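(* Let $g\in\mathbb{N}_{\ge2}$ and let $Q=(q_n)_{n=1}^\infty$ be a basic sequence with every $q_n\in\{g^k: k\in\mathbb{N}\}$, generated by $(X,\mathscr{B},\mu,T,f,x)$, where $(X,\mathscr{B},\mu,T)$ is ergodic and has zero (measure-theoretic) entropy, and $\int_X\log(f)\,d\mu<\infty$. Then $$\mathcal{N}(Q)=\mathcal{DN}(Q)=\mathcal{UN}(Q)=\mathcal{UDN}(Q)=\mathcal{N}_g.$$
   Context: Notation: $\mathbb{N}=\{1,2,\dots\}$, $\mathbb{N}_0=\mathbb{N}\cup\{0\}$, $\mathbb{N}_{\ge 2}=\{2,3,\dots\}$; $m$ is Lebesgue measure on $[0,1)$, which carries its usual topology. $\mathcal{N}_g$ is the set of $z\in[0,1)$ that are normal in base $g$ (every block of $k$ base-$g$ digits occurs with relative frequency $g^{-k}$ in the base-$g$ expansion of $z$, for every $k\in\mathbb{N}$). A basic sequence is a sequence $Q=(q_n)_{n=1}^\infty$ with $q_n\in\mathbb{N}_{\ge 2}$. Every $z\in[0,1)$ has a unique expansion $z=\sum_{n\ge1}\frac{z_n}{q_1\cdots q_n}$ with $z_n\in\{0,\dots,q_n-1\}$ and $z_n\ne q_n-1$ for infinitely many $n$; write $z=0.z_1z_2\cdots_Q$. A continuous measure preserving system $(X,\mathscr{B},\mu,T)$ consists of a complete separable metric space $X$, its Borel $\sigma$-algebra $\mathscr{B}$, a probability measure $\mu$ on $\mathscr{B}$ giving positive measure to every nonempty open set, and a continuous $\mu$-preserving map $T:X\to X$. A point $x\in X$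 is generic if $\frac1N\sum_{n=1}^N h(T^nx)\to\int_X h\,d\mu$ for every continuous $h:X\to\mathbb{C}$ with $h\in L^1(X,\mu)$. A continuous $f:X\to\mathbb{N}_{\ge2}$ (discrete target) generates the topology of $X$ if the topology of $X$ is the smallest topology $\tau$ on $X$ for which $f$ is continuous and $T^{-1}U\in\tau$ for all $U\in\tau$. $Q$ is generated by $(X,\mathscr{B},\mu,T,f,x)$ if $(X,\mathscr{B},\mu,T)$ is a continuous measure preserving system, $f:X\to\mathbb{N}_{\ge2}$ is continuous and generates the topology of $X$, $x$ is a generic point, and $q_n=f(T^nx)$ for all $n\ge1$. $\mathcal{DN}(Q)$ ($Q$-distribution normal numbers): the $z\in[0,1)$ for which $(q_nq_{n-1}\cdots q_1z)_{n\ge1}$ is uniformly distributed mod $1$. $\mathcal{N}(Q)$ ($Q$-normal numbers): for $D=(d_1,\dots,d_\ell)\in\mathbb{N}_0^\ell$ let $\mathcal{I}_{Q,j}(D)=1$ if $d_i<q_{j+i-1}$ for all $1\le i\le\ell$ and $0$ otherwise, $Q_n(D)=\sum_{j=1}^n\frac{\mathcal{I}_{Q,j}(D)}{q_jq_{j+1}\cdots q_{j+\ell-1}}$, and $N_n^Q(D,z)=\#\{1\le i\le n: z_{i+j}=d_j\ \forall\,1\le j\le\ell\}$. Then $z\in\mathcal{N}(Q)$ iff $\lim_n N_n^Q(D,z)/Q_n(D)=1$ for every block $D$ (of any length) with $\lim_nQ_n(D)=\infty$. $\mathcal{UN}(Q)$ (uniformly $Q$-normal numbers): for $D=(d_1,\dots,d_\ell)\in\mathbb{N}_0^\ell$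 and $B=(b_1,\dots,b_\ell)\in\mathbb{N}_{\ge2}^\ell$ let $S_B=\{j\in\mathbb{N}: (q_j,\dots,q_{j+\ell-1})=B\}$; let $Q_n(D,B)=\frac{|S_B\cap[1,n]|}{b_1\cdots b_\ell}$ if $d_i<b_i$ for all $i$, and $Q_n(D,B)=0$ otherwise; and $N_n^Q(D,B,z)=\#\{j\in S_B\cap[1,n]: z_{j+i-1}=d_i\ \forall\,1\le i\le\ell\}$. Then $z\in\mathcal{UN}(Q)$ iff for all $\ell$ and all $D,B$ of length $\ell$ with $\lim_n Q_n(D,B)=\infty$ we have $\lim_n N_n^Q(D,B,z)/Q_n(D,B)=1$. $\mathcal{UDN}(Q)$ (uniformly $Q$-distribution normal numbers): define $(T\rtimes M)(u,z)=(Tu,\,f(u)z \bmod 1)$ on $X\times[0,1)$. Then $z\in\mathcal{UDN}(Q)$ iff the sequence $\big((T\rtimes M)^{n-1}(Tx,z)\big)_{n\ge1}=\big(T^nx,\ q_{n-1}\cdots q_1z \bmod 1\big)_{n\ge1}$ is uniformly distributed with respect to $\mu\times m$, i.e. its averages $\frac1N\sum_{n=1}^N F(\cdot)$ converge to $\int F\,d(\mu\times m)$ for every bounded continuous $F:X\times[0,1)\to\mathbb{C}$. *)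

theory Defs
  imports "HOL-Probability.Probability"
begin

text \<open>
  Sequences indexed by the positive integers are functions on \<open>nat\<close> whose value at \<open>0\<close> is
  irrelevant. Blocks \<open>(d\<^sub>1, \<dots>, d\<^sub>l)\<close> with \<open>l \<ge> 1\<close> are nonempty lists, so \<open>d\<^sub>i\<close> is \<open>D ! (i - 1)\<close>.
\<close>

definition basic_sequence :: "(nat \<Rightarrow> nat) \<Rightarrow> bool" where
  "basic_sequence Q \<longleftrightarrow> (\<forall>n\<ge>1. Q n \<ge> 2)"

text \<open>The condition \<open>d 0 = 0\<close> only fixes the irrelevant value, so that the digit sequence is unique.\<close>

definition cantor_expansion :: "(nat \<Rightarrow> nat) \<Rightarrow> real \<Rightarrow> (nat \<Rightarrow> nat) \<Rightarrow> bool" where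
  "cantor_expansion Q z d \<longleftrightarrow>
     d 0 = 0 \<and> (\<forall>n\<ge>1. d n < Q n) \<and> infinite {n. n \<ge> 1 \<and> d n \<noteq> Q n - 1} \<and>
     (\<lambda>n. real (d (Suc n)) / (\<Prod>i=1..Suc n. real (Q i))) sums z"

definition cantor_digits :: "(nat \<Rightarrow> nat) \<Rightarrow> real \<Rightarrow> nat \<Rightarrow> nat" where
  "cantor_digits Q z = (THE d. cantor_expansion Q z d)"

definition normal_numbers_base :: "nat \<Rightarrow> real set" where
  "normal_numbers_base g =
     {z \<in> {0..<1}. \<forall>w. w \<noteq> [] \<and> (\<forall>i<length w. w ! i < g) \<longrightarrow>
        (\<lambda>n. real (card {i \<in> {1..n}. \<forall>j\<in>{1..length w}.
                 cantor_digits (\<lambda>_. g) z (i + j - 1) = w ! (j - 1)}) / real n)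
          \<longlonglongrightarrow> 1 / real g ^ length w}"

definition ud_mod1 :: "(nat \<Rightarrow> real) \<Rightarrow> bool" where
  "ud_mod1 s \<longleftrightarrow>
     (\<forall>a b. 0 \<le> a \<and> a < b \<and> b \<le> 1 \<longrightarrow>
        (\<lambda>N. real (card {n \<in> {1..N}. frac (s n) \<in> {a..<b}}) / real N) \<longlonglongrightarrow> b - a)"

definition DN_Q :: "(nat \<Rightarrow> nat) \<Rightarrow> real set" where
  "DN_Q Q = {z \<in> {0..<1}. ud_mod1 (\<lambda>n. (\<Prod>i=1..n. real (Q i)) * z)}"

definition admissible_at :: "(nat \<Rightarrow> nat) \<Rightarrow> nat \<Rightarrow> nat list \<Rightarrow> bool" where
  "admissible_at Q j D \<longleftrightarrow> (\<forall>i\<in>{1..length D}. D ! (i - 1) < Q (j + i - 1))"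

definition Q_sum :: "(nat \<Rightarrow> nat) \<Rightarrow> nat list \<Rightarrow> nat \<Rightarrow> real" where
  "Q_sum Q D n =
     (\<Sum>j=1..n. (if admissible_at Q j D then 1 else 0) / (\<Prod>i=1..length D. real (Q (j + i - 1))))"

definition Q_count :: "(nat \<Rightarrow> nat) \<Rightarrow> nat list \<Rightarrow> real \<Rightarrow> nat \<Rightarrow> nat" where
  "Q_count Q D z n =
     card {i \<in> {1..n}. \<forall>j\<in>{1..length D}. cantor_digits Q z (i + j) = D ! (j - 1)}"

definition N_Q :: "(nat \<Rightarrow> nat) \<Rightarrow> real set" where
  "N_Q Q =
     {z \<in> {0..<1}. \<forall>D. D \<noteq> [] \<and> filterlim (Q_sum Q D) at_top sequentially \<longrightarrow>
        (\<lambda>n. real (Q_count Q D z n) / Q_sum Q D n) \<longlonglongrightarrow> 1}"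

definition S_block :: "(nat \<Rightarrow> nat) \<Rightarrow> nat list \<Rightarrow> nat set" where
  "S_block Q B = {j. j \<ge> 1 \<and> (\<forall>i\<in>{1..length B}. Q (j + i - 1) = B ! (i - 1))}"

definition Q_sum2 :: "(nat \<Rightarrow> nat) \<Rightarrow> nat list \<Rightarrow> nat list \<Rightarrow> nat \<Rightarrow> real" where
  "Q_sum2 Q D B n =
     (if (\<forall>i<length D. D ! i < B ! i)
      then real (card (S_block Q B \<inter> {1..n})) / real (prod_list B) else 0)"

definition Q_count2 :: "(nat \<Rightarrow> nat) \<Rightarrow> nat list \<Rightarrow> nat list \<Rightarrow> real \<Rightarrow> nat \<Rightarrow> nat" where
  "Q_count2 Q D B z n =
     card {j \<in> S_block Q B \<inter> {1..n}.
             \<forall>i\<in>{1..length D}. cantor_digits Q z (j + i - 1) = D ! (i - 1)}"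

definition UN_Q :: "(nat \<Rightarrow> nat) \<Rightarrow> real set" where
  "UN_Q Q =
     {z \<in> {0..<1}. \<forall>D B. D \<noteq> [] \<and> length B = length D \<and> (\<forall>b\<in>set B. b \<ge> 2) \<and>
          filterlim (Q_sum2 Q D B) at_top sequentially \<longrightarrow>
        (\<lambda>n. real (Q_count2 Q D B z n) / Q_sum2 Q D B n) \<longlonglongrightarrow> 1}"

definition continuous_mps :: "'a::polish_space measure \<Rightarrow> ('a \<Rightarrow> 'a) \<Rightarrow> bool" where
  "continuous_mps M T \<longleftrightarrow>
     prob_space M \<and> sets M = sets borel \<and>
     (\<forall>U. open U \<and> U \<noteq> {} \<longrightarrow> measure M U > 0) \<and>
     continuous_on UNIV T \<and>
     (\<forall>A\<in>sets M. measure M (T -` A) = measure M A)"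

definition generic_point :: "'a::polish_space measure \<Rightarrow> ('a \<Rightarrow> 'a) \<Rightarrow> 'a \<Rightarrow> bool" where
  "generic_point M T x \<longleftrightarrow>
     (\<forall>h::'a \<Rightarrow> complex. continuous_on UNIV h \<and> integrable M h \<longrightarrow>
        (\<lambda>N. (\<Sum>n=1..N. h ((T ^^ n) x)) / of_nat N) \<longlonglongrightarrow> (\<integral>u. h u \<partial>M))"

definition makes_continuous :: "('a \<Rightarrow> 'a) \<Rightarrow> ('a \<Rightarrow> nat) \<Rightarrow> 'a topology \<Rightarrow> bool" where
  "makes_continuous T f \<tau> \<longleftrightarrow>
     topspace \<tau> = UNIV \<and> continuous_map \<tau> (discrete_topology UNIV) f \<and>
     (\<forall>U. openin \<tau> U \<longrightarrow> openin \<tau> (T -` U))"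

definition generates_topology :: "('a::topological_space \<Rightarrow> 'a) \<Rightarrow> ('a \<Rightarrow> nat) \<Rightarrow> bool" where
  "generates_topology T f \<longleftrightarrow>
     makes_continuous T f euclidean \<and>
     (\<forall>\<tau>. makes_continuous T f \<tau> \<longrightarrow> (\<forall>U. open U \<longrightarrow> openin \<tau> U))"

definition generated_by ::
  "(nat \<Rightarrow> nat) \<Rightarrow> 'a::polish_space measure \<Rightarrow> ('a \<Rightarrow> 'a) \<Rightarrow> ('a \<Rightarrow> nat) \<Rightarrow> 'a \<Rightarrow> bool" where
  "generated_by Q M T f x \<longleftrightarrow>
     continuous_mps M T \<and>
     (\<forall>u. f u \<ge> 2) \<and> continuous_on UNIV f \<and> generates_topology T f \<and>
     generic_point M T x \<and> (\<forall>n\<ge>1. Q n = f ((T ^^ n) x))"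

definition ergodic :: "'a measure \<Rightarrow> ('a \<Rightarrow> 'a) \<Rightarrow> bool" where
  "ergodic M T \<longleftrightarrow>
     (\<forall>A\<in>sets M. T -` A \<inter> space M = A \<longrightarrow> measure M A = 0 \<or> measure M A = 1)"

definition measurable_partition :: "'a measure \<Rightarrow> 'a set set \<Rightarrow> bool" where
  "measurable_partition M P \<longleftrightarrow> finite P \<and> P \<subseteq> sets M \<and> partition_on (space M) P"

text \<open>
  \<open>0 * ln 0 = 0\<close> in HOL, so null cells contribute nothing.
\<close>

definition partition_entropy :: "'a measure \<Rightarrow> 'a set set \<Rightarrow> real" where
  "partition_entropy M P = - (\<Sum>A\<in>P. measure M A * ln (measure M A))"

definition partition_join :: "'a set set \<Rightarrow> 'a set set \<Rightarrow> 'a set set" where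
  "partition_join P R = {A \<inter> B | A B. A \<in> P \<and> B \<in> R} - {{}}"

text \<open>\<open>iterated_join M T P n\<close> is the join of \<open>(T ^^ i) -` P\<close> for \<open>i < n\<close>.\<close>

fun iterated_join :: "'a measure \<Rightarrow> ('a \<Rightarrow> 'a) \<Rightarrow> 'a set set \<Rightarrow> nat \<Rightarrow> 'a set set" where
  "iterated_join M T P 0 = {space M}"
| "iterated_join M T P (Suc n) =
     partition_join P ((\<lambda>A. T -` A \<inter> space M) ` iterated_join M T P n)"

text \<open>
  For measure preserving \<open>T\<close> the entropies of the iterated joins are subadditive in \<open>n\<close>, so the
  upper limit below is a limit.
\<close>

definition entropy_wrt_partition :: "'a measure \<Rightarrow> ('a \<Rightarrow> 'a) \<Rightarrow> 'a set set \<Rightarrow> ereal" where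
  "entropy_wrt_partition M T P =
     limsup (\<lambda>n. ereal (partition_entropy M (iterated_join M T P n) / real n))"

definition ks_entropy :: "'a measure \<Rightarrow> ('a \<Rightarrow> 'a) \<Rightarrow> ereal" where
  "ks_entropy M T = (SUP P\<in>{P. measurable_partition M P}. entropy_wrt_partition M T P)"

text \<open>\<open>[0, 1)\<close> carries its subspace topology from the real line, not that of the circle.\<close>

definition lebesgue01 :: "real measure" where
  "lebesgue01 = restrict_space lborel {0..<1}"

definition skew_product :: "('a \<Rightarrow> 'a) \<Rightarrow> ('a \<Rightarrow> nat) \<Rightarrow> 'a \<times> real \<Rightarrow> 'a \<times> real" where
  "skew_product T f = (\<lambda>(u, z). (T u, frac (real (f u) * z)))"

definition UDN_Q ::
  "'a::polish_space measure \<Rightarrow> ('a \<Rightarrow> 'a) \<Rightarrow> ('a \<Rightarrow> nat) \<Rightarrow> 'a \<Rightarrow> real set" where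
  "UDN_Q M T f x =
     {z \<in> {0..<1}. \<forall>F :: 'a \<times> real \<Rightarrow> complex.
        continuous_on (UNIV \<times> {0..<1}) F \<and> bounded (F ` (UNIV \<times> {0..<1})) \<longrightarrow>
        (\<lambda>N. (\<Sum>n=1..N. F ((skew_product T f ^^ (n - 1)) (T x, z))) / of_nat N)
          \<longlonglongrightarrow> (\<integral>v. F v \<partial>(M \<Otimes>\<^sub>M lebesgue01))}"

end

theory Submission
  imports Defs "HOL-Real_Asymp.Real_Asymp"
begin

text \<open>
  Write \<open>f = g^k\<close>, let \<open>\<kappa>\<close> be the mean of \<open>k\<close>, and let \<open>r\<^sub>j\<close> be the fractional part of
  \<open>q\<^sub>1 \<cdots> q\<^sub>j z\<close>. All five sets are shown to equal the set of \<open>z\<close> for which every pair of a block \<open>B\<close>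
  of values of \<open>f\<close> and an admissible digit block \<open>D\<close> occurs jointly with frequency
  \<open>\<mu>(B) / \<Prod>B\<close>. From this condition the five properties follow by approximation, because
  relatively open subsets of the phase space are countable disjoint unions of such cells.

  The converse uses zero entropy by counting. For large \<open>n\<close>, all but an \<open>\<epsilon>\<close>-fraction of the windows
  of length \<open>n\<close> of \<open>Q\<close> lie in a set of at most \<open>exp (\<epsilon> n)\<close> blocks, while by a martingale bound only an
  \<open>exp (- c n)\<close>-fraction of the digit blocks admissible for a fixed block has the wrong statistics. Hence any upper
  bound \<open>C |I|\<close> for the frequency of visits of \<open>r\<^sub>j\<close> to the \<open>g\<close>-adic intervals \<open>I\<close> makes the bad windows rare:
  \<open>C = 1\<close> for distribution normality and \<open>C = \<kappa>\<close> for normality in base \<open>g\<close>. For \<open>Q\<close>-normality only the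
  frequency of digit blocks is known; it is compared with \<open>g powr (- \<kappa> n)\<close>, which is where ergodicity
  enters.
\<close>

section \<open>Cantor series digits\<close>

text \<open>The counting argument is one-sided: upper bounds for visits to bad cells enter, and
  averaging over overlapping windows turns the rarity of bad windows into an exact frequency. In the
  opposite direction only lower bounds on open sets are proved; partitions of total mass one,
  complements and staircases of superlevel sets turn them into limits. The order of the constants
  matters. The martingale rate \<open>c\<close> depends only on the tolerance and the length of the
  tested block, so \<open>\<epsilon>\<close> is taken small against \<open>c\<close> before the
  window length \<open>n\<close> is chosen, and \<open>exp (\<epsilon> n)\<close> symbol blocks
  cannot use up the gain \<open>exp (- c n)\<close>. Powers of \<open>g\<close> enter twice: the
  product over a symbol block is a power of \<open>g\<close>, so its cells are \<open>g\<close>-adic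
  intervals, and the remainders along \<open>Q\<close> form a subsequence of the base
  \<open>g\<close> remainders whose density is governed by the mean exponent. An obstacle is that
  exponents may be unbounded while entropy sees finite partitions only. Large exponents are
  therefore counted separately, and integrability of \<open>log f\<close> keeps their total share
  small.\<close>

lemma map_window_eq_iff:
  fixes d :: "nat \<Rightarrow> nat"
  shows "map (\<lambda>i. d (j + i)) [0..<length w] = w \<longleftrightarrow> (\<forall>i\<in>{1..length w}. d (j + i - 1) = w ! (i - 1))"
proof
  assume eq: "map (\<lambda>i. d (j + i)) [0..<length w] = w"
  show "\<forall>i\<in>{1..length w}. d (j + i - 1) = w ! (i - 1)"
  proof
    fix i assume i: "i \<in> {1..length w}"
    have "w ! (i - 1) = map (\<lambda>i. d (j + i)) [0..<length w] ! (i - 1)" by (simp only: eq)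
    also have "\<dots> = d (j + i - 1)" using i by (cases i) auto
    finally show "d (j + i - 1) = w ! (i - 1)" by simp
  qed
next
  assume *: "\<forall>i\<in>{1..length w}. d (j + i - 1) = w ! (i - 1)"
  have "d (j + i) = w ! i" if "i < length w" for i
    using bspec[OF *, of "Suc i"] that by simp
  then show "map (\<lambda>i. d (j + i)) [0..<length w] = w"
    by (intro nth_equalityI) auto
qed

section \<open>Finite digit blocks and mixed radix intervals\<close>

primrec digs :: "nat list \<Rightarrow> real \<Rightarrow> nat list" where
  "digs [] r = []"
| "digs (b # B) r = nat \<lfloor>real b * r\<rfloor> # digs B (frac (real b * r))"

text \<open>Mixed radix value with the most significant digit first, that is, the numerator of the
  left endpoint of a cell; unmatched tails contribute 0.\<close>

fun block_value :: "nat list \<Rightarrow> nat list \<Rightarrow> nat" where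
  "block_value (b # B) (d # D) = d * prod_list B + block_value B D"
| "block_value _ _ = 0"

definition cell_interval :: "nat list \<Rightarrow> nat list \<Rightarrow> real set" where
  "cell_interval B D =
     {real (block_value B D) / real (prod_list B)..<(real (block_value B D) + 1) / real (prod_list B)}"

lemma length_digs [simp]: "length (digs B r) = length B"
  by (induction B arbitrary: r) auto

lemma block_value_less: "list_all2 (<) D B \<Longrightarrow> block_value B D < prod_list B"
proof (induction rule: list_all2_induct)
  case (Cons d D b B)
  have "d * prod_list B + block_value B D < Suc d * prod_list B" using Cons by simp
  also have "\<dots> \<le> b * prod_list B" using Cons by (intro mult_right_mono) auto
  finally show ?case by simp
qed simp

lemma digs_less:
  assumes "0 \<le> r" "r < 1" "\<forall>b\<in>set B. b > 0"
  shows "list_all2 (<) (digs B r) B"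
  using assms
proof (induction B arbitrary: r)
  case (Cons b B)
  have "real b * r < real b" using Cons by simp
  then have "\<lfloor>real b * r\<rfloor> < int b" by linarith
  moreover have "list_all2 (<) (digs B (frac (real b * r))) B"
    using Cons by (intro Cons.IH) (auto simp: frac_lt_1)
  ultimately show ?case using Cons by (simp add: nat_less_iff)
qed simp

lemma floor_eq_iff_bounds: "nat \<lfloor>y\<rfloor> = d \<longleftrightarrow> real d \<le> y \<and> y < real d + 1" if "0 \<le> y" for y :: real
  using that by linarith

text \<open>Multiplying by the full product reduces both sides to bounds between integers. The tail
  value stays below the tail product, so the interval determines the leading digit, and the rest is
  the induction hypothesis for \<open>frac y\<close>.\<close>

lemma digs_eq_iff:
  assumes "list_all2 (<) D B" "0 \<le> r" "r < 1"
  shows "digs B r = D \<longleftrightarrow> r \<in> cell_interval B D"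
  using assms
proof (induction arbitrary: r rule: list_all2_induct)
  case Nil
  then show ?case by (simp add: cell_interval_def)
next
  case (Cons d D b B)
  define P where "P = real (prod_list B)"
  define v where "v = real (block_value B D)"
  have vP: "v + 1 \<le> P" "0 \<le> v"
    using block_value_less[OF Cons.hyps(2)] unfolding v_def P_def by linarith+
  then have P: "P > 0" by linarith
  have b: "real b > 0" using Cons by simp
  define y where "y = real b * r"
  have y: "0 \<le> y" using b Cons unfolding y_def by simp
  have fr: "digs B (frac y) = D \<longleftrightarrow> frac y \<in> cell_interval B D"
    by (rule Cons.IH) (auto simp: frac_lt_1)
  have eq: "digs (b # B) r = d # D \<longleftrightarrow> nat \<lfloor>y\<rfloor> = d \<and> v \<le> P * frac y \<and> P * frac y < v + 1"
    using fr P by (simp add: y_def cell_interval_def v_def P_def field_simps)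
  have "r \<in> cell_interval (b # B) (d # D) \<longleftrightarrow> d * P + v \<le> P * y \<and> P * y < d * P + v + 1"
    using b P by (simp add: y_def cell_interval_def v_def P_def field_simps)
  moreover have "P * frac y = P * y - d * P" if "nat \<lfloor>y\<rfloor> = d"
  proof -
    have "frac y = y - real d" using that y by (auto simp: frac_def)
    then show ?thesis by (simp only: right_diff_distrib mult.commute)
  qed
  moreover have "nat \<lfloor>y\<rfloor> = d" if "d * P + v \<le> P * y" "P * y < d * P + v + 1"
  proof -
    have "P * real d \<le> P * y" "P * y < P * (real d + 1)"
      using that vP mult.commute[of "real d" P] distrib_left[of P "real d" 1] by linarith+
    then have "real d \<le> y" "y < real d + 1" using P by (auto simp only: mult_le_cancel_left_pos mult_less_cancel_left_pos)
    then show ?thesis using P y by (subst floor_eq_iff_bounds) auto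
  qed
  ultimately show ?case unfolding eq by smt
qed

lemma cell_interval_subset:
  assumes "list_all2 (<) D B"
  shows "cell_interval B D \<subseteq> {0..<1}"
proof -
  have *: "real (block_value B D) + 1 \<le> real (prod_list B)"
    using block_value_less[OF assms] by linarith
  then have "(real (block_value B D) + 1) / real (prod_list B) \<le> 1"
    by (simp add: divide_le_eq)
  then show ?thesis unfolding cell_interval_def
    by (fastforce intro: order_trans[rotated])
qed

section \<open>Remainders, greedy digits and uniqueness of the Cantor expansion\<close>

definition bprod :: "(nat \<Rightarrow> nat) \<Rightarrow> nat \<Rightarrow> real" where
  "bprod Q n = (\<Prod>i=1..n. real (Q i))"

lemma bprod_0 [simp]: "bprod Q 0 = 1"
  by (simp add: bprod_def)

lemma bprod_Suc: "bprod Q (Suc n) = bprod Q n * real (Q (Suc n))"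
  by (simp add: bprod_def)

lemma cantor_expansion_altdef:
  "cantor_expansion Q z d \<longleftrightarrow>
     d 0 = 0 \<and> (\<forall>n\<ge>1. d n < Q n) \<and> infinite {n. n \<ge> 1 \<and> d n \<noteq> Q n - 1} \<and>
     (\<lambda>n. real (d (Suc n)) / bprod Q (Suc n)) sums z"
  unfolding cantor_expansion_def bprod_def ..

text \<open>The remainder after \<open>n\<close> digits. Digit \<open>n + 1\<close> is read from it,
  hence the shift \<open>j - 1\<close> wherever a digit position \<open>j\<close> meets a
  remainder.\<close>

definition orbit_rem :: "(nat \<Rightarrow> nat) \<Rightarrow> real \<Rightarrow> nat \<Rightarrow> real" where
  "orbit_rem Q z n = frac (bprod Q n * z)"

lemma orbit_rem_bounds: "0 \<le> orbit_rem Q z n" "orbit_rem Q z n < 1"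
  by (auto simp: orbit_rem_def frac_lt_1)

lemma frac_nat_mult_frac: "frac (real b * frac y) = frac (real b * y)"
proof -
  have eq: "real b * frac y = real b * y - of_int (int b * \<lfloor>y\<rfloor>)" by (simp add: frac_def algebra_simps)
  have "frac (u - of_int m) = frac u" for u :: real and m by (simp add: frac_def)
  then show ?thesis unfolding eq .
qed

lemma orbit_rem_Suc: "orbit_rem Q z (Suc n) = frac (real (Q (Suc n)) * orbit_rem Q z n)"
  unfolding orbit_rem_def frac_nat_mult_frac by (simp add: bprod_Suc mult_ac)

lemma bprod_ge: assumes "basic_sequence Q" shows "bprod Q n \<ge> 2 ^ n"
proof (induction n)
  case (Suc n)
  have "Q (Suc n) \<ge> 2" using assms unfolding basic_sequence_def by simp
  then have "real (Q (Suc n)) \<ge> 2" by linarith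
  moreover have "0 \<le> bprod Q n" by (simp add: bprod_def prod_nonneg)
  ultimately have "2 ^ n * 2 \<le> bprod Q n * real (Q (Suc n))" using Suc by (intro mult_mono) auto
  then show ?case by (simp add: bprod_Suc mult_ac)
qed simp

lemma bprod_pos: assumes "basic_sequence Q" shows "bprod Q n > 0"
  using less_le_trans[OF _ bprod_ge[OF assms, of n]] by simp

lemma inverse_bprod_tendsto: assumes "basic_sequence Q" shows "(\<lambda>n. 1 / bprod Q n) \<longlonglongrightarrow> 0"
proof (rule tendsto_sandwich[of "\<lambda>_. 0" _ _ "\<lambda>n. (1/2) ^ n"])
  show "\<forall>\<^sub>F n in sequentially. 1 / bprod Q n \<le> (1/2) ^ n"
    using bprod_ge[OF assms] by (intro always_eventually allI) (simp add: power_one_over frac_le)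
qed (use less_imp_le[OF bprod_pos[OF assms]] in \<open>auto intro!: LIMSEQ_power_zero\<close>)

text \<open>The value 0 at index 0 matches the normalisation in
  \<open>cantor_expansion\<close>.\<close>

definition greedy_digit :: "(nat \<Rightarrow> nat) \<Rightarrow> real \<Rightarrow> nat \<Rightarrow> nat" where
  "greedy_digit Q z n = (if n = 0 then 0 else nat \<lfloor>real (Q n) * orbit_rem Q z (n - 1)\<rfloor>)"

lemma greedy_digit_Suc:
  "real (greedy_digit Q z (Suc n)) = \<lfloor>bprod Q (Suc n) * z\<rfloor> - Q (Suc n) * \<lfloor>bprod Q n * z\<rfloor>"
proof -
  have "real (Q (Suc n)) * orbit_rem Q z n = bprod Q (Suc n) * z - of_int (int (Q (Suc n)) * \<lfloor>bprod Q n * z\<rfloor>)"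
    by (simp add: orbit_rem_def frac_def bprod_Suc algebra_simps)
  then have "\<lfloor>real (Q (Suc n)) * orbit_rem Q z n\<rfloor> = \<lfloor>bprod Q (Suc n) * z\<rfloor> - int (Q (Suc n)) * \<lfloor>bprod Q n * z\<rfloor>"
    by (metis floor_diff_of_int)
  moreover have "0 \<le> \<lfloor>real (Q (Suc n)) * orbit_rem Q z n\<rfloor>"
    using orbit_rem_bounds by simp
  ultimately show ?thesis unfolding greedy_digit_def
    by (simp)
qed

text \<open>By \<open>greedy_digit_Suc\<close> consecutive terms telescope, so each partial sum is
  \<open>z\<close> truncated to denominator \<open>bprod Q n\<close>. The bounds on \<open>z\<close>
  give the base case, where the integer part is 0.\<close>

lemma sum_greedy_digit:
  assumes "basic_sequence Q" "0 \<le> z" "z < 1"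
  shows "(\<Sum>i<n. real (greedy_digit Q z (Suc i)) / bprod Q (Suc i)) = \<lfloor>bprod Q n * z\<rfloor> / bprod Q n"
proof (induction n)
  case 0
  then show ?case using assms by (simp add: floor_eq_iff)
next
  case (Suc n)
  have "bprod Q n > 0" "bprod Q (Suc n) > 0" using bprod_pos[OF assms(1)] by auto
  moreover have "bprod Q (Suc n) = bprod Q n * Q (Suc n)" by (rule bprod_Suc)
  moreover have "(\<Sum>i<Suc n. real (greedy_digit Q z (Suc i)) / bprod Q (Suc i)) =
      \<lfloor>bprod Q n * z\<rfloor> / bprod Q n + real (greedy_digit Q z (Suc n)) / bprod Q (Suc n)"
    using Suc by simp
  ultimately have "(\<Sum>i<Suc n. real (greedy_digit Q z (Suc i)) / bprod Q (Suc i)) =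
      \<lfloor>bprod Q n * z\<rfloor> / bprod Q n +
      (\<lfloor>bprod Q (Suc n) * z\<rfloor> - Q (Suc n) * \<lfloor>bprod Q n * z\<rfloor>) / (bprod Q n * Q (Suc n))"
    by (simp only: greedy_digit_Suc)
  also have "\<dots> = \<lfloor>bprod Q (Suc n) * z\<rfloor> / (bprod Q n * Q (Suc n))"
  proof -
    have *: "a / p + (c - q * a) / (p * q) = c / (p * q)" if "p > 0" "p * q > 0" for a c p q :: real
      proof -
      have "p \<noteq> 0" "q \<noteq> 0" using that by auto
      then show ?thesis by (simp add: field_simps)
    qed
    show ?thesis unfolding of_int_diff of_int_mult of_int_of_nat_eq by (rule *) (use \<open>bprod Q n > 0\<close> \<open>bprod Q (Suc n) > 0\<close> in \<open>simp_all add: bprod_Suc\<close>)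
  qed
  finally show ?case by (simp only: bprod_Suc)
qed

lemma cantor_expansion_greedy:
  assumes Q: "basic_sequence Q" and z: "0 \<le> z" "z < 1"
  shows "cantor_expansion Q z (greedy_digit Q z)"
  unfolding cantor_expansion_altdef
proof (intro conjI allI impI)
  let ?s = "\<lambda>n. \<lfloor>bprod Q n * z\<rfloor> / bprod Q n"
  have gt: "z < ?s n + 1 / bprod Q n" for n
  proof -
    have "bprod Q n * z < \<lfloor>bprod Q n * z\<rfloor> + 1" by linarith
    then show ?thesis using bprod_pos[OF Q, of n] by (simp add: field_simps)
  qed
  have le: "?s n \<le> z" for n
    using bprod_pos[OF Q, of n] by (simp add: field_simps)
  have lim: "?s \<longlonglongrightarrow> z"
  proof (rule tendsto_sandwich[of "\<lambda>n. z - 1 / bprod Q n" _ _ "\<lambda>_. z"])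
    show "(\<lambda>n. z - 1 / bprod Q n) \<longlonglongrightarrow> z"
      using tendsto_diff[OF tendsto_const inverse_bprod_tendsto[OF Q]] by simp
  qed (use le gt less_imp_le in \<open>auto simp: algebra_simps intro!: always_eventually\<close>)
  show "(\<lambda>n. real (greedy_digit Q z (Suc n)) / bprod Q (Suc n)) sums z"
    unfolding sums_def sum_greedy_digit[OF Q z] by (rule lim)
  show "greedy_digit Q z n < Q n" if "n \<ge> 1" for n
  proof -
    have "Q n > 0" using Q that unfolding basic_sequence_def by force
    then have "real (Q n) * orbit_rem Q z (n - 1) < Q n" using orbit_rem_bounds by simp
    then have "\<lfloor>real (Q n) * orbit_rem Q z (n - 1)\<rfloor> < int (Q n)" by linarith
    then show ?thesis using that \<open>Q n > 0\<close> by (simp add: greedy_digit_def nat_less_iff)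
  qed
  show "infinite {n. 1 \<le> n \<and> greedy_digit Q z n \<noteq> Q n - 1}"
  proof
    assume "finite {n. 1 \<le> n \<and> greedy_digit Q z n \<noteq> Q n - 1}"
    then obtain m where m0: "\<forall>n\<in>{n. 1 \<le> n \<and> greedy_digit Q z n \<noteq> Q n - 1}. n \<le> m"
      using finite_nat_set_iff_bounded_le by blast
    have m: "greedy_digit Q z (Suc n) = Q (Suc n) - 1" if "n \<ge> m" for n
    proof (rule ccontr)
      assume "greedy_digit Q z (Suc n) \<noteq> Q (Suc n) - 1"
      then have "Suc n \<le> m" using m0 by auto
      then show False using that by simp
    qed
    \<comment> \<open>With maximal digits the right endpoint of the current interval never moves, so
      it equals the limit \<open>z\<close>, contradicting the strict bound
      \<open>gt\<close>.\<close>
    have const: "?s n + 1 / bprod Q n = ?s m + 1 / bprod Q m" if "n \<ge> m" for n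
      using that
    proof (induction n rule: dec_induct)
      case (step n)
      have "Q (Suc n) \<ge> 2" using Q unfolding basic_sequence_def by simp
      then have "real (greedy_digit Q z (Suc n)) = real (Q (Suc n)) - 1" using m[OF step(1)] by simp
      moreover have "bprod Q n > 0" "bprod Q (Suc n) > 0" using bprod_pos[OF Q] by auto
      moreover have "bprod Q (Suc n) = bprod Q n * Q (Suc n)" by (rule bprod_Suc)
      moreover have "?s (Suc n) = ?s n + real (greedy_digit Q z (Suc n)) / bprod Q (Suc n)"
        using sum_greedy_digit[OF Q z, of n] sum_greedy_digit[OF Q z, of "Suc n"] by simp
      ultimately have "?s (Suc n) + 1 / bprod Q (Suc n) = ?s n + real (Q (Suc n)) / bprod Q (Suc n)"
        by (simp add: diff_divide_distrib)
      also have "real (Q (Suc n)) / bprod Q (Suc n) = 1 / bprod Q n"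
        using \<open>Q (Suc n) \<ge> 2\<close> by (simp add: bprod_Suc)
      finally have "?s (Suc n) + 1 / bprod Q (Suc n) = ?s n + 1 / bprod Q n" .
      then show ?case using step by simp
    qed simp
    have "(\<lambda>n. ?s n + 1 / bprod Q n) \<longlonglongrightarrow> z + 0"
      by (intro tendsto_add lim inverse_bprod_tendsto Q)
    moreover have "(\<lambda>n. ?s n + 1 / bprod Q n) \<longlonglongrightarrow> ?s m + 1 / bprod Q m"
      by (rule tendsto_eventually[OF eventually_mono[OF eventually_ge_at_top[of m] const]])
    ultimately have "z = ?s m + 1 / bprod Q m" using LIMSEQ_unique by fastforce
    then show False using gt[of m] by simp
  qed
qed (simp add: greedy_digit_def)

text \<open>An arbitrary expansion is pinned down by integer parts: the scaled partial sum is an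
  integer, and the decreasing right endpoints keep \<open>z\<close> within one unit of it.
  Uniqueness follows by taking differences.\<close>

lemma cantor_expansion_partial_sum:
  assumes Q: "basic_sequence Q" and d: "cantor_expansion Q z d"
  shows "\<lfloor>bprod Q n * z\<rfloor> = bprod Q n * (\<Sum>i<n. real (d (Suc i)) / bprod Q (Suc i))"
proof -
  let ?s = "\<lambda>n. \<Sum>i<n. real (d (Suc i)) / bprod Q (Suc i)"
  have sums: "?s \<longlonglongrightarrow> z" using d unfolding cantor_expansion_altdef sums_def by blast
  have pos: "bprod Q n > 0" for n using bprod_pos[OF Q] .
  have step: "?s (Suc n) + 1 / bprod Q (Suc n) \<le> ?s n + 1 / bprod Q n"
    and step_strict: "d (Suc n) \<noteq> Q (Suc n) - 1 \<Longrightarrow> ?s (Suc n) + 1 / bprod Q (Suc n) < ?s n + 1 / bprod Q n" for n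
  proof -
    have 1: "d (Suc n) < Q (Suc n)" using d unfolding cantor_expansion_altdef by auto
    have eq: "bprod Q (Suc n) = bprod Q n * Q (Suc n)" by (rule bprod_Suc)
    have Qp: "real (Q (Suc n)) > 0" using 1 by simp
    have "?s (Suc n) + 1 / bprod Q (Suc n) = ?s n + (real (d (Suc n)) + 1) / (bprod Q n * Q (Suc n))"
      by (simp add: bprod_Suc add_divide_distrib)
    moreover have "(real (d (Suc n)) + 1) / (bprod Q n * Q (Suc n)) \<le> 1 / bprod Q n"
    proof -
      have "bprod Q n * (real (d (Suc n)) + 1) \<le> bprod Q n * real (Q (Suc n))"
        using 1 pos[of n] by (intro mult_left_mono) auto
      then show ?thesis using pos[of n] Qp by (simp add: field_simps)
    qed
    moreover have "(real (d (Suc n)) + 1) / (bprod Q n * Q (Suc n)) < 1 / bprod Q n" if "d (Suc n) \<noteq> Q (Suc n) - 1"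
    proof -
      have "real (d (Suc n)) + 1 < Q (Suc n)" using 1 that by linarith
      then have "bprod Q n * (real (d (Suc n)) + 1) < bprod Q n * real (Q (Suc n))"
        using pos[of n] by (intro mult_strict_left_mono) auto
      then show ?thesis using pos[of n] Qp by (simp add: field_simps)
    qed
    ultimately show "?s (Suc n) + 1 / bprod Q (Suc n) \<le> ?s n + 1 / bprod Q n"
      and "d (Suc n) \<noteq> Q (Suc n) - 1 \<Longrightarrow> ?s (Suc n) + 1 / bprod Q (Suc n) < ?s n + 1 / bprod Q n"
      by auto
  qed
  have anti: "?s m + 1 / bprod Q m \<le> ?s n + 1 / bprod Q n" if "n \<le> m" for n m
    using that by (rule lift_Suc_antimono_le[of "\<lambda>n. ?s n + 1 / bprod Q n", OF step])
  have lim: "(\<lambda>n. ?s n + 1 / bprod Q n) \<longlonglongrightarrow> z"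
    using tendsto_add[OF sums inverse_bprod_tendsto[OF Q]] by simp
  have upper: "z \<le> ?s m + 1 / bprod Q m" for m
    using LIMSEQ_le_const2[OF lim] anti by blast
  \<comment> \<open>A later nonmaximal digit makes the right endpoint drop strictly, so the upper
    bound for \<open>z\<close> is strict.\<close>
  have "infinite {n. n \<ge> 1 \<and> d n \<noteq> Q n - 1}" using d unfolding cantor_expansion_altdef by blast
  then obtain m where m: "m > n" "d m \<noteq> Q m - 1" unfolding infinite_nat_iff_unbounded by blast
  then obtain m' where m': "m = Suc m'" "m' \<ge> n" by (cases m) auto
  have lt: "z < ?s n + 1 / bprod Q n"
    using upper[of m] step_strict[of m'] anti[OF m'(2)] m m' by simp
  have le: "?s n \<le> z"
    by (rule incseq_le[OF _ sums]) (intro incseq_SucI, use less_imp_le[OF pos] in auto)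
  have "\<exists>a::int. bprod Q n * ?s n = a"
  proof (induction n)
    case (Suc n)
    then obtain a :: int where a: "bprod Q n * ?s n = a" by blast
    have eq: "bprod Q (Suc n) = bprod Q n * Q (Suc n)" by (rule bprod_Suc)
    have "bprod Q (Suc n) * ?s (Suc n) = bprod Q n * ?s n * Q (Suc n) + d (Suc n)"
      using less_imp_neq[OF pos[of n]] less_imp_neq[OF pos[of "Suc n"]] unfolding sum.lessThan_Suc distrib_left by (auto simp: bprod_Suc mult_ac)
    then have "bprod Q (Suc n) * ?s (Suc n) = of_int (a * int (Q (Suc n)) + int (d (Suc n)))"
      unfolding a by simp
    then show ?case by blast
  qed simp
  then obtain a :: int where a: "bprod Q n * ?s n = a" by blast
  have "bprod Q n * ?s n \<le> bprod Q n * z" "bprod Q n * z < bprod Q n * (?s n + 1 / bprod Q n)"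
    using mult_left_mono[OF le less_imp_le[OF pos]] mult_strict_left_mono[OF lt pos] .
  then have "a \<le> bprod Q n * z" "bprod Q n * z < a + 1"
    using pos[of n] unfolding distrib_left a by auto
  then have "\<lfloor>bprod Q n * z\<rfloor> = a" by linarith
  then show ?thesis using a by simp
qed

lemma cantor_expansion_unique:
  assumes Q: "basic_sequence Q" and "cantor_expansion Q z d" "cantor_expansion Q z d'"
  shows "d = d'"
proof
  fix n
  show "d n = d' n"
  proof (cases n)
    case 0
    then show ?thesis using assms unfolding cantor_expansion_altdef by simp
  next
    case (Suc m)
    have pos: "bprod Q n > 0" for n using bprod_pos[OF Q] .
    have "(\<Sum>i<n. real (d (Suc i)) / bprod Q (Suc i)) = (\<Sum>i<n. real (d' (Suc i)) / bprod Q (Suc i))" for n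
    proof -
      have ne: "bprod Q n \<noteq> 0" using pos[of n] by linarith
      have "bprod Q n * (\<Sum>i<n. real (d (Suc i)) / bprod Q (Suc i)) = bprod Q n * (\<Sum>i<n. real (d' (Suc i)) / bprod Q (Suc i))"
        by (rule trans[OF cantor_expansion_partial_sum[OF Q assms(2), symmetric] cantor_expansion_partial_sum[OF Q assms(3)]])
      then show ?thesis by (rule mult_left_cancel[OF ne, THEN iffD1])
    qed
    from this[of m] this[of "Suc m"] have "real (d (Suc m)) / bprod Q (Suc m) = real (d' (Suc m)) / bprod Q (Suc m)"
      by simp
    then show ?thesis using pos[of "Suc m"] Suc by (simp)
  qed
qed

lemma cantor_digits_eq_greedy:
  assumes "basic_sequence Q" "0 \<le> z" "z < 1"
  shows "cantor_digits Q z = greedy_digit Q z"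
  unfolding cantor_digits_def
  using cantor_expansion_greedy[OF assms] cantor_expansion_unique[OF assms(1)] by (intro the_equality)

text \<open>Reduces a window of the infinite digit sequence to the finite expansion of a single
  remainder, so that joint statements about symbols and digits become statements about
  intervals.\<close>

lemma digit_window:
  assumes "basic_sequence Q" "0 \<le> z" "z < 1"
  shows "map (\<lambda>i. cantor_digits Q z (Suc n + i)) [0..<l] =
    digs (map (\<lambda>i. Q (Suc n + i)) [0..<l]) (orbit_rem Q z n)"
proof (induction l arbitrary: n)
  case (Suc l)
  have *: "[0..<Suc l] = 0 # map Suc [0..<l]" by (metis map_Suc_upt upt_conv_Cons zero_less_Suc)
  show ?case using Suc[of "Suc n"]
    unfolding * by (simp add: comp_def orbit_rem_Suc cantor_digits_eq_greedy[OF assms] greedy_digit_def)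
qed simp

section \<open>Deviations in boxes of digits\<close>

abbreviation digit_box :: "nat list \<Rightarrow> nat list set" where
  "digit_box B \<equiv> {D. list_all2 (<) D B}"

text \<open>The deviation argument reveals digits from left to right, so boxes are decomposed at the
  last coordinate although lists are built at the front.\<close>

lemma digit_box_snoc: "digit_box (B @ [b]) = (\<lambda>(D, a). D @ [a]) ` (digit_box B \<times> {..<b})"
proof (intro set_eqI iffI)
  fix D assume "D \<in> digit_box (B @ [b])"
  then obtain us vs where "D = us @ vs" "list_all2 (<) us B" "list_all2 (<) vs [b]"
    by (auto simp: list_all2_append2)
  then show "D \<in> (\<lambda>(D, a). D @ [a]) ` (digit_box B \<times> {..<b})"
    by (auto simp: list_all2_Cons2)
qed (auto intro!: list_all2_appendI)

lemma finite_digit_box [simp]: "finite (digit_box B)"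
proof (induction B rule: rev_induct)
  case (snoc b B)
  then show ?case unfolding digit_box_snoc by simp
qed simp

lemma sum_digit_box_snoc:
  "(\<Sum>D\<in>digit_box (B @ [b]). h D) = (\<Sum>D\<in>digit_box B. \<Sum>a<b. h (D @ [a]))"
proof -
  have "inj_on (\<lambda>(D, a). D @ [a]) (digit_box B \<times> {..<b})" by (auto simp: inj_on_def)
  then show ?thesis
    unfolding digit_box_snoc sum.cartesian_product by (simp add: sum.reindex comp_def case_prod_unfold)
qed

lemma card_digit_box: "card (digit_box B) = prod_list B"
proof (induction B rule: rev_induct)
  case (snoc b B)
  have "inj_on (\<lambda>(D, a). D @ [a]) (digit_box B \<times> {..<b})" by (auto simp: inj_on_def)
  then show ?case using snoc unfolding digit_box_snoc by (simp add: card_image card_cartesian_product)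
qed simp

section \<open>Exponential moments of bounded martingale differences\<close>

lemma exp_bound_quadratic_abs:
  fixes x :: real
  assumes "\<bar>x\<bar> \<le> 1" shows "exp x \<le> 1 + x + x\<^sup>2"
proof (cases "x \<ge> 0")
  case True
  then show ?thesis using exp_bound[of x] assms by simp
next
  case False
  define y where "y = - x"
  have y: "0 < y" "y \<le> 1" using False assms by (auto simp: y_def)
  \<comment> \<open>The product equals \<open>1 + y^3\<close>, so \<open>1 - y + y^2\<close> bounds
    the reciprocal of \<open>1 + y\<close>, and hence that of \<open>exp y\<close>, from
    above.\<close>
  have "1 \<le> (1 + y) * (1 - y + y\<^sup>2)" using y by (simp add: algebra_simps power2_eq_square)
  also have "\<dots> \<le> exp y * (1 - y + y\<^sup>2)"
    using y exp_ge_add_one_self[of y] by (intro mult_right_mono) (auto simp: power2_eq_square)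
  finally have "exp (- y) \<le> 1 - y + y\<^sup>2" by (simp add: exp_minus field_simps)
  then show ?thesis by (simp add: y_def)
qed

text \<open>Azuma-type bound: after \<open>exp x \<le> 1 + x + x^2\<close> the linear terms sum to
  zero over the last digit by the martingale identity, so each coordinate costs at most a factor
  \<open>exp ((\<theta> * K)^2)\<close> beyond its number of digits.\<close>

lemma exp_moment_digit_box:
  fixes V :: "nat list \<Rightarrow> real" and K \<theta> :: real
  assumes mart: "\<And>i D. i < length B \<Longrightarrow> D \<in> digit_box (take i B) \<Longrightarrow> (\<Sum>a<B ! i. V (D @ [a])) = real (B ! i) * V D"
    and incr: "\<And>i D a. i < length B \<Longrightarrow> D \<in> digit_box (take i B) \<Longrightarrow> \<bar>V (D @ [a]) - V D\<bar> \<le> K"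
    and \<theta>: "\<bar>\<theta>\<bar> * K \<le> 1"
  shows "(\<Sum>D\<in>digit_box B. exp (\<theta> * V D)) \<le> real (prod_list B) * (exp (\<theta> * V []) * exp ((\<theta> * K)\<^sup>2 * length B))"
  using mart incr
proof (induction B rule: rev_induct)
  case (snoc b B)
  let ?n = "length B"
  have IH: "(\<Sum>D\<in>digit_box B. exp (\<theta> * V D)) \<le> real (prod_list B) * (exp (\<theta> * V []) * exp ((\<theta> * K)\<^sup>2 * length B))"
  proof (rule snoc.IH)
    fix i D a assume *: "i < length B" "D \<in> digit_box (take i B)"
    then show "(\<Sum>a<B ! i. V (D @ [a])) = real (B ! i) * V D" "\<bar>V (D @ [a]) - V D\<bar> \<le> K"
      using snoc.prems[of i D] by (auto simp: nth_append)
  qed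
  have step: "(\<Sum>a<b. exp (\<theta> * V (D @ [a]))) \<le> b * (exp (\<theta> * V D) * exp ((\<theta> * K)\<^sup>2))" if D: "D \<in> digit_box B" for D
  proof -
    have mart: "(\<Sum>a<b. V (D @ [a])) = b * V D" and incr: "\<bar>V (D @ [a]) - V D\<bar> \<le> K" for a
      using snoc.prems[of ?n D] D by (auto simp: nth_append)
    have "exp (\<theta> * V (D @ [a])) \<le> exp (\<theta> * V D) * (1 + \<theta> * (V (D @ [a]) - V D) + (\<theta> * K)\<^sup>2)" for a
    proof -
      let ?x = "\<theta> * (V (D @ [a]) - V D)"
      have le: "\<bar>?x\<bar> \<le> \<bar>\<theta>\<bar> * K" using incr[of a] by (simp add: abs_mult mult_left_mono)
      then have "exp ?x \<le> 1 + ?x + ?x\<^sup>2" using \<theta> by (intro exp_bound_quadratic_abs) linarith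
      moreover have "?x\<^sup>2 \<le> (\<theta> * K)\<^sup>2"
        using le incr[of a] by (intro abs_le_square_iff[THEN iffD1]) (simp add: abs_mult)
      ultimately have "exp ?x \<le> 1 + ?x + (\<theta> * K)\<^sup>2" by linarith
      then have "exp (\<theta> * V D) * exp ?x \<le> exp (\<theta> * V D) * (1 + ?x + (\<theta> * K)\<^sup>2)" by (intro mult_left_mono) auto
      moreover have "exp (\<theta> * V D) * exp ?x = exp (\<theta> * V (D @ [a]))"
        by (simp add: exp_add[symmetric] algebra_simps)
      ultimately show ?thesis by simp
    qed
    then have "(\<Sum>a<b. exp (\<theta> * V (D @ [a]))) \<le> (\<Sum>a<b. exp (\<theta> * V D) * (1 + \<theta> * (V (D @ [a]) - V D) + (\<theta> * K)\<^sup>2))"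
      by (intro sum_mono) auto
    also have "\<dots> = exp (\<theta> * V D) * (b + \<theta> * ((\<Sum>a<b. V (D @ [a])) - b * V D) + b * (\<theta> * K)\<^sup>2)"
      by (simp add: sum_distrib_left[symmetric] sum.distrib sum_subtractf)
    also have "\<dots> = b * (exp (\<theta> * V D) * (1 + (\<theta> * K)\<^sup>2))"
      unfolding mart by (simp add: algebra_simps)
    also have "\<dots> \<le> b * (exp (\<theta> * V D) * exp ((\<theta> * K)\<^sup>2))"
      by (intro mult_left_mono exp_ge_add_one_self) auto
    finally show ?thesis .
  qed
  have "(\<Sum>D\<in>digit_box (B @ [b]). exp (\<theta> * V D)) \<le> (\<Sum>D\<in>digit_box B. b * (exp (\<theta> * V D) * exp ((\<theta> * K)\<^sup>2)))"
    unfolding sum_digit_box_snoc using step by (rule sum_mono)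
  also have "\<dots> = (b * exp ((\<theta> * K)\<^sup>2)) * (\<Sum>D\<in>digit_box B. exp (\<theta> * V D))"
    by (simp add: sum_distrib_left mult_ac)
  also have "\<dots> \<le> (b * exp ((\<theta> * K)\<^sup>2)) * (real (prod_list B) * (exp (\<theta> * V []) * exp ((\<theta> * K)\<^sup>2 * length B)))"
    by (intro mult_left_mono IH) auto
  also have "\<dots> = real (prod_list (B @ [b])) * (exp (\<theta> * V []) * exp ((\<theta> * K)\<^sup>2 * length (B @ [b])))"
    by (simp add: exp_add algebra_simps)
  finally show ?case .
qed simp

text \<open>Markov's inequality for the exponential moments of \<open>V\<close> and of
  \<open>- V\<close>; the two tails produce the factor 2.\<close>

lemma card_deviation_digit_box:
  fixes V :: "nat list \<Rightarrow> real" and K \<eta> :: real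
  assumes mart: "\<And>i D. i < length B \<Longrightarrow> D \<in> digit_box (take i B) \<Longrightarrow> (\<Sum>a<B ! i. V (D @ [a])) = real (B ! i) * V D"
    and incr: "\<And>i D a. i < length B \<Longrightarrow> D \<in> digit_box (take i B) \<Longrightarrow> \<bar>V (D @ [a]) - V D\<bar> \<le> K"
    and V0: "V [] = 0" and K: "K \<ge> 1" and \<eta>: "0 < \<eta>" "\<eta> \<le> 1"
  shows "card {D \<in> digit_box B. \<bar>V D\<bar> > \<eta> * length B} \<le> 2 * real (prod_list B) * exp (- (\<eta>\<^sup>2 / (4 * K\<^sup>2)) * length B)"
proof -
  let ?n = "length B"
  \<comment> \<open>Minimises \<open>\<theta>^2 K^2 - \<theta> \<eta>\<close>, with value
    \<open>- \<eta>^2 / (4 K^2)\<close>; the bounds \<open>K \<ge> 1\<close> and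
    \<open>\<eta> \<le> 1\<close> keep \<open>\<theta> * K \<le> 1\<close>.\<close>
  define \<theta> where "\<theta> = \<eta> / (2 * K\<^sup>2)"
  have \<theta>pos: "\<theta> > 0" using K \<eta> by (simp add: \<theta>_def)
  have \<theta>K: "\<theta> * K \<le> 1" using K \<eta> by (simp add: \<theta>_def power2_eq_square field_simps)
  have one: "card {D \<in> digit_box B. s * V D > \<eta> * ?n} \<le> real (prod_list B) * exp (- (\<eta>\<^sup>2 / (4 * K\<^sup>2)) * ?n)"
    if s: "s = 1 \<or> s = -1" for s :: real
  proof -
    let ?S = "{D \<in> digit_box B. s * V D > \<eta> * ?n}"
    have "card ?S * exp (\<theta> * \<eta> * ?n) = (\<Sum>D\<in>?S. exp (\<theta> * \<eta> * ?n))" by simp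
    also have "\<dots> \<le> (\<Sum>D\<in>?S. exp ((\<theta> * s) * V D))"
      using \<theta>pos by (intro sum_mono) (auto simp: mult.assoc intro!: mult_left_mono)
    also have "\<dots> \<le> (\<Sum>D\<in>digit_box B. exp ((\<theta> * s) * V D))"
      by (intro sum_mono2) auto
    also have "\<dots> \<le> real (prod_list B) * (exp ((\<theta> * s) * V []) * exp (((\<theta> * s) * K)\<^sup>2 * ?n))"
      using s \<theta>pos \<theta>K by (intro exp_moment_digit_box mart incr) (auto simp: abs_mult)
    also have "((\<theta> * s) * K)\<^sup>2 = (\<theta> * K)\<^sup>2" using s by auto
    finally have "card ?S * exp (\<theta> * \<eta> * ?n) \<le> real (prod_list B) * exp ((\<theta> * K)\<^sup>2 * ?n)" by (simp add: V0)
    then have "card ?S * exp (\<theta> * \<eta> * ?n) * exp (- (\<theta> * \<eta> * ?n)) \<le> real (prod_list B) * exp ((\<theta> * K)\<^sup>2 * ?n) * exp (- (\<theta> * \<eta> * ?n))"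
      by (rule mult_right_mono) auto
    moreover have "(\<theta> * K)\<^sup>2 * ?n - \<theta> * \<eta> * ?n = - (\<eta>\<^sup>2 / (4 * K\<^sup>2)) * ?n"
      using K by (simp add: \<theta>_def power2_eq_square field_simps)
    ultimately show ?thesis by (simp add: mult.assoc exp_add[symmetric] del: mult_minus_left)
  qed
  have "{D \<in> digit_box B. \<bar>V D\<bar> > \<eta> * ?n} = {D \<in> digit_box B. 1 * V D > \<eta> * ?n} \<union> {D \<in> digit_box B. -1 * V D > \<eta> * ?n}"
    by auto
  then have "card {D \<in> digit_box B. \<bar>V D\<bar> > \<eta> * ?n} \<le> card {D \<in> digit_box B. 1 * V D > \<eta> * ?n} + card {D \<in> digit_box B. -1 * V D > \<eta> * ?n}"
    by (simp only: card_Un_le)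
  then have "real (card {D \<in> digit_box B. \<bar>V D\<bar> > \<eta> * ?n}) \<le> real (card {D \<in> digit_box B. 1 * V D > \<eta> * ?n}) + real (card {D \<in> digit_box B. -1 * V D > \<eta> * ?n})"
    by linarith
  then show ?thesis using one[of 1] one[of "-1"] by simp
qed

text \<open>The conditional expectation, for uniform digits given the prefix \<open>D\<close>, of the excess of the indicator that the block
  \<open>d\<close> occurs at position \<open>s\<close>.\<close>

definition match_excess :: "nat list \<Rightarrow> nat list \<Rightarrow> nat \<Rightarrow> nat list \<Rightarrow> real" where
  "match_excess \<beta> d s D =
     (let t = take (length d) (drop s D) in
       (if take (length t) d = t then 1 / real (prod_list (drop (length t) \<beta>)) else 0)) - 1 / real (prod_list \<beta>)"

text \<open>For fixed symbols \<open>B\<close> this is a martingale in the growing digit block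
  \<open>D\<close>: each occurrence of \<open>\<beta>\<close> in \<open>B\<close> contributes its
  excess conditioned on the digits known so far.\<close>

definition block_excess :: "nat list \<Rightarrow> nat list \<Rightarrow> nat list \<Rightarrow> nat list \<Rightarrow> real" where
  "block_excess \<beta> d B D =
     (\<Sum>s | s + length \<beta> \<le> length B \<and> take (length \<beta>) (drop s B) = \<beta>. match_excess \<beta> d s D)"

text \<open>Only a digit inside the occurrence matters. There the conditional probability
  \<open>1 / pr k\<close> becomes \<open>1 / pr (Suc k)\<close> for exactly one of the
  \<open>\<beta> ! k\<close> digits and vanishes for the others, so its average is unchanged; after
  a failed prefix it stays 0.\<close>

lemma match_excess_append:
  assumes s: "s + length \<beta> \<le> length B" "take (length \<beta>) (drop s B) = \<beta>" and d: "d \<in> digit_box \<beta>"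
    and D: "length D = i" "i < length B"
  shows "(\<Sum>a<B ! i. match_excess \<beta> d s (D @ [a])) = real (B ! i) * match_excess \<beta> d s D" (is ?mart)
    and "\<bar>match_excess \<beta> d s (D @ [a]) - match_excess \<beta> d s D\<bar> \<le> (if s \<le> i \<and> i < s + length \<beta> then 1 else 0)" (is ?incr)
proof -
  have len: "length d = length \<beta>" using d by (auto dest: list_all2_lengthD)
  have \<beta>pos: "b > 0" if "b \<in> set \<beta>" for b
    using d that by (auto simp: list_all2_conv_all_nth in_set_conv_nth)
  define pr where "pr k = real (prod_list (drop k \<beta>))" for k
  have prge: "pr k \<ge> 1" for k
  proof -
    have "prod_list (drop k \<beta>) > 0"
      using \<beta>pos[of 0] by (auto simp: prod_list_zero_iff dest!: in_set_dropD intro!: gr0I)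
    then show ?thesis unfolding pr_def by linarith
  qed
  have "?mart \<and> ?incr"
  proof (cases "s \<le> i \<and> i < s + length \<beta>")
    case True
    define t where "t = drop s D"
    define k where "k = length t"
    have k: "k = i - s" "k < length \<beta>" using True D by (auto simp: k_def t_def)
    have b: "B ! i = \<beta> ! k"
    proof -
      have "take (length \<beta>) (drop s B) ! k = B ! (s + k)"
        using s(1) by (subst nth_take[OF k(2)]) (simp add: nth_drop)
      then show ?thesis using s(2) k True by simp
    qed
    have dk: "d ! k < \<beta> ! k" using d k len by (auto simp: list_all2_conv_all_nth)
    have prk: "pr k = real (\<beta> ! k) * pr (Suc k)"
      using k(2) unfolding pr_def by (subst Cons_nth_drop_Suc[symmetric]) auto
    have 1: "match_excess \<beta> d s D = (if take k d = t then 1 / pr k else 0) - 1 / real (prod_list \<beta>)"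
      using k len by (simp add: match_excess_def pr_def k_def t_def Let_def)
    have 2: "match_excess \<beta> d s (D @ [a]) = (if take k d = t \<and> d ! k = a then 1 / pr (Suc k) else 0) - 1 / real (prod_list \<beta>)" for a
    proof -
      have "take (length d) (drop s (D @ [a])) = t @ [a]" using True D len k by (simp add: t_def k_def)
      moreover have "take (Suc k) d = take k d @ [d ! k]" using k len by (simp add: take_Suc_conv_app_nth)
      ultimately show ?thesis by (simp add: match_excess_def pr_def k_def[symmetric] Let_def)
    qed
    have "(\<Sum>a<\<beta> ! k. if d ! k = a then 1 / pr (Suc k) else 0) = 1 / pr (Suc k)"
      using dk by simp
    moreover have "real (\<beta> ! k) * (1 / pr k) = 1 / pr (Suc k)"
      unfolding prk using dk prge[of "Suc k"] by simp
    ultimately have ?mart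
      unfolding b 1 2 by (cases "take k d = t") (auto simp: sum_subtractf right_diff_distrib)
    moreover have "0 \<le> 1 / pr k" "1 / pr k \<le> 1" "0 \<le> 1 / pr (Suc k)" "1 / pr (Suc k) \<le> 1"
      using prge[of k] prge[of "Suc k"] by auto
    then have ?incr using True unfolding 1 2 by (auto simp del: zero_le_divide_1_iff le_divide_eq_1_pos)
    ultimately show ?thesis by blast
  next
    case False
    have "match_excess \<beta> d s (D @ [a]) = match_excess \<beta> d s D" for a
    proof -
      have "take (length d) (drop s (D @ [a])) = take (length d) (drop s D)"
        using False D len by (cases "i < s") auto
      then show ?thesis unfolding match_excess_def by (simp only:)
    qed
    then show ?thesis using False by auto
  qed
  then show ?mart ?incr by auto
qed

text \<open>A single digit lies in at most \<open>length \<beta>\<close> overlapping occurrences, so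
  this length bounds the martingale increments.\<close>

lemma card_block_excess:
  fixes \<eta> :: real
  assumes d: "d \<in> digit_box \<beta>" and "\<beta> \<noteq> []" and \<eta>: "0 < \<eta>" "\<eta> \<le> 1"
  shows "card {D \<in> digit_box B. \<bar>block_excess \<beta> d B D\<bar> > \<eta> * length B}
    \<le> 2 * real (prod_list B) * exp (- (\<eta>\<^sup>2 / (4 * (real (length \<beta>))\<^sup>2)) * length B)"
proof (rule card_deviation_digit_box)
  let ?S = "{s. s + length \<beta> \<le> length B \<and> take (length \<beta>) (drop s B) = \<beta>}"
  have fin: "finite ?S" by (rule finite_subset[of _ "{..length B}"]) auto
  fix i D a assume iD: "i < length B" "D \<in> digit_box (take i B)"
  then have i: "length D = i" by (auto dest: list_all2_lengthD)
  show "(\<Sum>a<B ! i. block_excess \<beta> d B (D @ [a])) = real (B ! i) * block_excess \<beta> d B D"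
    unfolding block_excess_def sum_distrib_left
    by (subst sum.swap) (intro sum.cong refl match_excess_append(1)[OF _ _ d i], use iD in auto)
  have "\<bar>block_excess \<beta> d B (D @ [a]) - block_excess \<beta> d B D\<bar> \<le> (\<Sum>s\<in>?S. \<bar>match_excess \<beta> d s (D @ [a]) - match_excess \<beta> d s D\<bar>)"
    unfolding block_excess_def sum_subtractf[symmetric] by (rule sum_abs)
  also have "\<dots> \<le> (\<Sum>s\<in>?S. if s \<le> i \<and> i < s + length \<beta> then 1 else 0)"
    by (intro sum_mono match_excess_append(2)[where B = B]) (use i iD d in auto)
  also have "\<dots> = card {s \<in> ?S. s \<le> i \<and> i < s + length \<beta>}"
    using fin by (simp add: sum.If_cases Int_def)
  also have "\<dots> \<le> card {i + 1 - length \<beta>..i}"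
    using fin by (intro of_nat_mono card_mono) auto
  also have "\<dots> \<le> length \<beta>" by simp
  finally show "\<bar>block_excess \<beta> d B (D @ [a]) - block_excess \<beta> d B D\<bar> \<le> length \<beta>" .
next
  show "real (length \<beta>) \<ge> 1" using \<open>\<beta> \<noteq> []\<close> by (cases \<beta>) auto
  show "block_excess \<beta> d B [] = 0"
    by (simp add: block_excess_def match_excess_def)
qed (use \<eta> in auto)

text \<open>Once all digits are known the conditional probabilities are indicators: the end value of
  the martingale is the number of matches minus the expected number.\<close>

lemma block_excess_eq:
  assumes d: "d \<in> digit_box \<beta>" and len: "length D = length B"
  shows "block_excess \<beta> d B D = (\<Sum>s | s + length \<beta> \<le> length B.
    if take (length \<beta>) (drop s B) = \<beta> then (if take (length \<beta>) (drop s D) = d then 1 else 0) - 1 / real (prod_list \<beta>) else 0)"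
proof -
  have ld: "length d = length \<beta>" using d by (auto dest: list_all2_lengthD)
  have fin: "finite {s. s + length \<beta> \<le> length B}" by (rule finite_subset[of _ "{..length B}"]) auto
  have "match_excess \<beta> d s D = (if take (length \<beta>) (drop s D) = d then 1 else 0) - 1 / real (prod_list \<beta>)"
    if "s + length \<beta> \<le> length B" for s
    using that len ld by (auto simp: match_excess_def Let_def)
  then show ?thesis
    unfolding block_excess_def using fin
    by (simp add: sum.inter_filter[symmetric] cong: if_cong conj_cong)
qed

section \<open>Ergodic sums\<close>

lemma (in prob_space) distr_eq_if_measure_preserving:
  assumes T: "T \<in> measurable M M"
    and mp: "\<And>A. A \<in> sets M \<Longrightarrow> measure M (T -` A \<inter> space M) = measure M A"
  shows "distr M M T = M"
proof (rule measure_eqI)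
  fix A assume "A \<in> sets (distr M M T)"
  then have A: "A \<in> sets M" by simp
  have "emeasure (distr M M T) A = emeasure M (T -` A \<inter> space M)" using A T by (simp add: emeasure_distr)
  also have "\<dots> = emeasure M A" using mp[OF A] by (simp add: emeasure_eq_measure)
  finally show "emeasure (distr M M T) A = emeasure M A" .
qed simp

text \<open>
  Let \<open>X n\<close> be the maximum of the ergodic sums up to \<open>n\<close>. Where these are unbounded,
  \<open>X (n + 1) - X n \<circ> T = max h (- X n \<circ> T)\<close> converges to \<open>h\<close>, while its integral is nonnegative.
\<close>

lemma (in prob_space) ergodic_birkhoff_sum_bounded:
  fixes h :: "'a \<Rightarrow> real"
  assumes T[measurable]: "T \<in> measurable M M"
    and mp: "\<And>A. A \<in> sets M \<Longrightarrow> measure M (T -` A \<inter> space M) = measure M A"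
    and erg: "ergodic M T" and h: "integrable M h" and neg: "(\<integral>u. h u \<partial>M) < 0"
  shows "AE u in M. \<exists>C. \<forall>n. (\<Sum>i<n. h ((T ^^ i) u)) \<le> C"
proof -
  have hm[measurable]: "h \<in> borel_measurable M" using h by simp
  have distr: "distr M M T = M" by (rule distr_eq_if_measure_preserving[OF T mp])
  have int_comp: "integrable M (\<lambda>u. f (T u)) \<and> (\<integral>u. f (T u) \<partial>M) = (\<integral>u. f u \<partial>M)"
    if "integrable M f" for f :: "'a \<Rightarrow> real"
    using that integrable_distr_eq[OF T, of f] integral_distr[OF T, of f] by (simp add: distr)
  define S where "S n u = (\<Sum>i<n. h ((T ^^ i) u))" for n u
  have S_Suc: "S (Suc n) u = h u + S n (T u)" for n u
    unfolding S_def by (subst sum.lessThan_Suc_shift) (simp add: funpow_swap1)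
  have Tn[measurable]: "(T ^^ n) \<in> measurable M M" for n
    by (induction n) auto
  have Sm[measurable]: "S n \<in> borel_measurable M" for n unfolding S_def by measurable
  define A where "A = {u \<in> space M. \<forall>C::nat. \<exists>n. S n u > real C}"
  have Am[measurable]: "A \<in> sets M" unfolding A_def by measurable
  \<comment> \<open>The sums at \<open>u\<close> and at \<open>T u\<close> differ by
    \<open>h u\<close> and an index shift, so unboundedness is invariant and ergodicity leaves
    measure 0 or 1.\<close>
  have "T -` A \<inter> space M = A"
  proof (intro set_eqI iffI)
    fix u assume u: "u \<in> T -` A \<inter> space M"
    have "\<exists>n. S n u > real C" for C
    proof -
      obtain c :: nat where c: "C - h u \<le> c" using real_arch_simple by blast
      obtain n where "S n (T u) > c" using u unfolding A_def by auto
      then show ?thesis using c S_Suc[of n u] by (intro exI[of _ "Suc n"]) linarith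
    qed
    then show "u \<in> A" using u unfolding A_def by auto
  next
    fix u assume u: "u \<in> A"
    have "\<exists>n. S n (T u) > real C" for C
    proof -
      obtain c :: nat where c: "C + \<bar>h u\<bar> \<le> c" using real_arch_simple by blast
      obtain n where n: "S n u > c" using u unfolding A_def by auto
      then have "n \<noteq> 0" by (cases n) (auto simp: S_def)
      then obtain m where "n = Suc m" by (cases n) auto
      then have "S (Suc m) u > c" using n by simp
      then show ?thesis using c S_Suc[of m u] by (intro exI[of _ m]) linarith
    qed
    then show "u \<in> T -` A \<inter> space M" using u measurable_space[OF T] unfolding A_def by auto
  qed
  then have "measure M A = 0 \<or> measure M A = 1" using erg Am unfolding ergodic_def by blast
  moreover have "measure M A \<noteq> 1"
  proof
    assume "measure M A = 1"
    then have AE_A: "AE u in M. u \<in> A" using prob_eq_1[OF Am] by simp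
    define X where "X n u = Max ((\<lambda>i. S i u) ` {..n})" for n u
    have Xm[measurable]: "X n \<in> borel_measurable M" for n
      unfolding X_def by measurable
    have Sint: "integrable M (S n)" for n
    proof (induction n)
      case (Suc n)
      then show ?case using int_comp[of "S n"] h unfolding S_Suc[abs_def] by auto
    qed (simp add: S_def[abs_def])
    have X_ge: "S i u \<le> X n u" if "i \<le> n" for i n u unfolding X_def using that by (intro Max_ge) auto
    have X0: "0 \<le> X n u" for n u using X_ge[of 0 n u] by (simp add: S_def)
    have X_Suc: "X (Suc n) u = max 0 (h u + X n (T u))" for n u
    proof -
      have "(\<lambda>i. S i u) ` {..Suc n} = insert 0 ((\<lambda>s. h u + s) ` ((\<lambda>i. S i (T u)) ` {..n}))"
        unfolding atMost_Suc_eq_insert_0 by (auto simp: image_image S_Suc S_def[of 0])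
      then have "X (Suc n) u = max 0 (Max ((\<lambda>s. h u + s) ` ((\<lambda>i. S i (T u)) ` {..n})))"
        unfolding X_def by (simp add: Max_insert)
      also have "Max ((\<lambda>s. h u + s) ` ((\<lambda>i. S i (T u)) ` {..n})) = h u + X n (T u)"
        unfolding X_def by (rule mono_Max_commute[symmetric]) (auto intro: monoI)
      finally show ?thesis .
    qed
    have Xint: "integrable M (X n)" for n
    proof (induction n)
      case 0
      have "X 0 = (\<lambda>_. 0)" by (rule ext) (simp add: X_def S_def)
      then show ?case by simp
    next
      case (Suc n)
      then show ?case using int_comp[of "X n"] h unfolding X_Suc[abs_def] by (intro integrable_max) auto
    qed
    have mono: "X n u \<le> X (Suc n) u" for n u unfolding X_def by (intro Max_mono) auto
    define Y where "Y n u = X (Suc n) u - X n (T u)" for n u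
    have Y_eq: "Y n u = max (- X n (T u)) (h u)" for n u unfolding Y_def X_Suc by linarith
    have "0 \<le> (\<integral>u. Y n u \<partial>M)" for n
    proof -
      have "(\<integral>u. Y n u \<partial>M) = (\<integral>u. X (Suc n) u \<partial>M) - (\<integral>u. X n u \<partial>M)"
        unfolding Y_def using int_comp[OF Xint[of n]] Xint[of "Suc n"] by simp
      also have "\<dots> \<ge> 0" using integral_mono[OF Xint Xint mono, of n] by simp
      finally show ?thesis .
    qed
    moreover have "(\<lambda>n. \<integral>u. Y n u \<partial>M) \<longlonglongrightarrow> (\<integral>u. h u \<partial>M)"
    proof (rule integral_dominated_convergence[where w = "\<lambda>u. \<bar>h u\<bar>"])
      show "AE u in M. (\<lambda>n. Y n u) \<longlonglongrightarrow> h u"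
      proof (rule AE_mp[OF AE_A], intro AE_I2 impI)
        fix u assume "u \<in> space M" "u \<in> A"
        obtain c :: nat where c: "\<bar>h u\<bar> + \<bar>h u\<bar> \<le> c" using real_arch_simple by blast
        obtain n where n: "S n u > c" using \<open>u \<in> A\<close> unfolding A_def by auto
        have "Y m u = h u" if "m \<ge> n" for m
        proof -
          have "X (Suc m) u \<ge> S n u" using that by (intro X_ge) auto
          then have "X m (T u) \<ge> - h u" using X_Suc[of m u] n c by linarith
          then show ?thesis unfolding Y_eq by linarith
        qed
        then show "(\<lambda>n. Y n u) \<longlonglongrightarrow> h u"
          by (intro tendsto_eventually eventually_sequentiallyI[of n])
      qed
      \<comment> \<open>Since \<open>X n\<close> is nonnegative, \<open>Y n u\<close> lies between
        \<open>h u\<close> and \<open>max 0 (h u)\<close>, whence the dominating function.\<close>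
      show "AE u in M. norm (Y n u) \<le> \<bar>h u\<bar>" for n
        unfolding Y_eq using X0 by (intro AE_I2) (smt (verit) real_norm_def)
    qed (use h in \<open>auto simp: Y_def[abs_def]\<close>)
    ultimately have "0 \<le> (\<integral>u. h u \<partial>M)" by (intro LIMSEQ_le_const) auto
    then show False using neg by simp
  qed
  ultimately have "measure M A = 0" by blast
  then have "AE u in M. u \<notin> A" using Am by (intro AE_not_in) (simp add: null_sets_def emeasure_eq_measure)
  then show ?thesis
    by (rule AE_mp) (intro AE_I2, auto simp: A_def S_def[symmetric] not_less)
qed

text \<open>Centring at the mean plus \<open>\<epsilon> / 2\<close> makes the integral negative, so
  the centred sums are bounded almost everywhere. The remaining \<open>\<epsilon> / 2\<close> per
  step excludes the deviation from some index on, depending on the point, and dominated convergence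
  gives decay in measure.\<close>

lemma (in prob_space) ergodic_upper_deviation:
  fixes h :: "'a \<Rightarrow> real"
  assumes T[measurable]: "T \<in> measurable M M"
    and mp: "\<And>A. A \<in> sets M \<Longrightarrow> measure M (T -` A \<inter> space M) = measure M A"
    and erg: "ergodic M T" and h: "integrable M h" and \<epsilon>: "\<epsilon> > 0"
  shows "(\<lambda>n. prob {u \<in> space M. (\<Sum>i<n. h ((T ^^ i) u)) > ((\<integral>u. h u \<partial>M) + \<epsilon>) * real n}) \<longlonglongrightarrow> 0"
proof -
  have hm[measurable]: "h \<in> borel_measurable M" using h by simp
  have Tn[measurable]: "(T ^^ n) \<in> measurable M M" for n
    by (induction n) auto
  define c where "c = (\<integral>u. h u \<partial>M)"
  define B where "B n = {u \<in> space M. (\<Sum>i<n. h ((T ^^ i) u)) > (c + \<epsilon>) * real n}" for n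
  have Bm[measurable]: "B n \<in> sets M" for n unfolding B_def by measurable
  have "AE u in M. \<exists>C. \<forall>n. (\<Sum>i<n. h ((T ^^ i) u) - (c + \<epsilon> / 2)) \<le> C"
    using h \<epsilon> by (intro ergodic_birkhoff_sum_bounded T mp erg) (auto simp: c_def prob_space)
  then have lim: "AE u in M. (\<lambda>n. indicat_real (B n) u) \<longlonglongrightarrow> 0"
  proof (rule AE_mp, intro AE_I2 impI)
    fix u assume "u \<in> space M" "\<exists>C. \<forall>n. (\<Sum>i<n. h ((T ^^ i) u) - (c + \<epsilon> / 2)) \<le> C"
    then obtain C where C: "(\<Sum>i<n. h ((T ^^ i) u) - (c + \<epsilon> / 2)) \<le> C" for n by blast
    obtain N :: nat where N: "2 * C / \<epsilon> \<le> N" using real_arch_simple by blast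
    have "u \<notin> B n" if "n \<ge> N" for n
    proof
      assume "u \<in> B n"
      then have "(c + \<epsilon>) * n < (\<Sum>i<n. h ((T ^^ i) u))" by (simp add: B_def)
      also have "\<dots> \<le> C + (c + \<epsilon> / 2) * n" using C[of n] by (simp add: sum_subtractf algebra_simps)
      finally have "\<epsilon> * n < 2 * C" by (simp add: algebra_simps)
      then have "n < 2 * C / \<epsilon>" using \<epsilon> by (simp add: field_simps)
      then show False using N that by linarith
    qed
    then show "(\<lambda>n. indicat_real (B n) u) \<longlonglongrightarrow> 0"
      by (intro tendsto_eventually eventually_sequentiallyI[of N]) auto
  qed
  have "(\<lambda>n. \<integral>u. indicat_real (B n) u \<partial>M) \<longlonglongrightarrow> (\<integral>u. 0 \<partial>M)"
    by (rule integral_dominated_convergence[where w = "\<lambda>_. 1"]) (use lim in \<open>auto simp: indicator_def\<close>)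
  then show ?thesis by (simp add: B_def c_def)
qed

section \<open>Frequencies and zero entropy\<close>

definition freq :: "(nat \<Rightarrow> bool) \<Rightarrow> nat \<Rightarrow> real" where
  "freq A N = real (card {j \<in> {1..N}. A j}) / real N"

lemma freq_eq_sum: "freq A N = (\<Sum>j=1..N. of_bool (A j)) / real N"
  by (simp add: freq_def of_bool_def sum.If_cases Int_def)

lemma freq_nonneg [simp]: "0 \<le> freq A N"
  by (simp add: freq_def)

lemma freq_le_1 [simp]: "freq A N \<le> 1"
proof -
  have "card {j \<in> {1..N}. A j} \<le> card {1..N}" by (rule card_mono) auto
  then have "real (card {j \<in> {1..N}. A j}) \<le> real N" by simp
  then show ?thesis unfolding freq_def by (cases "N = 0") (simp_all add: pos_divide_le_eq)
qed

lemma freq_mono: "(\<And>j. j \<ge> 1 \<Longrightarrow> A j \<Longrightarrow> B j) \<Longrightarrow> freq A N \<le> freq B N"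
  unfolding freq_def by (intro divide_right_mono of_nat_mono card_mono) auto

lemma freq_cong: "(\<And>j. j \<ge> 1 \<Longrightarrow> A j \<longleftrightarrow> B j) \<Longrightarrow> freq A N = freq B N"
  by (intro antisym freq_mono) auto

lemma freq_disj_le: "freq (\<lambda>j. A j \<or> B j) N \<le> freq A N + freq B N"
  unfolding freq_eq_sum add_divide_distrib[symmetric] sum.distrib[symmetric]
  by (intro divide_right_mono sum_mono) auto

lemma freq_bex_le:
  assumes "finite I"
  shows "freq (\<lambda>j. \<exists>i\<in>I. A i j) N \<le> (\<Sum>i\<in>I. freq (A i) N)"
  using assms
proof (induction I)
  case (insert i I)
  have "freq (\<lambda>j. \<exists>i\<in>insert i I. A i j) N \<le> freq (A i) N + freq (\<lambda>j. \<exists>i\<in>I. A i j) N"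
    using freq_disj_le[of "A i" "\<lambda>j. \<exists>i\<in>I. A i j" N] by simp
  then show ?case using insert by simp
qed (simp add: freq_def)

lemma freq_bex_disjoint:
  assumes "finite I" and "\<And>i i' j. i \<in> I \<Longrightarrow> i' \<in> I \<Longrightarrow> A i j \<Longrightarrow> A i' j \<Longrightarrow> i = i'"
  shows "freq (\<lambda>j. \<exists>i\<in>I. A i j) N = (\<Sum>i\<in>I. freq (A i) N)"
proof -
  have "of_bool (\<exists>i\<in>I. A i j) = (\<Sum>i\<in>I. of_bool (A i j) :: real)" for j
  proof (cases "\<exists>i\<in>I. A i j")
    case True
    then obtain i where i: "i \<in> I" "A i j" by blast
    then have "(\<Sum>i\<in>I. of_bool (A i j) :: real) = (\<Sum>i\<in>{i}. 1)"
      using assms by (intro sum.mono_neutral_cong_right) auto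
    then show ?thesis using True by simp
  qed auto
  then show ?thesis
    unfolding freq_eq_sum sum_divide_distrib[symmetric] by (subst sum.swap) simp
qed

text \<open>\<open>z\<close> prescribes which entries are nonzero. A nonzero first entry
  \<open>a\<close> leaves at most \<open>2 ^ (m - a)\<close> lists by induction, and these powers
  sum to less than \<open>2 ^ m\<close>; the bound does not depend on the length.\<close>

lemma card_positive_lists_le:
  "finite {v. list_all2 (\<lambda>b v. b = (v \<ge> (1::nat))) z v \<and> sum_list v \<le> m} \<and>
   card {v. list_all2 (\<lambda>b v. b = (v \<ge> (1::nat))) z v \<and> sum_list v \<le> m} \<le> 2 ^ m"
proof (induction z arbitrary: m)
  case Nil
  have "{v. list_all2 (\<lambda>b v. b = (v \<ge> (1::nat))) [] v \<and> sum_list v \<le> m} = {[]}" by auto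
  then show ?case by simp
next
  case (Cons b z)
  let ?S = "\<lambda>z m. {v. list_all2 (\<lambda>b v. b = (v \<ge> (1::nat))) z v \<and> sum_list v \<le> m}"
  show ?case
  proof (cases b)
    case False
    then have eq: "?S (b # z) m = (#) 0 ` ?S z m" by (auto simp: list_all2_Cons1)
    show ?thesis unfolding eq using Cons[of m] by (auto simp: card_image)
  next
    case True
    have eq: "?S (b # z) m = (\<Union>a\<in>{1..m}. (#) a ` ?S z (m - a))"
      using True by (fastforce simp: list_all2_Cons1)
    have "card (?S (b # z) m) \<le> (\<Sum>a\<in>{1..m}. card ((#) a ` ?S z (m - a)))"
      unfolding eq by (rule card_UN_le) auto
    also have "\<dots> \<le> (\<Sum>a\<in>{1..m}. 2 ^ (m - a))"
      using Cons by (intro sum_mono order_trans[OF card_image_le]) auto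
    also have "\<dots> \<le> 2 ^ m"
    proof -
      have "(\<Sum>a\<in>{1..m}. 2 ^ (m - a)) = (\<Sum>i<m. 2 ^ i :: nat)"
        by (rule sum.reindex_bij_witness[of _ "\<lambda>i. m - i" "\<lambda>a. m - a"]) auto
      then show ?thesis using sum_power2[of m] by (simp add: atLeast0LessThan)
    qed
    finally have "card (?S (b # z) m) \<le> 2 ^ m" .
    moreover have "finite (?S (b # z) m)" unfolding eq using Cons by auto
    ultimately show ?thesis by blast
  qed
qed

section \<open>Iterated partitions and cells of large measure\<close>

lemma iterated_join_partition:
  assumes P: "measurable_partition M P" and T[measurable]: "T \<in> measurable M M"
  shows "finite (iterated_join M T P n) \<and> iterated_join M T P n \<subseteq> sets M \<and>
    \<Union>(iterated_join M T P n) = space M \<and> disjoint (iterated_join M T P n)"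
proof (induction n)
  case 0
  show ?case by auto
next
  case (Suc n)
  let ?J = "iterated_join M T P"
  let ?R = "(\<lambda>A. T -` A \<inter> space M) ` ?J n"
  have P': "finite P" "P \<subseteq> sets M" "\<Union>P = space M" "disjoint P"
    using P unfolding measurable_partition_def partition_on_def by auto
  have eq: "?J (Suc n) = (\<lambda>(A, B). A \<inter> (T -` B \<inter> space M)) ` (P \<times> ?J n) - {{}}"
    by (auto simp: partition_join_def)
  show ?case
  proof (intro conjI)
    show "finite (?J (Suc n))" unfolding eq using P' Suc by auto
    show "?J (Suc n) \<subseteq> sets M"
      unfolding eq using P' Suc by (auto intro!: sets.Int measurable_sets[OF T])
    show "\<Union>(?J (Suc n)) = space M"
    proof (intro equalityI subsetI)
      fix u assume u: "u \<in> space M"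
      then obtain A where A: "A \<in> P" "u \<in> A" using P' by blast
      have "T u \<in> space M" using u T by (meson measurable_space)
      then obtain B where B: "B \<in> ?J n" "T u \<in> B" using Suc by blast
      then have "A \<inter> (T -` B \<inter> space M) \<in> ?J (Suc n)" unfolding eq using A u by auto
      then show "u \<in> \<Union>(?J (Suc n))" using A B u by (intro UnionI[of "A \<inter> (T -` B \<inter> space M)"]) auto
    next
      fix u assume "u \<in> \<Union>(?J (Suc n))"
      then show "u \<in> space M" unfolding eq by auto
    qed
    show "disjoint (?J (Suc n))"
    proof (rule disjointI)
      fix C C' assume "C \<in> ?J (Suc n)" "C' \<in> ?J (Suc n)" "C \<noteq> C'"
      then obtain A B A' B' where *: "A \<in> P" "A' \<in> P" "B \<in> ?J n" "B' \<in> ?J n"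
        "C = A \<inter> (T -` B \<inter> space M)" "C' = A' \<inter> (T -` B' \<inter> space M)" unfolding eq by auto
      then have "A \<noteq> A' \<or> B \<noteq> B'" using \<open>C \<noteq> C'\<close> by auto
      then have "A \<inter> A' = {} \<or> B \<inter> B' = {}" using * P' Suc disjointD by blast
      then show "C \<inter> C' = {}" unfolding * by auto
    qed
  qed
qed

lemma iterated_join_same_cell:
  assumes "C \<in> iterated_join M T P n" "u \<in> C" "v \<in> C" "i < n"
  shows "\<exists>A\<in>P. (T ^^ i) u \<in> A \<and> (T ^^ i) v \<in> A"
  using assms
proof (induction n arbitrary: C u v i)
  case (Suc n)
  from Suc.prems(1) obtain A B where AB: "A \<in> P" "B \<in> iterated_join M T P n" "C = A \<inter> (T -` B \<inter> space M)"
    by (auto simp: partition_join_def)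
  show ?case
  proof (cases i)
    case 0
    then show ?thesis using AB Suc.prems by auto
  next
    case (Suc i')
    have "\<exists>A\<in>P. (T ^^ i') (T u) \<in> A \<and> (T ^^ i') (T v) \<in> A"
      using AB Suc.prems Suc by (intro Suc.IH[of B]) auto
    then show ?thesis using Suc by (simp add: funpow_swap1)
  qed
qed simp

text \<open>Cells of measure below \<open>exp (- \<epsilon> n)\<close> contribute at least
  \<open>\<epsilon> n\<close> times their measure to the entropy, so entropy below
  \<open>\<epsilon>^2 n\<close> leaves them total measure below \<open>\<epsilon>\<close>. The other
  cells number at most \<open>exp (\<epsilon> n)\<close>.\<close>

lemma (in prob_space) zero_entropy_heavy_cells:
  fixes \<epsilon> :: real
  assumes P: "measurable_partition M P" and T: "T \<in> measurable M M"
    and ent: "ks_entropy M T = 0" and \<epsilon>: "\<epsilon> > 0"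
  shows "eventually (\<lambda>n. \<exists>H\<subseteq>iterated_join M T P n. card H \<le> exp (\<epsilon> * n) \<and> prob (\<Union>H) \<ge> 1 - \<epsilon>) sequentially"
proof -
  let ?J = "iterated_join M T P"
  have "entropy_wrt_partition M T P \<le> ks_entropy M T"
    unfolding ks_entropy_def using P by (intro SUP_upper) auto
  then have "limsup (\<lambda>n. ereal (partition_entropy M (?J n) / real n)) < ereal (\<epsilon>\<^sup>2)"
    using \<epsilon> ent unfolding entropy_wrt_partition_def by (simp add: le_less_trans)
  then have "eventually (\<lambda>n. ereal (partition_entropy M (?J n) / real n) < ereal (\<epsilon>\<^sup>2)) sequentially"
    by (rule Limsup_lessD)
  then have "eventually (\<lambda>n. ereal (partition_entropy M (?J n) / real n) < ereal (\<epsilon>\<^sup>2) \<and> n > 0) sequentially"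
    using eventually_gt_at_top[of 0] by (rule eventually_conj)
  then show ?thesis
  proof (rule eventually_mono)
    fix n assume n: "ereal (partition_entropy M (?J n) / real n) < ereal (\<epsilon>\<^sup>2) \<and> 0 < n"
    then have ent: "partition_entropy M (?J n) < \<epsilon>\<^sup>2 * n" by (simp add: divide_less_eq)
    have J: "finite (?J n)" "?J n \<subseteq> sets M" "\<Union>(?J n) = space M" "disjoint (?J n)"
      using iterated_join_partition[OF P T, of n] by auto
    define H where "H = {C \<in> ?J n. prob C \<ge> exp (- (\<epsilon> * n))}"
    define L where "L = {C \<in> ?J n. prob C < exp (- (\<epsilon> * n))}"
    have HL: "?J n = H \<union> L" "H \<inter> L = {}" "finite H" "finite L" using J unfolding H_def L_def by auto
    have union: "prob (\<Union>K) = (\<Sum>C\<in>K. prob C)" if "K \<subseteq> ?J n" for K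
    proof -
      have "disjoint_family_on (\<lambda>C. C) K"
        using that J(4) by (auto simp: disjoint_family_on_def disjoint_def)
      then show ?thesis
        using that J finite_measure_finite_Union[of K "\<lambda>C. C"] finite_subset[OF that J(1)] by auto
    qed
    have tot: "(\<Sum>C\<in>H. prob C) + (\<Sum>C\<in>L. prob C) = 1"
      using union[of "?J n"] HL J prob_space by (simp add: sum.union_disjoint)
    have "card H * exp (- (\<epsilon> * n)) \<le> (\<Sum>C\<in>H. prob C)"
      using sum_mono[of H "\<lambda>_. exp (- (\<epsilon> * n))" prob] by (simp add: H_def)
    also have "\<dots> \<le> 1" using tot sum_nonneg[of L prob] by simp
    finally have card: "card H \<le> exp (\<epsilon> * n)" by (simp add: exp_minus field_simps)
    have pos: "0 \<le> - (prob C * ln (prob C))" for C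
    proof (cases "prob C = 0")
      case False
      then have "prob C > 0" using measure_nonneg[of M C] by linarith
      then have "ln (prob C) \<le> 0" using prob_le_1[of C] by simp
      then show ?thesis by (simp add: mult_nonneg_nonpos)
    qed simp
    have "\<epsilon> * n * (\<Sum>C\<in>L. prob C) = (\<Sum>C\<in>L. prob C * (\<epsilon> * n))" by (simp add: sum_distrib_left mult_ac)
    also have "\<dots> \<le> (\<Sum>C\<in>L. - (prob C * ln (prob C)))"
    proof (rule sum_mono)
      fix C assume C: "C \<in> L"
      show "prob C * (\<epsilon> * n) \<le> - (prob C * ln (prob C))"
      proof (cases "prob C = 0")
        case False
        then have p: "prob C > 0" using measure_nonneg[of M C] by linarith
        have "prob C < exp (- (\<epsilon> * n))" using C by (simp add: L_def)
        then have "ln (prob C) \<le> - (\<epsilon> * n)" using p by (metis less_imp_le ln_exp ln_less_cancel_iff exp_gt_zero)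
        then have "prob C * (\<epsilon> * n) \<le> prob C * (- ln (prob C))" using p by (intro mult_left_mono) auto
        then show ?thesis by simp
      qed simp
    qed
    also have "\<dots> \<le> (\<Sum>C\<in>?J n. - (prob C * ln (prob C)))"
      using HL J pos by (intro sum_mono2) auto
    also have "\<dots> = partition_entropy M (?J n)" by (simp add: partition_entropy_def sum_negf)
    also have "\<dots> < \<epsilon> * n * \<epsilon>" using ent by (simp add: power2_eq_square mult_ac)
    finally have "(\<Sum>C\<in>L. prob C) < \<epsilon>" using \<epsilon> n by (simp add: mult_less_cancel_left_pos)
    then have "prob (\<Union>H) \<ge> 1 - \<epsilon>" using tot union[of H] HL by simp
    then show "\<exists>H\<subseteq>?J n. card H \<le> exp (\<epsilon> * n) \<and> prob (\<Union>H) \<ge> 1 - \<epsilon>"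
      using card HL by blast
  qed
qed

section \<open>Power sequences generated by a system\<close>

locale generated_power_sequence =
  fixes g :: nat and Q :: "nat \<Rightarrow> nat"
    and M :: "'a::polish_space measure" and T :: "'a \<Rightarrow> 'a" and f :: "'a \<Rightarrow> nat" and x :: 'a
  assumes g: "g \<ge> 2"
    and basic: "basic_sequence Q"
    and powers: "\<forall>n\<ge>1. \<exists>k\<ge>1. Q n = g ^ k"
    and generated: "generated_by Q M T f x"
    and ergodic: "ergodic M T"
    and zero_entropy: "ks_entropy M T = 0"
    and log_integrable: "(\<integral>\<^sup>+ u. ennreal (ln (real (f u))) \<partial>M) < \<infinity>"
begin

sublocale prob_space M
  using generated unfolding generated_by_def continuous_mps_def by blast

lemma sets_M [measurable_cong]: "sets M = sets borel"
  using generated unfolding generated_by_def continuous_mps_def by blast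

lemma space_M [simp]: "space M = UNIV"
  using sets_eq_imp_space_eq[OF sets_M] by simp

lemma open_prob_pos: "open U \<Longrightarrow> U \<noteq> {} \<Longrightarrow> prob U > 0"
  using generated unfolding generated_by_def continuous_mps_def by blast

lemma continuous_T: "continuous_on UNIV T"
  using generated unfolding generated_by_def continuous_mps_def by blast

lemma continuous_f: "continuous_on UNIV f"
  using generated unfolding generated_by_def by blast

lemma f_ge_2: "f u \<ge> 2"
  using generated unfolding generated_by_def by blast

lemma generates: "generates_topology T f"
  using generated unfolding generated_by_def by blast

lemma generic: "generic_point M T x"
  using generated unfolding generated_by_def by blast

lemma Q_eq: "n \<ge> 1 \<Longrightarrow> Q n = f ((T ^^ n) x)"
  using generated unfolding generated_by_def by blast

lemma T_measurable [measurable]: "T \<in> measurable M M"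
  using borel_measurable_continuous_onI[OF continuous_T] by (simp add: measurable_cong_sets[OF sets_M sets_M])

lemma measure_preserving: "A \<in> sets M \<Longrightarrow> measure M (T -` A \<inter> space M) = measure M A"
  using generated unfolding generated_by_def continuous_mps_def by simp

lemma continuous_funpow: "continuous_on UNIV (T ^^ n)"
proof (induction n)
  case (Suc n)
  then show ?case using continuous_on_compose[OF Suc] continuous_on_subset[OF continuous_T] by auto
qed (simp add: id_def)

lemma funpow_measurable [measurable]: "(T ^^ n) \<in> measurable M M"
  by (induction n) auto

lemma open_symbol: "open {u. R (f ((T ^^ i) u))}"
proof -
  have "continuous_on UNIV (\<lambda>u. f ((T ^^ i) u))"
    using continuous_on_compose[OF continuous_funpow continuous_on_subset[OF continuous_f]] by (simp add: comp_def)
  then have "open ((\<lambda>u. f ((T ^^ i) u)) -` {m. R m})"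
    by (intro open_vimage discrete_topology_class.open_discrete)
  then show ?thesis by (simp add: vimage_def)
qed

section \<open>Symbol blocks along orbits and their frequencies\<close>

definition block :: "nat \<Rightarrow> 'a \<Rightarrow> nat list" where
  "block n u = map (\<lambda>i. f ((T ^^ i) u)) [0..<n]"

lemma length_block [simp]: "length (block n u) = n"
  by (simp add: block_def)

lemma nth_block [simp]: "i < n \<Longrightarrow> block n u ! i = f ((T ^^ i) u)"
  by (simp add: block_def)

text \<open>An arbitrary predicate covers complements as well, so sets defined by a block are
  clopen.\<close>

lemma open_block: "open {u. R (block n u)}"
proof -
  have "{u. R (block n u)} = (\<Union>B\<in>{B. R B \<and> length B = n}. \<Inter>i\<in>{..<n}. {u. f ((T ^^ i) u) = B ! i})"
  proof (intro set_eqI iffI)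
    fix u assume "u \<in> (\<Union>B\<in>{B. R B \<and> length B = n}. \<Inter>i\<in>{..<n}. {u. f ((T ^^ i) u) = B ! i})"
    then obtain B where B: "R B" "length B = n" "\<forall>i<n. f ((T ^^ i) u) = B ! i" by auto
    then have "block n u = B" by (intro nth_equalityI) auto
    then show "u \<in> {u. R (block n u)}" using B by simp
  next
    fix u assume "u \<in> {u. R (block n u)}"
    then show "u \<in> (\<Union>B\<in>{B. R B \<and> length B = n}. \<Inter>i\<in>{..<n}. {u. f ((T ^^ i) u) = B ! i})"
      by (intro UN_I[of "block n u"]) auto
  qed
  then show ?thesis using open_symbol by (auto intro!: open_UN open_INT)
qed

lemma sets_block [measurable]: "{u. R (block n u)} \<in> sets M"
  using open_block unfolding sets_M by (rule borel_open)

lemma take_block: "m \<le> n \<Longrightarrow> take m (block n u) = block m u"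
  by (rule nth_equalityI) auto

lemma drop_block: "drop m (block n u) = block (n - m) ((T ^^ m) u)"
  by (rule nth_equalityI) (auto simp: add.commute[of m] funpow_add)

lemma block_window: "j \<ge> 1 \<Longrightarrow> block n ((T ^^ j) x) = map (\<lambda>i. Q (j + i)) [0..<n]"
  by (rule nth_equalityI) (auto simp: Q_eq funpow_add add.commute[of j])

lemma generic_average:
  fixes h :: "'a \<Rightarrow> real"
  assumes "continuous_on UNIV h" "integrable M h"
  shows "(\<lambda>N. (\<Sum>j=1..N. h ((T ^^ j) x)) / real N) \<longlonglongrightarrow> (\<integral>u. h u \<partial>M)"
proof -
  have "continuous_on UNIV (\<lambda>u. complex_of_real (h u)) \<and> integrable M (\<lambda>u. complex_of_real (h u))"
    using assms by (auto intro: continuous_intros)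
  then have "(\<lambda>N. (\<Sum>j=1..N. complex_of_real (h ((T ^^ j) x))) / of_nat N) \<longlonglongrightarrow> (\<integral>u. complex_of_real (h u) \<partial>M)"
    using generic unfolding generic_point_def by blast
  then have "(\<lambda>N. complex_of_real ((\<Sum>j=1..N. h ((T ^^ j) x)) / real N)) \<longlonglongrightarrow> complex_of_real (\<integral>u. h u \<partial>M)"
    by simp
  then show ?thesis by (simp only: tendsto_of_real_iff)
qed

lemma continuous_of_open_levels:
  fixes h :: "'a \<Rightarrow> real"
  assumes "\<And>R. open {u. R (h u)}"
  shows "continuous_on UNIV h"
proof -
  have "open (h -` S)" for S
    using assms[of "\<lambda>r. r \<in> S"] by (simp add: vimage_def)
  then show ?thesis by (simp add: continuous_on_open_vimage)
qed

text \<open>Indicators of clopen sets are continuous, so genericity of \<open>x\<close> applies to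
  them without approximation.\<close>

lemma block_frequency: "freq (\<lambda>j. R (block n ((T ^^ j) x))) \<longlonglongrightarrow> prob {u. R (block n u)}"
proof -
  let ?h = "indicat_real {u. R (block n u)}"
  have h: "?h u = of_bool (R (block n u))" for u by (simp add: indicator_def)
  have "integrable M ?h" by (simp add: emeasure_eq_measure sets_block)
  moreover have "continuous_on UNIV ?h"
    by (rule continuous_of_open_levels) (unfold h, rule open_block)
  ultimately have "(\<lambda>N. (\<Sum>j=1..N. ?h ((T ^^ j) x)) / real N) \<longlonglongrightarrow> (\<integral>u. ?h u \<partial>M)"
    by (intro generic_average)
  moreover have "(\<integral>u. ?h u \<partial>M) = prob {u. R (block n u)}" by simp
  ultimately show ?thesis unfolding h freq_eq_sum[abs_def] by simp
qed

text \<open>The hypothesis on powers speaks only of the orbit of \<open>x\<close>. The set of points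
  with another symbol is open and never visited, hence of measure 0 by genericity, hence empty since
  nonempty open sets have positive measure.\<close>

lemma f_power: "\<exists>k\<ge>1. f u = g ^ k"
proof (rule ccontr)
  assume *: "\<not> (\<exists>k\<ge>1. f u = g ^ k)"
  let ?R = "\<lambda>B. \<not> (\<exists>k\<ge>1. hd B = g ^ k)"
  have hd: "hd (block 1 v) = f v" for v by (simp add: block_def)
  have "u \<in> {v. ?R (block 1 v)}" using * hd[of u] by simp
  then have "prob {v. ?R (block 1 v)} > 0"
    using open_block[of ?R 1] by (intro open_prob_pos) blast+
  moreover have "freq (\<lambda>j. ?R (block 1 ((T ^^ j) x))) N = 0" for N
  proof -
    have "{j \<in> {1..N}. ?R (block 1 ((T ^^ j) x))} = {}" using powers by (auto simp: hd[unfolded One_nat_def] Q_eq)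
    then show ?thesis unfolding freq_def by simp
  qed
  then have "prob {v. ?R (block 1 v)} = 0"
    using block_frequency[of ?R 1] LIMSEQ_unique tendsto_const by (metis (no_types, lifting) ext)
  ultimately show False by simp
qed

section \<open>Exponents of the symbols and their mean\<close>

definition expo :: "'a \<Rightarrow> nat" where
  "expo u = (THE k. f u = g ^ k)"

lemma f_eq_expo: "f u = g ^ expo u"
proof -
  obtain k where k: "f u = g ^ k" using f_power by blast
  then have "expo u = k" unfolding expo_def using g by (intro the_equality) auto
  then show ?thesis using k by simp
qed

lemma expo_ge_1: "expo u \<ge> 1"
  using f_power[of u] g f_eq_expo[of u] by auto

lemma prod_block: "prod_list (block n u) = g ^ (\<Sum>i<n. expo ((T ^^ i) u))"
proof (induction n)
  case (Suc n)
  have "block (Suc n) u = block n u @ [f ((T ^^ n) u)]" by (simp add: block_def)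
  then show ?case using Suc by (simp add: power_add f_eq_expo[of "(T ^^ n) u"])
qed (simp add: block_def)

lemma open_expo: "open {u. R (expo u)}"
  using open_symbol[of "\<lambda>m. R (THE k. m = g ^ k)" 0] by (simp add: expo_def)

lemma expo_measurable [measurable]: "expo \<in> measurable M (count_space UNIV)"
proof (rule measurable_count_space_eq2_countable[THEN iffD2])
  show "expo \<in> space M \<rightarrow> UNIV \<and> (\<forall>a\<in>UNIV. expo -` {a} \<inter> space M \<in> sets M)"
    using open_expo borel_open unfolding sets_M by (auto simp: vimage_def)
qed

lemma integrable_expo: "integrable M (\<lambda>u. real (expo u))"
proof -
  have lng: "ln (real g) > 0" using g by simp
  have eq: "ln (real (f u)) = real (expo u) * ln (real g)" for u
    using g by (subst f_eq_expo) (simp add: ln_realpow)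
  have "integrable M (\<lambda>u. real (expo u) * ln (real g))"
    using log_integrable lng eq by (intro integrableI_nonneg) (auto simp: less_top[symmetric] eq)
  then show ?thesis using lng by simp
qed

definition mean_expo :: real where
  "mean_expo = (\<integral>u. real (expo u) \<partial>M)"

lemma mean_expo_ge_1: "mean_expo \<ge> 1"
proof -
  have "(\<integral>u. 1 \<partial>M) \<le> mean_expo"
    unfolding mean_expo_def using expo_ge_1 by (intro integral_mono integrable_expo) auto
  then show ?thesis using prob_space by simp
qed

text \<open>Genericity is used here for a possibly unbounded function: it covers every continuous
  integrable one.\<close>

lemma expo_average: "(\<lambda>N. (\<Sum>j=1..N. real (expo ((T ^^ j) x))) / real N) \<longlonglongrightarrow> mean_expo"
  unfolding mean_expo_def by (rule generic_average[OF continuous_of_open_levels integrable_expo]) (rule open_expo)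

lemma integral_funpow:
  fixes h :: "'a \<Rightarrow> real"
  assumes h: "integrable M h"
  shows "integrable M (\<lambda>u. h ((T ^^ i) u))" "(\<integral>u. h ((T ^^ i) u) \<partial>M) = (\<integral>u. h u \<partial>M)"
proof -
  have hm[measurable]: "h \<in> borel_measurable M" using h by simp
  have distr: "distr M M T = M" by (rule distr_eq_if_measure_preserving[OF T_measurable measure_preserving])
  have "integrable M (\<lambda>u. h ((T ^^ i) u)) \<and> (\<integral>u. h ((T ^^ i) u) \<partial>M) = (\<integral>u. h u \<partial>M)"
  proof (induction i)
    case (Suc i)
    let ?h = "\<lambda>u. h ((T ^^ i) u)"
    show ?case
      using Suc integrable_distr_eq[OF T_measurable, of ?h] integral_distr[OF T_measurable, of ?h]
      by (simp add: distr funpow_swap1)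
  qed (use h in simp)
  then show "integrable M (\<lambda>u. h ((T ^^ i) u))" "(\<integral>u. h ((T ^^ i) u) \<partial>M) = (\<integral>u. h u \<partial>M)" by auto
qed

text \<open>Convergence in measure of the ergodic averages, from the one-sided bound applied to the
  exponent and to its negative.\<close>

lemma expo_sum_deviation:
  fixes \<epsilon> :: real
  assumes "\<epsilon> > 0"
  shows "(\<lambda>n. prob {u. (\<Sum>i<n. real (expo ((T ^^ i) u))) > (mean_expo + \<epsilon>) * n}) \<longlonglongrightarrow> 0"
    "(\<lambda>n. prob {u. (\<Sum>i<n. real (expo ((T ^^ i) u))) < (mean_expo - \<epsilon>) * n}) \<longlonglongrightarrow> 0"
proof -
  show "(\<lambda>n. prob {u. (\<Sum>i<n. real (expo ((T ^^ i) u))) > (mean_expo + \<epsilon>) * n}) \<longlonglongrightarrow> 0"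
    using ergodic_upper_deviation[OF T_measurable measure_preserving ergodic integrable_expo assms]
    by (simp add: mean_expo_def)
  have "integrable M (\<lambda>u. - real (expo u))" using integrable_expo by simp
  from ergodic_upper_deviation[OF T_measurable measure_preserving ergodic this assms]
  show "(\<lambda>n. prob {u. (\<Sum>i<n. real (expo ((T ^^ i) u))) < (mean_expo - \<epsilon>) * n}) \<longlonglongrightarrow> 0"
    by (simp add: mean_expo_def sum_negf algebra_simps)
qed

section \<open>Large exponents and the number of typical blocks\<close>

definition big_expo :: "nat \<Rightarrow> 'a \<Rightarrow> nat" where
  "big_expo R u = (if expo u > R then expo u else 0)"

lemma big_expo_measurable [measurable]: "big_expo R \<in> measurable M (count_space UNIV)"
  unfolding big_expo_def by measurable

lemma integrable_big_expo: "integrable M (\<lambda>u. real (big_expo R u))"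
  by (rule Bochner_Integration.integrable_bound[OF integrable_expo]) (auto simp: big_expo_def)

lemma integral_big_expo_tendsto: "(\<lambda>R. \<integral>u. real (big_expo R u) \<partial>M) \<longlonglongrightarrow> 0"
proof -
  have "(\<lambda>R. \<integral>u. real (big_expo R u) \<partial>M) \<longlonglongrightarrow> (\<integral>u. 0 \<partial>M)"
  proof (rule integral_dominated_convergence[OF _ _ integrable_expo])
    show "AE u in M. (\<lambda>R. real (big_expo R u)) \<longlonglongrightarrow> 0"
    proof (intro AE_I2 tendsto_eventually)
      fix u show "eventually (\<lambda>R. real (big_expo R u) = 0) sequentially"
        using eventually_ge_at_top[of "expo u"] by eventually_elim (simp add: big_expo_def)
    qed
  qed (auto simp: big_expo_def)
  then show ?thesis by simp
qed

text \<open>Markov's inequality: a mean of at most \<open>\<delta>^2\<close> per step yields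
  \<open>\<delta>\<close> both for the threshold per step and for the probability.\<close>

lemma few_big_expos:
  fixes \<delta> :: real
  assumes "\<delta> > 0" "(\<integral>u. real (big_expo R u) \<partial>M) \<le> \<delta>\<^sup>2" "n > 0"
  shows "prob {u. (\<Sum>i<n. real (big_expo R ((T ^^ i) u))) > \<delta> * n} \<le> \<delta>"
proof -
  let ?X = "\<lambda>u. \<Sum>i<n. real (big_expo R ((T ^^ i) u))"
  have int: "integrable M ?X" by (intro Bochner_Integration.integrable_sum integral_funpow integrable_big_expo)
  have "(\<integral>u. ?X u \<partial>M) = n * (\<integral>u. real (big_expo R u) \<partial>M)"
    by (subst Bochner_Integration.integral_sum) (simp_all add: integral_funpow[OF integrable_big_expo])
  also have "\<dots> \<le> n * \<delta>\<^sup>2" using assms by (intro mult_left_mono) auto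
  finally have "(\<integral>u. ?X u \<partial>M) \<le> n * \<delta>\<^sup>2" .
  moreover have "prob {u \<in> space M. \<delta> * n \<le> ?X u} \<le> (\<integral>u. ?X u \<partial>M) / (\<delta> * n)"
    using assms by (intro integral_Markov_inequality_measure[where A = "{}", simplified] int) (auto intro!: AE_I2 sum_nonneg)
  moreover have "(\<integral>u. ?X u \<partial>M) / (\<delta> * n) \<le> n * \<delta>\<^sup>2 / (\<delta> * n)"
    using assms calculation by (intro divide_right_mono) auto
  ultimately have "prob {u. \<delta> * n \<le> ?X u} \<le> n * \<delta>\<^sup>2 / (\<delta> * n)"
    by (simp only: space_M UNIV_I simp_thms)
  also have "\<dots> = \<delta>" using assms by (simp add: power2_eq_square)
  finally have "prob {u. \<delta> * n \<le> ?X u} \<le> \<delta>" .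
  moreover have "prob {u. ?X u > \<delta> * n} \<le> prob {u. \<delta> * n \<le> ?X u}"
    by (intro finite_measure_mono) auto
  ultimately show ?thesis by linarith
qed

text \<open>
  Entropy is defined by finite partitions, so large exponents are merged into one class. Given the
  truncated block, the large exponents are recovered from a list of positive integers with sum at
  most \<open>m\<close>, for which there are at most \<open>2 ^ m\<close> choices.
\<close>

definition truncation_partition :: "nat \<Rightarrow> 'a set set" where
  "truncation_partition R = (\<lambda>c. {u. min (expo u) (Suc R) = c}) ` {..Suc R} - {{}}"

lemma truncation_partition: "measurable_partition M (truncation_partition R)"
  unfolding measurable_partition_def
proof (intro conjI)
  have "{u. min (expo u) (Suc R) = c} \<in> sets M" for c
    using open_expo[of "\<lambda>k. min k (Suc R) = c"] unfolding sets_M by (rule borel_open)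
  then show "truncation_partition R \<subseteq> sets M" unfolding truncation_partition_def by auto
  have "\<Union>(truncation_partition R) = UNIV"
  proof -
    have "u \<in> \<Union>(truncation_partition R)" for u
      unfolding truncation_partition_def
      by (intro UnionI[of "{v. min (expo v) (Suc R) = min (expo u) (Suc R)}"]) auto
    then show ?thesis by auto
  qed
  moreover have "disjoint (truncation_partition R)"
    unfolding truncation_partition_def by (auto simp: disjoint_def)
  ultimately show "partition_on (space M) (truncation_partition R)"
    by (auto simp: partition_on_def truncation_partition_def)
qed (simp add: truncation_partition_def)

lemma card_blocks_in_cell:
  assumes C: "C \<in> iterated_join M T (truncation_partition R) n"
  shows "finite (block n ` (C \<inter> {u. (\<Sum>i<n. big_expo R ((T ^^ i) u)) \<le> m})) \<and>
    card (block n ` (C \<inter> {u. (\<Sum>i<n. big_expo R ((T ^^ i) u)) \<le> m})) \<le> 2 ^ m"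
proof (cases "C \<inter> {u. (\<Sum>i<n. big_expo R ((T ^^ i) u)) \<le> m} = {}")
  case False
  let ?E = "C \<inter> {u. (\<Sum>i<n. big_expo R ((T ^^ i) u)) \<le> m}"
  obtain w where w: "w \<in> C" using False by blast
  have same: "min (expo ((T ^^ i) u)) (Suc R) = min (expo ((T ^^ i) w)) (Suc R)" if u: "u \<in> C" "i < n" for u i
    using iterated_join_same_cell[OF C u(1) w u(2)] by (auto simp: truncation_partition_def)
  define z where "z = map (\<lambda>i. expo ((T ^^ i) w) > R) [0..<n]"
  define S where "S = {v. list_all2 (\<lambda>b v. b = (v \<ge> (1::nat))) z v \<and> sum_list v \<le> m}"
  have S: "finite S" "card S \<le> 2 ^ m" using card_positive_lists_le[of z m] unfolding S_def by auto
  \<comment> \<open>Points of the cell share with \<open>w\<close> the positions of the large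
    exponents and all small symbols; \<open>v\<close> supplies the large exponents and is 0
    elsewhere.\<close>
  define dec where "dec v = map (\<lambda>i. if expo ((T ^^ i) w) > R then g ^ (v ! i) else f ((T ^^ i) w)) [0..<n]" for v
  have "block n u \<in> dec ` S" if u: "u \<in> ?E" for u
  proof
    let ?v = "map (\<lambda>i. big_expo R ((T ^^ i) u)) [0..<n]"
    have iff: "expo ((T ^^ i) u) > R \<longleftrightarrow> expo ((T ^^ i) w) > R" if "i < n" for i
      using same[of u i] u that by (auto simp: min_def split: if_splits)
    have "sum_list ?v = (\<Sum>i<n. big_expo R ((T ^^ i) u))"
      by (simp add: interv_sum_list_conv_sum_set_nat atLeast0LessThan)
    then show "?v \<in> S"
      using u iff expo_ge_1[unfolded One_nat_def] by (auto simp: S_def z_def list_all2_conv_all_nth big_expo_def)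
    show "block n u = dec ?v"
    proof (rule nth_equalityI)
      fix i assume "i < length (block n u)"
      then have i: "i < n" by simp
      show "block n u ! i = dec ?v ! i"
      proof (cases "expo ((T ^^ i) w) > R")
        case True
        then show ?thesis using i iff[OF i] by (simp add: dec_def big_expo_def f_eq_expo[of "(T ^^ i) u"])
      next
        case False
        then have "expo ((T ^^ i) u) = expo ((T ^^ i) w)" using same[of u i] u i by (auto simp: min_def split: if_splits)
        then show ?thesis using False i by (simp add: dec_def f_eq_expo[of "(T ^^ i) u"] f_eq_expo[of "(T ^^ i) w"])
      qed
    qed (simp add: dec_def)
  qed
  then have sub: "block n ` ?E \<subseteq> dec ` S" by blast
  then have "card (block n ` ?E) \<le> card (dec ` S)" using S by (intro card_mono) auto
  also have "\<dots> \<le> 2 ^ m" using S card_image_le[of S dec] by linarith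
  finally show ?thesis using finite_subset[OF sub] S by simp
qed simp

text \<open>The truncated partition has few heavy cells, and inside one a total of at most
  \<open>m\<close> for the large exponents leaves at most \<open>2 ^ m\<close> blocks. The bounds on
  the exponent sums control the product of each block; the treatment of Q-normality depends on
  them.\<close>

lemma few_typical_blocks:
  fixes \<epsilon> :: real
  assumes \<epsilon>: "\<epsilon> > 0"
  shows "eventually (\<lambda>n. \<exists>G. finite G \<and> real (card G) \<le> exp (\<epsilon> * n) \<and> prob {u. block n u \<in> G} \<ge> 1 - \<epsilon> \<and>
    (\<forall>B\<in>G. \<exists>u. B = block n u \<and> (mean_expo - \<epsilon>) * n \<le> (\<Sum>i<n. real (expo ((T ^^ i) u)))
       \<and> (\<Sum>i<n. real (expo ((T ^^ i) u))) \<le> (mean_expo + \<epsilon>) * n)) sequentially"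
proof -
  \<comment> \<open>Four exceptional sets of measure at most \<open>\<delta>\<close> each: the light
    cells, the sets \<open>?U1\<close> and \<open>?U2\<close> of wrong exponent sums, and the set
    \<open>?U3\<close> where the large exponents sum to more than
    \<open>\<delta> * n\<close>.\<close>
  define \<delta> where "\<delta> = \<epsilon> / 4"
  have \<delta>: "\<delta> > 0" using \<epsilon> by (simp add: \<delta>_def)
  have "eventually (\<lambda>R. (\<integral>u. real (big_expo R u) \<partial>M) < \<delta>\<^sup>2) sequentially"
    using integral_big_expo_tendsto by (rule order_tendstoD) (use \<delta> in simp)
  then obtain R where "(\<integral>u. real (big_expo R u) \<partial>M) < \<delta>\<^sup>2"
    by (auto simp: eventually_sequentially)
  then have R: "(\<integral>u. real (big_expo R u) \<partial>M) \<le> \<delta>\<^sup>2" by simp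
  let ?J = "iterated_join M T (truncation_partition R)"
  let ?s = "\<lambda>n u. \<Sum>i<n. real (expo ((T ^^ i) u))"
  have "eventually (\<lambda>n. \<exists>H\<subseteq>?J n. card H \<le> exp (\<delta> * n) \<and> prob (\<Union>H) \<ge> 1 - \<delta>) sequentially"
    by (rule zero_entropy_heavy_cells[OF truncation_partition T_measurable zero_entropy \<delta>])
  moreover have "eventually (\<lambda>n. prob {u. ?s n u > (mean_expo + \<epsilon>) * n} < \<delta>) sequentially"
    "eventually (\<lambda>n. prob {u. ?s n u < (mean_expo - \<epsilon>) * n} < \<delta>) sequentially"
    using expo_sum_deviation[OF \<epsilon>] \<delta> by (auto intro: order_tendstoD)
  ultimately show ?thesis using eventually_gt_at_top[of 0]
  proof eventually_elim
    case (elim n)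
    then obtain H where H: "H \<subseteq> ?J n" "card H \<le> exp (\<delta> * n)" "prob (\<Union>H) \<ge> 1 - \<delta>" by blast
    have J: "finite (?J n)" "?J n \<subseteq> sets M"
      using iterated_join_partition[OF truncation_partition T_measurable, of R n] by auto
    define m where "m = nat \<lfloor>\<delta> * n\<rfloor>"
    let ?b = "\<lambda>u. (\<Sum>i<n. big_expo R ((T ^^ i) u)) \<le> m"
    let ?U1 = "{u. ?s n u > (mean_expo + \<epsilon>) * n}"
    let ?U2 = "{u. ?s n u < (mean_expo - \<epsilon>) * n}"
    let ?U3 = "{u. (\<Sum>i<n. real (big_expo R ((T ^^ i) u))) > \<delta> * n}"
    have "{u \<in> space M. ?s n u > (mean_expo + \<epsilon>) * n} \<in> sets M"
      "{u \<in> space M. ?s n u < (mean_expo - \<epsilon>) * n} \<in> sets M"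
      "{u \<in> space M. (\<Sum>i<n. real (big_expo R ((T ^^ i) u))) > \<delta> * n} \<in> sets M"
      by measurable
    then have U: "?U1 \<in> sets M" "?U2 \<in> sets M" "?U3 \<in> sets M"
      by simp_all
    define E where "E = \<Union>H - ?U1 - ?U2 - ?U3"
    have bE: "?b u" if "u \<in> E" for u
    proof -
      have "real (\<Sum>i<n. big_expo R ((T ^^ i) u)) \<le> \<delta> * n" using that by (auto simp: E_def not_less)
      then show ?thesis unfolding m_def by (simp add: le_nat_floor)
    qed
    define G where "G = block n ` E"
    have sub: "G \<subseteq> (\<Union>C\<in>H. block n ` (C \<inter> {u. ?b u}))" using bE unfolding G_def E_def by blast
    have finH: "finite H" using H J finite_subset by blast
    have cell: "finite (block n ` (C \<inter> {u. ?b u}))" "card (block n ` (C \<inter> {u. ?b u})) \<le> 2 ^ m" if "C \<in> H" for C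
      using card_blocks_in_cell[of C R n m] that H by auto
    have finG: "finite G" using finite_subset[OF sub] finH cell by auto
    have "card G \<le> card (\<Union>C\<in>H. block n ` (C \<inter> {u. ?b u}))" using sub finH cell by (intro card_mono) auto
    also have "\<dots> \<le> (\<Sum>C\<in>H. card (block n ` (C \<inter> {u. ?b u})))" using finH by (rule card_UN_le)
    also have "\<dots> \<le> card H * 2 ^ m" using sum_bounded_above[of H "\<lambda>C. card (block n ` (C \<inter> {u. ?b u}))" "2 ^ m"] cell(2) by simp
    finally have "real (card G) \<le> real (card H) * 2 ^ m"
      using of_nat_mono by fastforce
    also have "\<dots> \<le> exp (\<delta> * n) * exp (\<delta> * n)"
    proof (rule mult_mono[OF H(2)])
      have "(2::real) \<le> exp 1" using exp_ge_add_one_self[of 1] by simp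
      then have "(2::real) ^ m \<le> exp 1 ^ m" by (intro power_mono) auto
      also have "\<dots> = exp (real m)" by (simp add: exp_of_nat_mult[symmetric])
      also have "\<dots> \<le> exp (\<delta> * n)" using \<delta> by (simp add: m_def)
      finally show "(2::real) ^ m \<le> exp (\<delta> * n)" .
    qed auto
    also have "\<dots> = exp (2 * \<delta> * n)" by (simp add: exp_add[symmetric])
    also have "\<dots> \<le> exp (\<epsilon> * n)" using \<epsilon> by (simp add: \<delta>_def mult_right_mono)
    finally have cardG: "real (card G) \<le> exp (\<epsilon> * n)" .
    have Hm: "\<Union>H \<in> sets M" using H J finH by (intro sets.finite_Union) auto
    have "1 - \<delta> \<le> prob (\<Union>H)" by (rule H(3))
    also have "\<dots> \<le> prob (E \<union> ?U1 \<union> ?U2 \<union> ?U3)"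
      using Hm by (intro finite_measure_mono) (auto simp: E_def)
    also have "\<dots> \<le> prob E + prob ?U1 + prob ?U2 + prob ?U3"
    proof -
      have Em: "E \<in> sets M" unfolding E_def using Hm by auto
      show ?thesis
        using measure_Un_le[of "E \<union> ?U1 \<union> ?U2" M ?U3] measure_Un_le[of "E \<union> ?U1" M ?U2] measure_Un_le[of E M ?U1] Em U
        by (auto intro: sets.Un)
    qed
    also have "\<dots> \<le> prob E + 3 * \<delta>"
      using elim(2,3) few_big_expos[OF \<delta> R, of n] elim(4) by simp
    also have "prob E \<le> prob {u. block n u \<in> G}"
      by (intro finite_measure_mono) (auto simp: G_def)
    finally have "1 - \<epsilon> \<le> prob {u. block n u \<in> G}" by (simp add: \<delta>_def)
    moreover have "\<exists>u. B = block n u \<and> (mean_expo - \<epsilon>) * n \<le> ?s n u \<and> ?s n u \<le> (mean_expo + \<epsilon>) * n" if "B \<in> G" for B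
      using that by (auto simp: G_def E_def not_less)
    ultimately show ?case using finG cardG by blast
  qed
qed

end

section \<open>Windows with wrong statistics\<close>

lemma sum_shift_bound:
  fixes X :: "nat \<Rightarrow> real"
  assumes "\<And>j. \<bar>X j\<bar> \<le> 1"
  shows "\<bar>(\<Sum>j=1..N. X (j + s)) - (\<Sum>j=1..N. X j)\<bar> \<le> 2 * s"
proof (induction s)
  case (Suc s)
  have tele: "(\<Sum>j=1..N. X (j + Suc s) - X (j + s)) = X (N + Suc s) - X (Suc s)"
    by (induction N) auto
  have "\<bar>(\<Sum>j=1..N. X (j + Suc s)) - (\<Sum>j=1..N. X (j + s))\<bar> \<le> 2"
    unfolding sum_subtractf[symmetric] tele using assms[of "N + Suc s"] assms[of "Suc s"] by linarith
  then show ?case using Suc by simp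
qed simp

text \<open>Summing over all windows counts each \<open>X j\<close> \<open>m\<close> times up to
  boundary terms. A good window contributes at most \<open>\<eta> * n\<close>, a bad one at most
  \<open>m \<le> n\<close>; dividing by \<open>m\<close> costs the factor 2 from
  \<open>n \<le> 2 * m\<close>.\<close>

lemma window_average_bound:
  fixes X :: "nat \<Rightarrow> real"
  assumes X: "\<And>j. \<bar>X j\<bar> \<le> 1" and m: "m > 0" "n \<le> 2 * m" "m \<le> n" and N: "N > 0" and \<eta>: "\<eta> \<ge> 0"
  shows "\<bar>(\<Sum>j=1..N. X j) / N\<bar> \<le> 2 * real m / N + 2 * (\<eta> + freq (\<lambda>j. \<bar>\<Sum>s<m. X (j + s)\<bar> > \<eta> * n) N)"
proof -
  let ?W = "\<lambda>j. \<Sum>s<m. X (j + s)"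
  let ?S = "\<Sum>j=1..N. X j"
  let ?F = "freq (\<lambda>j. \<bar>?W j\<bar> > \<eta> * n) N"
  have "(\<Sum>j=1..N. ?W j) - m * ?S = (\<Sum>s<m. (\<Sum>j=1..N. X (j + s)) - ?S)"
    by (subst sum.swap) (simp add: sum_subtractf)
  then have "\<bar>(\<Sum>j=1..N. ?W j) - m * ?S\<bar> = \<bar>\<Sum>s<m. (\<Sum>j=1..N. X (j + s)) - ?S\<bar>" by simp
  also have "\<dots> \<le> (\<Sum>s<m. \<bar>(\<Sum>j=1..N. X (j + s)) - ?S\<bar>)" by (rule sum_abs)
  also have "\<dots> \<le> (\<Sum>s<m. 2 * real m)"
  proof (rule sum_mono)
    fix s assume "s \<in> {..<m}"
    then show "\<bar>(\<Sum>j=1..N. X (j + s)) - ?S\<bar> \<le> 2 * real m" using sum_shift_bound[of X s N, OF X] by simp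
  qed
  also have "\<dots> = 2 * real m * m" by simp
  finally have 1: "\<bar>(\<Sum>j=1..N. ?W j) - m * ?S\<bar> \<le> 2 * real m * m" .
  have W: "\<bar>?W j\<bar> \<le> m" for j
  proof -
    have "\<bar>?W j\<bar> \<le> (\<Sum>s<m. 1)" using X by (intro order_trans[OF sum_abs] sum_mono) auto
    then show ?thesis by simp
  qed
  have "\<bar>\<Sum>j=1..N. ?W j\<bar> \<le> (\<Sum>j=1..N. \<bar>?W j\<bar>)" by (rule sum_abs)
  also have "\<dots> \<le> (\<Sum>j=1..N. \<eta> * n + n * of_bool (\<bar>?W j\<bar> > \<eta> * n))"
  proof (rule sum_mono)
    fix j
    have "0 \<le> \<eta> * n" "\<bar>?W j\<bar> \<le> n" using \<eta> W[of j] m by auto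
    then show "\<bar>?W j\<bar> \<le> \<eta> * n + n * of_bool (\<bar>?W j\<bar> > \<eta> * n)" by auto
  qed
  also have "\<dots> = n * N * (\<eta> + ?F)"
    using N by (simp add: sum.distrib sum_distrib_left[symmetric] freq_eq_sum field_simps)
  finally have 2: "\<bar>\<Sum>j=1..N. ?W j\<bar> \<le> n * N * (\<eta> + ?F)" .
  have "m * \<bar>?S\<bar> = \<bar>m * ?S\<bar>" by (simp add: abs_mult)
  also have "\<dots> \<le> 2 * real m * m + n * N * (\<eta> + ?F)" using 1 2 by linarith
  also have "\<dots> \<le> 2 * real m * m + (2 * real m) * N * (\<eta> + ?F)"
    using m \<eta> by (intro add_left_mono mult_right_mono) (auto simp: freq_nonneg)
  also have "\<dots> = m * (2 * real m + 2 * N * (\<eta> + ?F))" by (simp add: algebra_simps)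
  finally have "\<bar>?S\<bar> \<le> 2 * real m + 2 * N * (\<eta> + ?F)" using m by (simp only: mult_le_cancel_left_pos of_nat_0_less_iff)
  then have "\<bar>?S\<bar> / N \<le> (2 * real m + 2 * N * (\<eta> + ?F)) / N" by (rule divide_right_mono) simp
  then show ?thesis using N by (simp add: add_divide_distrib)
qed

context generated_power_sequence
begin

section \<open>Joint blocks of symbols and digits\<close>

definition digit_block :: "real \<Rightarrow> nat \<Rightarrow> nat \<Rightarrow> nat list" where
  "digit_block z n j = map (\<lambda>i. cantor_digits Q z (j + i)) [0..<n]"

abbreviation symbol_block :: "nat \<Rightarrow> nat \<Rightarrow> nat list" where
  "symbol_block n j \<equiv> block n ((T ^^ j) x)"

definition cell_normal :: "real \<Rightarrow> bool" where
  "cell_normal z \<longleftrightarrow> (\<forall>\<beta> d. \<beta> \<noteq> [] \<and> d \<in> digit_box \<beta> \<longrightarrow>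
     freq (\<lambda>j. symbol_block (length \<beta>) j = \<beta> \<and> digit_block z (length \<beta>) j = d)
       \<longlonglongrightarrow> prob {u. block (length \<beta>) u = \<beta>} / real (prod_list \<beta>))"

lemma cell_normalD:
  assumes "cell_normal z" "\<beta> \<noteq> []" "d \<in> digit_box \<beta>"
  shows "freq (\<lambda>j. symbol_block (length \<beta>) j = \<beta> \<and> digit_block z (length \<beta>) j = d)
       \<longlonglongrightarrow> prob {u. block (length \<beta>) u = \<beta>} / real (prod_list \<beta>)"
  using assms unfolding cell_normal_def by blast

lemma length_digit_block [simp]: "length (digit_block z n j) = n"
  by (simp add: digit_block_def)

lemma take_drop_digit_block: "s + l \<le> n \<Longrightarrow> take l (drop s (digit_block z n j)) = digit_block z l (j + s)"
  by (rule nth_equalityI) (auto simp: digit_block_def add_ac)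

lemma take_drop_symbol_block: "s + l \<le> n \<Longrightarrow> take l (drop s (symbol_block n j)) = symbol_block l (j + s)"
  by (simp add: drop_block take_block funpow_add add.commute[of j])

lemma digit_block_eq:
  assumes "0 \<le> z" "z < 1" "j \<ge> 1"
  shows "digit_block z n j = digs (symbol_block n j) (orbit_rem Q z (j - 1))"
  using digit_window[OF basic assms(1,2), of "j - 1" n] block_window[OF assms(3), of n] assms(3)
  by (simp add: digit_block_def)

lemma symbol_pos: "\<forall>b\<in>set (block n u). b > 0"
  using f_ge_2 by (auto simp: block_def intro: less_le_trans[OF zero_less_numeral])

lemma digit_block_less:
  assumes "0 \<le> z" "z < 1" "j \<ge> 1"
  shows "digit_block z n j \<in> digit_box (symbol_block n j)"
  using digs_less[OF orbit_rem_bounds symbol_pos] by (simp add: digit_block_eq[OF assms])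

lemma digit_block_iff:
  assumes "0 \<le> z" "z < 1" "j \<ge> 1" "D \<in> digit_box (symbol_block n j)"
  shows "digit_block z n j = D \<longleftrightarrow> orbit_rem Q z (j - 1) \<in> cell_interval (symbol_block n j) D"
  using digs_eq_iff[OF _ orbit_rem_bounds] assms(4) by (simp add: digit_block_eq[OF assms(1-3)])

definition bad_digits :: "nat list \<Rightarrow> nat list \<Rightarrow> real \<Rightarrow> nat list \<Rightarrow> nat list set" where
  "bad_digits \<beta> d \<eta> B = {D \<in> digit_box B. \<bar>block_excess \<beta> d B D\<bar> > \<eta> * length B}"

lemma finite_bad_digits [simp]: "finite (bad_digits \<beta> d \<eta> B)"
  unfolding bad_digits_def by (rule finite_subset[OF _ finite_digit_box]) auto

text \<open>Centring the digit indicator at \<open>1 / prod_list \<beta>\<close> on occurrences of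
  \<open>\<beta>\<close> makes the window sums equal to \<open>block_excess\<close>, so rare bad
  windows force the centred average to 0. Genericity then supplies the frequency of
  \<open>\<beta>\<close> itself.\<close>

lemma cell_frequency_from_windows:
  assumes \<beta>: "\<beta> \<noteq> []" and d: "d \<in> digit_box \<beta>"
    and bad: "\<And>\<eta>::real. 0 < \<eta> \<Longrightarrow> \<eta> \<le> 1 \<Longrightarrow> \<exists>n\<ge>2 * length \<beta>.
      eventually (\<lambda>N. freq (\<lambda>j. \<bar>block_excess \<beta> d (symbol_block n j) (digit_block z n j)\<bar> > \<eta> * n) N \<le> \<eta>) sequentially"
  shows "freq (\<lambda>j. symbol_block (length \<beta>) j = \<beta> \<and> digit_block z (length \<beta>) j = d)
       \<longlonglongrightarrow> prob {u. block (length \<beta>) u = \<beta>} / real (prod_list \<beta>)"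
proof -
  let ?l = "length \<beta>"
  define c where "c = 1 / real (prod_list \<beta>)"
  have c: "0 \<le> c" "c \<le> 1" unfolding c_def by (auto simp: divide_le_eq_1)
  define X where "X j = (if symbol_block ?l j = \<beta> then (if digit_block z ?l j = d then 1 else 0) - c else 0)" for j
  have X: "\<bar>X j\<bar> \<le> 1" for j using c by (auto simp: X_def)
  have avg: "(\<Sum>j=1..N. X j) / N = freq (\<lambda>j. symbol_block ?l j = \<beta> \<and> digit_block z ?l j = d) N - c * freq (\<lambda>j. symbol_block ?l j = \<beta>) N" for N
  proof -
    have "X j = of_bool (symbol_block ?l j = \<beta> \<and> digit_block z ?l j = d) - c * of_bool (symbol_block ?l j = \<beta>)" for j
      by (auto simp: X_def)
    then show ?thesis
      unfolding freq_eq_sum by (simp add: sum_subtractf sum_distrib_left diff_divide_distrib)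
  qed
  have "(\<lambda>N. (\<Sum>j=1..N. X j) / N) \<longlonglongrightarrow> 0"
  proof (rule tendstoI)
    fix e :: real assume e: "e > 0"
    \<comment> \<open>The bound obtained below is at most
      \<open>e / 6 + 2 * (\<eta> + \<eta>)\<close>, hence below \<open>e\<close>.\<close>
    define \<eta> where "\<eta> = min 1 (e / 6)"
    have \<eta>: "0 < \<eta>" "\<eta> \<le> 1" "\<eta> \<le> e / 6" using e by (auto simp: \<eta>_def)
    obtain n where n: "n \<ge> 2 * ?l" and ev: "eventually (\<lambda>N. freq (\<lambda>j. \<bar>block_excess \<beta> d (symbol_block n j) (digit_block z n j)\<bar> > \<eta> * n) N \<le> \<eta>) sequentially"
      using bad[OF \<eta>(1,2)] by blast
    \<comment> \<open>The number of starting positions of \<open>\<beta>\<close> in a window;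
      \<open>n \<ge> 2 * length \<beta>\<close> gives \<open>n \<le> 2 * m\<close>.\<close>
    define m where "m = n + 1 - ?l"
    have l: "?l \<ge> 1" using \<beta> by (cases \<beta>) auto
    have m: "m > 0" "n \<le> 2 * m" "m \<le> n" using n l by (auto simp: m_def)
    have excess: "block_excess \<beta> d (symbol_block n j) (digit_block z n j) = (\<Sum>s<m. X (j + s))" for j
    proof -
      have set: "{s. s + ?l \<le> n} = {..<m}" using n by (auto simp: m_def)
      show ?thesis
        by (subst block_excess_eq[OF d]) (auto simp: set X_def c_def take_drop_symbol_block take_drop_digit_block m_def intro!: sum.cong)
    qed
    have "eventually (\<lambda>N. 2 * real m / real N < e / 6) sequentially"
      by (rule order_tendstoD(2)[OF lim_const_over_n]) (use e in simp)
    with ev show "eventually (\<lambda>N. dist ((\<Sum>j=1..N. X j) / N) 0 < e) sequentially"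
      using eventually_gt_at_top[of 0]
    proof eventually_elim
      case (elim N)
      have "\<bar>(\<Sum>j=1..N. X j) / N\<bar> \<le> 2 * real m / N + 2 * (\<eta> + freq (\<lambda>j. \<bar>\<Sum>s<m. X (j + s)\<bar> > \<eta> * n) N)"
        using X m elim(3) \<eta>(1) by (intro window_average_bound) auto
      then show ?case using elim \<eta> e unfolding excess by (simp add: dist_real_def)
    qed
  qed
  moreover have "freq (\<lambda>j. symbol_block ?l j = \<beta>) \<longlonglongrightarrow> prob {u. block ?l u = \<beta>}"
    using block_frequency[of "\<lambda>B. B = \<beta>"] .
  ultimately have "(\<lambda>N. (\<Sum>j=1..N. X j) / N + c * freq (\<lambda>j. symbol_block ?l j = \<beta>) N) \<longlonglongrightarrow> 0 + c * prob {u. block ?l u = \<beta>}"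
    by (intro tendsto_intros)
  then show ?thesis unfolding avg by (simp add: c_def)
qed

lemma atypical_frequency:
  assumes "prob {u. block n u \<in> G} \<ge> 1 - \<epsilon>" "\<epsilon> > 0"
  shows "eventually (\<lambda>N. freq (\<lambda>j. symbol_block n j \<notin> G) N \<le> 2 * \<epsilon>) sequentially"
proof -
  have "{u. block n u \<notin> G} = space M - {u. block n u \<in> G}" by auto
  then have "prob {u. block n u \<notin> G} = 1 - prob {u. block n u \<in> G}"
    using prob_compl[OF sets_block[of "\<lambda>B. B \<in> G" n]] by simp
  then have "prob {u. block n u \<notin> G} < 2 * \<epsilon>" using assms by linarith
  with block_frequency[of "\<lambda>B. B \<notin> G" n] have "eventually (\<lambda>N. freq (\<lambda>j. symbol_block n j \<notin> G) N < 2 * \<epsilon>) sequentially"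
    by (rule order_tendstoD)
  then show ?thesis by eventually_elim simp
qed

lemma card_bad_digits:
  assumes "\<beta> \<noteq> []" "d \<in> digit_box \<beta>" "0 < \<eta>" "\<eta> \<le> 1" "length B = n"
  shows "real (card (bad_digits \<beta> d \<eta> B)) \<le> 2 * real (prod_list B) * exp (- (\<eta>\<^sup>2 / (4 * (real (length \<beta>))\<^sup>2)) * n)"
  using card_block_excess[OF assms(2,1,3,4), of B] assms(5) unfolding bad_digits_def by simp

lemma exp_decay_eventually:
  fixes c a \<eta> :: real
  assumes "c > 0" "\<eta> > 0"
  shows "eventually (\<lambda>n. a * exp (- c * real n) \<le> \<eta>) sequentially"
proof -
  have "(\<lambda>n. a * exp (- c * real n)) \<longlonglongrightarrow> 0"
    using assms by real_asymp
  then have "eventually (\<lambda>n. a * exp (- c * real n) < \<eta>) sequentially"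
    by (rule order_tendstoD) (use assms in simp)
  then show ?thesis by eventually_elim simp
qed

text \<open>A bad digit block over a typical symbol block \<open>B\<close> is a visit to a
  \<open>g\<close>-adic interval of length \<open>1 / prod_list B\<close>. Summing over the bad
  digit blocks of \<open>B\<close> cancels this product and leaves
  \<open>2 * C * exp (- c * n)\<close>, a decay that outweighs the number of typical blocks.\<close>

lemma cell_normal_if_bounded_density:
  assumes z: "0 \<le> z" "z < 1" and C: "C \<ge> 0"
    and bound: "\<And>k v \<delta>. v < g ^ k \<Longrightarrow> \<delta> > 0 \<Longrightarrow>
      eventually (\<lambda>N. freq (\<lambda>j. orbit_rem Q z (j - 1) \<in> {real v / real (g ^ k)..<(real v + 1) / real (g ^ k)}) N
        \<le> C / real (g ^ k) + \<delta>) sequentially"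
  shows "cell_normal z"
  unfolding cell_normal_def
proof (intro allI impI cell_frequency_from_windows)
  fix \<beta> d and \<eta> :: real
  assume \<beta>d: "\<beta> \<noteq> [] \<and> d \<in> digit_box \<beta>" and \<eta>: "0 < \<eta>" "\<eta> \<le> 1"
  define c where "c = \<eta>\<^sup>2 / (4 * (real (length \<beta>))\<^sup>2)"
  have c: "c > 0" using \<eta> \<beta>d by (simp add: c_def)
  \<comment> \<open>The bound \<open>c / 2\<close> lets half of the decay absorb
    \<open>card G\<close>; \<open>\<eta> / 4\<close> pays for the atypical windows, whose frequency
    is at most \<open>2 * \<epsilon>\<close>.\<close>
  define \<epsilon> where "\<epsilon> = min (c / 2) (\<eta> / 4)"
  have \<epsilon>: "\<epsilon> > 0" "\<epsilon> \<le> c / 2" "\<epsilon> \<le> \<eta> / 4" using c \<eta> by (auto simp: \<epsilon>_def)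
  have "eventually (\<lambda>n. 2 * C * exp (- (c / 2) * real n) \<le> \<eta> / 4) sequentially"
    using c \<eta> by (intro exp_decay_eventually) auto
  from eventually_happens'[OF sequentially_bot eventually_conj[OF few_typical_blocks[OF \<epsilon>(1)] eventually_conj[OF this eventually_ge_at_top[of "2 * length \<beta>"]]]]
  obtain n G where n: "n \<ge> 2 * length \<beta>" "2 * C * exp (- (c / 2) * real n) \<le> \<eta> / 4"
    and G: "finite G" "real (card G) \<le> exp (\<epsilon> * n)" "prob {u. block n u \<in> G} \<ge> 1 - \<epsilon>" "\<forall>B\<in>G. \<exists>u. B = block n u"
    by blast
  let ?W = "bad_digits \<beta> d \<eta>"
  define I where "I = (SIGMA B:G. ?W B)"
  have I: "finite I" unfolding I_def using G by auto
  \<comment> \<open>The error per interval is fixed only after the finite family \<open>I\<close>,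
    so the errors add up to at most \<open>\<eta> / 4\<close>.\<close>
  define \<delta> where "\<delta> = \<eta> / (4 * (real (card I) + 1))"
  have \<delta>: "\<delta> > 0" "card I * \<delta> \<le> \<eta> / 4" using \<eta> by (auto simp: \<delta>_def field_simps)
  have len: "length B = n" if "B \<in> G" for B using G(4) that by fastforce
  have cells: "eventually (\<lambda>N. \<forall>p\<in>I. freq (\<lambda>j. orbit_rem Q z (j - 1) \<in> cell_interval (fst p) (snd p)) N \<le> C / real (prod_list (fst p)) + \<delta>) sequentially"
  proof (rule eventually_ball_finite[OF I], intro ballI)
    fix p assume "p \<in> I"
    then obtain B D where p: "p = (B, D)" "B \<in> G" "D \<in> ?W B" by (auto simp: I_def)
    obtain u where u: "B = block n u" using G(4) p by blast
    have "block_value B D < prod_list B" using p by (intro block_value_less) (auto simp: bad_digits_def)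
    then show "eventually (\<lambda>N. freq (\<lambda>j. orbit_rem Q z (j - 1) \<in> cell_interval (fst p) (snd p)) N \<le> C / real (prod_list (fst p)) + \<delta>) sequentially"
      using bound[OF _ \<delta>(1), of "block_value B D" "\<Sum>i<n. expo ((T ^^ i) u)"]
      unfolding p cell_interval_def u by (simp add: prod_block)
  qed
  have "(\<Sum>p\<in>I. C / real (prod_list (fst p)) + \<delta>) = (\<Sum>B\<in>G. card (?W B) * (C / real (prod_list B))) + card I * \<delta>"
  proof -
    have "(\<Sum>p\<in>I. C / real (prod_list (fst p))) = (\<Sum>B\<in>G. \<Sum>D\<in>?W B. C / real (prod_list B))"
      unfolding I_def by (subst sum.Sigma) (auto simp: G(1) case_prod_unfold)
    then show ?thesis by (simp add: sum.distrib)
  qed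
  also have "\<dots> \<le> (\<Sum>B\<in>G. 2 * C * exp (- c * n)) + \<eta> / 4"
  proof (intro add_mono sum_mono \<delta>(2))
    fix B assume B: "B \<in> G"
    show "card (?W B) * (C / real (prod_list B)) \<le> 2 * C * exp (- c * n)"
    proof (cases "prod_list B = 0")
      case False
      have "card (?W B) * (C / real (prod_list B)) \<le> (2 * real (prod_list B) * exp (- c * n)) * (C / real (prod_list B))"
        using card_bad_digits[of \<beta> d \<eta> B n] \<beta>d \<eta> len[OF B] C
        by (intro mult_right_mono) (auto simp: c_def)
      then show ?thesis using False by (simp add: mult_ac)
    qed (use C in simp)
  qed
  also have "(\<Sum>B\<in>G. 2 * C * exp (- c * n)) = card G * (2 * C * exp (- c * n))" by simp
  also have "\<dots> \<le> exp (c / 2 * n) * (2 * C * exp (- c * n))"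
  proof (rule mult_right_mono)
    have "exp (\<epsilon> * n) \<le> exp (c / 2 * n)" using mult_right_mono[OF \<epsilon>(2), of "real n"] by (simp only: exp_le_cancel_iff of_nat_0_le_iff)
    then show "real (card G) \<le> exp (c / 2 * n)" using G(2) by linarith
  qed (use C in simp)
  also have "\<dots> = 2 * C * exp (- (c / 2) * n)" by (simp add: exp_add[symmetric] algebra_simps mult_exp_exp)
  also have "\<dots> \<le> \<eta> / 4" by (rule n(2))
  finally have sum: "(\<Sum>p\<in>I. C / real (prod_list (fst p)) + \<delta>) \<le> \<eta> / 2" by simp
  have "eventually (\<lambda>N. freq (\<lambda>j. \<bar>block_excess \<beta> d (symbol_block n j) (digit_block z n j)\<bar> > \<eta> * n) N \<le> \<eta>) sequentially"
    using cells atypical_frequency[OF G(3) \<epsilon>(1)]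
  proof eventually_elim
    case (elim N)
    have "freq (\<lambda>j. \<bar>block_excess \<beta> d (symbol_block n j) (digit_block z n j)\<bar> > \<eta> * n) N
      \<le> freq (\<lambda>j. symbol_block n j \<notin> G \<or> (\<exists>p\<in>I. orbit_rem Q z (j - 1) \<in> cell_interval (fst p) (snd p))) N"
    proof (rule freq_mono)
      fix j :: nat
      assume j: "j \<ge> 1" and b: "\<bar>block_excess \<beta> d (symbol_block n j) (digit_block z n j)\<bar> > \<eta> * n"
      have box: "digit_block z n j \<in> digit_box (symbol_block n j)" by (rule digit_block_less[OF z j])
      then have "digit_block z n j \<in> ?W (symbol_block n j)" using b unfolding bad_digits_def by simp
      moreover have "orbit_rem Q z (j - 1) \<in> cell_interval (symbol_block n j) (digit_block z n j)"
        using digit_block_iff[OF z j box] by simp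
      ultimately show "symbol_block n j \<notin> G \<or> (\<exists>p\<in>I. orbit_rem Q z (j - 1) \<in> cell_interval (fst p) (snd p))"
        unfolding I_def by (intro disjCI bexI[of _ "(symbol_block n j, digit_block z n j)"]) auto
    qed
    also have "\<dots> \<le> freq (\<lambda>j. symbol_block n j \<notin> G) N + (\<Sum>p\<in>I. freq (\<lambda>j. orbit_rem Q z (j - 1) \<in> cell_interval (fst p) (snd p)) N)"
      by (intro order_trans[OF freq_disj_le] add_left_mono freq_bex_le I)
    also have "\<dots> \<le> 2 * \<epsilon> + (\<Sum>p\<in>I. C / real (prod_list (fst p)) + \<delta>)"
      using elim by (intro add_mono sum_mono) auto
    also have "\<dots> \<le> \<eta>" using sum \<epsilon> by linarith
    finally show ?case .
  qed
  then show "\<exists>n\<ge>2 * length \<beta>. eventually (\<lambda>N. freq (\<lambda>j. \<bar>block_excess \<beta> d (symbol_block n j) (digit_block z n j)\<bar> > \<eta> * n) N \<le> \<eta>) sequentially"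
    using n(1) by blast
qed auto

lemma admissible_at_iff: "j \<ge> 1 \<Longrightarrow> admissible_at Q j D \<longleftrightarrow> D \<in> digit_box (symbol_block (length D) j)"
proof -
  assume j: "j \<ge> 1"
  have "admissible_at Q j D \<longleftrightarrow> (\<forall>i<length D. D ! i < Q (j + i))"
    unfolding admissible_at_def
  proof (intro iffI ballI allI impI)
    fix i assume *: "\<forall>i\<in>{1..length D}. D ! (i - 1) < Q (j + i - 1)" and "i < length D"
    then show "D ! i < Q (j + i)" using bspec[OF *, of "Suc i"] by simp
  next
    fix i assume "\<forall>i<length D. D ! i < Q (j + i)" "i \<in> {1..length D}"
    then show "D ! (i - 1) < Q (j + i - 1)" by (cases i) auto
  qed
  also have "\<dots> \<longleftrightarrow> D \<in> digit_box (symbol_block (length D) j)"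
    unfolding block_window[OF j] by (auto simp: list_all2_conv_all_nth)
  finally show ?thesis .
qed

lemma prod_symbols_eq: "j \<ge> 1 \<Longrightarrow> (\<Prod>i=1..l. real (Q (j + i - 1))) = real (prod_list (symbol_block l j))"
proof (induction l)
  case (Suc l)
  have "symbol_block (Suc l) j = symbol_block l j @ [Q (j + l)]"
    using Suc by (simp add: block_window del: upt_Suc) (simp)
  then show ?case using Suc by simp
qed (simp add: block_def)

lemma Q_sum_eq:
  "Q_sum Q D N = (\<Sum>j=1..N. of_bool (D \<in> digit_box (symbol_block (length D) j)) / real (prod_list (symbol_block (length D) j)))"
  unfolding Q_sum_def by (rule sum.cong) (auto simp: admissible_at_iff prod_symbols_eq[simplified])

lemma digit_block_eq_iff: "digit_block z (length D) j = D \<longleftrightarrow> (\<forall>i\<in>{1..length D}. cantor_digits Q z (j + i - 1) = D ! (i - 1))"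
  unfolding digit_block_def by (rule map_window_eq_iff)

text \<open>At index \<open>i\<close> the definition of the count reads digits from position
  \<open>i + 1\<close> on, whereas \<open>Q_sum\<close> reads symbols from position \<open>j\<close>
  on; hence the shift by one.\<close>

lemma Q_count_eq: "real (Q_count Q D z N) / N = freq (\<lambda>j. digit_block z (length D) (Suc j) = D) N"
  unfolding Q_count_def freq_def digit_block_eq_iff by simp

text \<open>The shift changes the count only by a boundary term at each end, so the offset in
  \<open>Q_count_eq\<close> disappears in the limit.\<close>

lemma freq_shift: "N > 0 \<Longrightarrow> \<bar>freq (\<lambda>j. A (Suc j)) N - freq A N\<bar> \<le> 2 / N"
proof -
  assume N: "N > 0"
  have "\<bar>(\<Sum>j=1..N. of_bool (A (j + 1)) :: real) - (\<Sum>j=1..N. of_bool (A j))\<bar> \<le> 2 * real 1"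
    using sum_shift_bound[of "\<lambda>j. of_bool (A j)" 1 N] by simp
  then show ?thesis
    unfolding freq_eq_sum diff_divide_distrib[symmetric] using N by (simp add: divide_right_mono)
qed

end

section \<open>Normality and uniform normality\<close>

context generated_power_sequence
begin

lemma cell_prob_pos: "block n u = B \<Longrightarrow> prob {v. block n v = B} > 0"
  using open_block[of "\<lambda>B'. B' = B" n] by (intro open_prob_pos) auto

section \<open>Uniform normality as joint frequency of cells\<close>

lemma S_block_iff: "S_block Q B \<inter> {1..N} = {j \<in> {1..N}. symbol_block (length B) j = B}"
proof -
  have "symbol_block (length B) j = B \<longleftrightarrow> (\<forall>i\<in>{1..length B}. Q (j + i - 1) = B ! (i - 1))" if "j \<ge> 1" for j
    unfolding block_window[OF that] by (rule map_window_eq_iff)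
  then show ?thesis unfolding S_block_def by auto
qed

lemma Q_sum2_eq:
  assumes "length B = length D" "N > 0"
  shows "Q_sum2 Q D B N = (if D \<in> digit_box B then N * freq (\<lambda>j. symbol_block (length B) j = B) N / real (prod_list B) else 0)"
  using assms unfolding Q_sum2_def S_block_iff freq_def by (auto simp: list_all2_conv_all_nth)

lemma Q_count2_eq:
  assumes "length B = length D" "N > 0"
  shows "real (Q_count2 Q D B z N) = N * freq (\<lambda>j. symbol_block (length B) j = B \<and> digit_block z (length B) j = D) N"
proof -
  have "{j \<in> S_block Q B \<inter> {1..N}. \<forall>i\<in>{1..length D}. cantor_digits Q z (j + i - 1) = D ! (i - 1)} =
    {j \<in> {1..N}. symbol_block (length B) j = B \<and> digit_block z (length B) j = D}"
    unfolding S_block_iff digit_block_eq_iff[symmetric] assms(1) by auto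
  then show ?thesis using assms unfolding Q_count2_def freq_def by simp
qed

lemma symbol_block_occurs:
  assumes "p > 0" "freq A \<longlonglongrightarrow> p"
  shows "\<exists>j\<ge>1. A j"
proof (rule ccontr)
  assume "\<not> (\<exists>j\<ge>1. A j)"
  then have "{j \<in> {1..N}. A j} = {}" for N by auto
  then have "freq A = (\<lambda>_. 0)" unfolding freq_def by (intro ext) simp
  then show False using assms LIMSEQ_unique[OF _ tendsto_const] by fastforce
qed

text \<open>The normaliser is \<open>N\<close> times a frequency that converges to the measure of
  \<open>B\<close>, divided by the product. For positive measure it grows linearly and the ratio
  condition is the cell condition; for measure 0 the joint frequency is squeezed to 0. A divergent
  normaliser forces \<open>B\<close> to occur, hence to have positive measure.\<close>

lemma UN_Q_iff_cell_normal:
  assumes z: "0 \<le> z" "z < 1"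
  shows "z \<in> UN_Q Q \<longleftrightarrow> cell_normal z"
proof
  assume normal: "cell_normal z"
  have "(\<lambda>n. real (Q_count2 Q D B z n) / Q_sum2 Q D B n) \<longlonglongrightarrow> 1"
    if D: "D \<noteq> []" and len: "length B = length D" and lim: "filterlim (Q_sum2 Q D B) at_top sequentially" for D B
  proof -
    let ?F = "freq (\<lambda>j. symbol_block (length B) j = B)"
    let ?p = "prob {u. block (length B) u = B}"
    have "eventually (\<lambda>N. Q_sum2 Q D B N > 0 \<and> N > 0) sequentially"
      using lim eventually_gt_at_top[of 0] unfolding filterlim_at_top_dense by (simp add: eventually_conj_iff)
    then obtain N where N: "Q_sum2 Q D B N > 0" "N > 0" by (auto simp: eventually_sequentially)
    then have box: "D \<in> digit_box B" and "?F N \<noteq> 0"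
      using Q_sum2_eq[OF len] by (auto split: if_splits)
    then obtain j where "symbol_block (length B) j = B" unfolding freq_def by (cases "{j \<in> {1..N}. symbol_block (length B) j = B} = {}") auto
    then have p: "?p > 0" by (rule cell_prob_pos)
    have B: "real (prod_list B) > 0" using card_digit_box[of B] box card_gt_0_iff[of "digit_box B"] by auto
    have "(\<lambda>N. freq (\<lambda>j. symbol_block (length B) j = B \<and> digit_block z (length B) j = D) N / (?F N / real (prod_list B)))
      \<longlonglongrightarrow> (?p / real (prod_list B)) / (?p / real (prod_list B))"
    proof (intro tendsto_divide)
      show "freq (\<lambda>j. symbol_block (length B) j = B \<and> digit_block z (length B) j = D) \<longlonglongrightarrow> ?p / real (prod_list B)"
        by (rule cell_normalD[OF normal _ box]) (use D len in auto)
      show "?F \<longlonglongrightarrow> ?p" using block_frequency[of "\<lambda>B'. B' = B"] .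
    qed (use p B in auto)
    moreover have "(?p / real (prod_list B)) / (?p / real (prod_list B)) = 1" using p B by simp
    ultimately have lim1: "(\<lambda>N. freq (\<lambda>j. symbol_block (length B) j = B \<and> digit_block z (length B) j = D) N / (?F N / real (prod_list B))) \<longlonglongrightarrow> 1"
      by simp
    show ?thesis
      by (rule Lim_transform_eventually[OF lim1], rule eventually_mono[OF eventually_gt_at_top[of 0]])
        (use box Q_sum2_eq[OF len] Q_count2_eq[OF len] in simp)
  qed
  then show "z \<in> UN_Q Q" unfolding UN_Q_def using z by auto
next
  assume UN: "z \<in> UN_Q Q"
  show "cell_normal z"
    unfolding cell_normal_def
  proof (intro allI impI)
    fix B D assume BD: "B \<noteq> [] \<and> D \<in> digit_box B"
    then have len: "length B = length D" and D: "D \<noteq> []" by (auto dest: list_all2_lengthD)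
    let ?F = "freq (\<lambda>j. symbol_block (length B) j = B)"
    let ?A = "freq (\<lambda>j. symbol_block (length B) j = B \<and> digit_block z (length B) j = D)"
    let ?p = "prob {u. block (length B) u = B}"
    have F: "?F \<longlonglongrightarrow> ?p" using block_frequency[of "\<lambda>B'. B' = B"] .
    have AF: "?A N \<le> ?F N" for N by (rule freq_mono) auto
    show "?A \<longlonglongrightarrow> ?p / real (prod_list B)"
    proof (cases "?p = 0")
      case True
      then show ?thesis
        using tendsto_sandwich[of "\<lambda>_. 0" ?A sequentially ?F 0] F AF by (simp add: always_eventually)
    next
      case False
      then have p: "?p > 0" using measure_nonneg[of M] by (simp add: less_le)
      obtain j where j: "j \<ge> 1" "symbol_block (length B) j = B" using symbol_block_occurs[OF p F] by blast
      have B2: "\<forall>b\<in>set B. b \<ge> 2" using f_ge_2 by (subst j(2)[symmetric]) (auto simp: block_def)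
      have B: "real (prod_list B) > 0" using card_digit_box[of B] BD card_gt_0_iff[of "digit_box B"] by auto
      have lim: "filterlim (Q_sum2 Q D B) at_top sequentially"
      proof (rule filterlim_cong[THEN iffD1, OF refl refl])
        show "eventually (\<lambda>N. ?F N / real (prod_list B) * real N = Q_sum2 Q D B N) sequentially"
          using eventually_gt_at_top[of 0] by eventually_elim (use BD Q_sum2_eq[OF len] in simp)
        show "filterlim (\<lambda>N. ?F N / real (prod_list B) * real N) at_top sequentially"
        proof (rule filterlim_tendsto_pos_mult_at_top)
          show "(\<lambda>N. ?F N / real (prod_list B)) \<longlonglongrightarrow> ?p / real (prod_list B)"
            using B by (intro tendsto_intros F) auto
        qed (use p B filterlim_real_sequentially in auto)
      qed
      have ratio: "(\<lambda>n. real (Q_count2 Q D B z n) / Q_sum2 Q D B n) \<longlonglongrightarrow> 1"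
        using UN D len B2 lim unfolding UN_Q_def by auto
      have "(\<lambda>N. real (Q_count2 Q D B z N) / Q_sum2 Q D B N * (?F N / real (prod_list B))) \<longlonglongrightarrow> 1 * (?p / real (prod_list B))"
        using B by (intro tendsto_intros F ratio) auto
      moreover have "eventually (\<lambda>N. real (Q_count2 Q D B z N) / Q_sum2 Q D B N * (?F N / real (prod_list B)) = ?A N) sequentially"
        using eventually_gt_at_top[of 0]
      proof eventually_elim
        case (elim N)
        then show ?case
          using BD Q_sum2_eq[OF len elim] Q_count2_eq[OF len elim] B AF[of N] freq_nonneg[of "\<lambda>j. symbol_block (length B) j = B \<and> digit_block z (length B) j = D" N]
          by (cases "?F N = 0") (auto simp: field_simps)
      qed
      ultimately show ?thesis by (simp add: Lim_transform_eventually)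
    qed
  qed
qed

text \<open>Symbols may be unbounded, so a finite family covering most of the space arises by
  bounding them by \<open>R\<close> and letting \<open>R\<close> grow.\<close>

lemma finite_blocks_cover:
  fixes \<epsilon> :: real
  assumes "\<epsilon> > 0"
  obtains G where "finite G" "\<And>B. B \<in> G \<Longrightarrow> length B = n" "prob {u. block n u \<in> G} \<ge> 1 - \<epsilon>"
proof -
  define G where "G R = {B. set B \<subseteq> {..R} \<and> length B = n}" for R :: nat
  have "(\<lambda>R. prob {u. block n u \<in> G R}) \<longlonglongrightarrow> prob (\<Union>R. {u. block n u \<in> G R})"
  proof (rule finite_Lim_measure_incseq)
    show "range (\<lambda>R. {u. block n u \<in> G R}) \<subseteq> sets M" using sets_block[of "\<lambda>B. B \<in> G _"] by auto
    show "incseq (\<lambda>R. {u. block n u \<in> G R})" by (rule incseq_SucI) (auto simp: G_def)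
  qed
  moreover have "(\<Union>R. {u. block n u \<in> G R}) = UNIV"
  proof -
    have "block n u \<in> G (Max (insert 0 (set (block n u))))" for u by (auto simp: G_def)
    then show ?thesis by blast
  qed
  ultimately have "(\<lambda>R. prob {u. block n u \<in> G R}) \<longlonglongrightarrow> 1" using prob_space by simp
  then have "eventually (\<lambda>R. prob {u. block n u \<in> G R} > 1 - \<epsilon>) sequentially"
    by (rule order_tendstoD) (use assms in simp)
  then have "\<exists>R. prob {u. block n u \<in> G R} > 1 - \<epsilon>"
    by (rule eventually_happens'[OF sequentially_bot])
  then obtain R where R: "prob {u. block n u \<in> G R} > 1 - \<epsilon>" by (rule exE)
  have fin: "finite (G R)" unfolding G_def by (rule finite_lists_length_eq) simp
  show ?thesis by (rule that[OF fin _ less_imp_le[OF R]]) (simp add: G_def)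
qed

section \<open>Digit block frequencies averaged over the symbols\<close>

definition expected_weight :: "nat list \<Rightarrow> nat list \<Rightarrow> real" where
  "expected_weight D B = of_bool (D \<in> digit_box B) / real (prod_list B)"

lemma expected_weight_bounds: "0 \<le> expected_weight D B" "expected_weight D B \<le> 1"
  unfolding expected_weight_def by (auto simp: divide_le_eq_1)

lemma Q_sum_eq_weight: "Q_sum Q D N = (\<Sum>j=1..N. expected_weight D (symbol_block (length D) j))"
  unfolding Q_sum_eq expected_weight_def ..

text \<open>Indices are grouped by symbol block. Cell normality handles a finite family
  \<open>G\<close> of nearly full measure; elsewhere each summand is bounded by 1, so that part is
  at most the frequency of leaving \<open>G\<close>.\<close>

lemma digit_frequency_minus_Q_sum:
  assumes z: "0 \<le> z" "z < 1" and normal: "cell_normal z" and D: "D \<noteq> []"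
  shows "(\<lambda>N. freq (\<lambda>j. digit_block z (length D) j = D) N - Q_sum Q D N / N) \<longlonglongrightarrow> 0"
proof (rule tendstoI)
  fix e :: real assume e: "e > 0"
  let ?l = "length D"
  obtain G where G: "finite G" "\<And>B. B \<in> G \<Longrightarrow> length B = ?l" "prob {u. block ?l u \<in> G} \<ge> 1 - e / 4"
    using finite_blocks_cover[of "e / 4" ?l] e by auto
  let ?w = "\<lambda>j. expected_weight D (symbol_block ?l j)"
  let ?y = "\<lambda>j. of_bool (digit_block z ?l j = D) - ?w j"
  let ?Y = "\<lambda>B N. freq (\<lambda>j. symbol_block ?l j = B \<and> digit_block z ?l j = D) N - expected_weight D B * freq (\<lambda>j. symbol_block ?l j = B) N"
  have Y: "?Y B \<longlonglongrightarrow> 0" if B: "B \<in> G" for B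
  proof (cases "D \<in> digit_box B")
    case True
    let ?p = "prob {u. block ?l u = B}"
    have "?Y B \<longlonglongrightarrow> ?p / real (prod_list B) - expected_weight D B * ?p"
    proof (intro tendsto_intros)
      show "freq (\<lambda>j. symbol_block ?l j = B \<and> digit_block z ?l j = D) \<longlonglongrightarrow> ?p / real (prod_list B)"
      proof -
        have "B \<noteq> []" using G(2)[OF B] D by auto
        then show ?thesis using cell_normalD[OF normal _ True] unfolding G(2)[OF B] by blast
      qed
      show "freq (\<lambda>j. symbol_block ?l j = B) \<longlonglongrightarrow> ?p" using block_frequency[of "\<lambda>B'. B' = B"] .
    qed
    then show ?thesis using True by (simp add: expected_weight_def)
  next
    case False
    have "freq (\<lambda>j. symbol_block ?l j = B \<and> digit_block z ?l j = D) N = 0" for N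
    proof -
      have "{j \<in> {1..N}. symbol_block ?l j = B \<and> digit_block z ?l j = D} = {}"
      proof (rule ccontr)
        assume "{j \<in> {1..N}. symbol_block ?l j = B \<and> digit_block z ?l j = D} \<noteq> {}"
        then obtain j where "j \<ge> 1" "symbol_block ?l j = B" "digit_block z ?l j = D" by auto
        then show False using digit_block_less[OF z, of j ?l] False by simp
      qed
      then show ?thesis unfolding freq_def by simp
    qed
    then show ?thesis using False by (simp add: expected_weight_def)
  qed
  have "(\<lambda>N. \<Sum>B\<in>G. ?Y B N) \<longlonglongrightarrow> (\<Sum>B\<in>G. 0)" by (intro tendsto_sum Y)
  from tendstoD[OF this, of "e / 2"] e
  have "eventually (\<lambda>N. \<bar>\<Sum>B\<in>G. ?Y B N\<bar> < e / 2) sequentially"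
    by (simp add: dist_real_def)
  moreover have "eventually (\<lambda>N. freq (\<lambda>j. symbol_block ?l j \<notin> G) N \<le> 2 * (e / 4)) sequentially"
    using atypical_frequency[OF G(3)] e by simp
  ultimately show "eventually (\<lambda>N. dist (freq (\<lambda>j. digit_block z ?l j = D) N - Q_sum Q D N / N) 0 < e) sequentially"
  proof eventually_elim
    case (elim N)
    have split: "?y j = (\<Sum>B\<in>G. of_bool (symbol_block ?l j = B \<and> digit_block z ?l j = D) - expected_weight D B * of_bool (symbol_block ?l j = B))
       + ?y j * of_bool (symbol_block ?l j \<notin> G)" for j
    proof -
      have "(\<Sum>B\<in>G. of_bool (symbol_block ?l j = B \<and> digit_block z ?l j = D) - expected_weight D B * of_bool (symbol_block ?l j = B))
        = (\<Sum>B\<in>G. if symbol_block ?l j = B then ?y j else 0)"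
        by (intro sum.cong) auto
      also have "\<dots> = ?y j * of_bool (symbol_block ?l j \<in> G)" using G(1) by simp
      finally show ?thesis by simp
    qed
    have "(\<Sum>j=1..N. ?y j) = (\<Sum>j=1..N. \<Sum>B\<in>G. of_bool (symbol_block ?l j = B \<and> digit_block z ?l j = D) - expected_weight D B * of_bool (symbol_block ?l j = B))
       + (\<Sum>j=1..N. ?y j * of_bool (symbol_block ?l j \<notin> G))"
      unfolding sum.distrib[symmetric] by (rule sum.cong[OF refl split])
    then have "(\<Sum>j=1..N. ?y j) / N = (\<Sum>B\<in>G. ?Y B N) + (\<Sum>j=1..N. ?y j * of_bool (symbol_block ?l j \<notin> G)) / N"
      by (subst (asm) sum.swap) (simp add: freq_eq_sum sum_subtractf sum_divide_distrib add_divide_distrib diff_divide_distrib sum_distrib_left mult_ac)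
    moreover have "\<bar>(\<Sum>j=1..N. ?y j * of_bool (symbol_block ?l j \<notin> G)) / N\<bar> \<le> freq (\<lambda>j. symbol_block ?l j \<notin> G) N"
    proof -
      have "\<bar>\<Sum>j=1..N. ?y j * of_bool (symbol_block ?l j \<notin> G)\<bar> \<le> (\<Sum>j=1..N. of_bool (symbol_block ?l j \<notin> G))"
      proof (intro order_trans[OF sum_abs] sum_mono)
        fix j
        have "\<bar>?y j\<bar> \<le> 1" using expected_weight_bounds[of D "symbol_block ?l j"] by auto
        then show "\<bar>?y j * of_bool (symbol_block ?l j \<notin> G)\<bar> \<le> of_bool (symbol_block ?l j \<notin> G)" by auto
      qed
      then show ?thesis unfolding freq_eq_sum by (simp add: divide_right_mono)
    qed
    moreover have "(\<Sum>j=1..N. ?y j) / N = freq (\<lambda>j. digit_block z ?l j = D) N - Q_sum Q D N / N"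
      unfolding freq_eq_sum Q_sum_eq_weight by (simp add: sum_subtractf diff_divide_distrib)
    ultimately show ?case using elim unfolding dist_real_def by linarith
  qed
qed

lemma Q_sum_ge: "expected_weight D B * freq (\<lambda>j. symbol_block (length D) j = B) N \<le> Q_sum Q D N / N"
proof -
  have "expected_weight D B * of_bool (symbol_block (length D) j = B) \<le> expected_weight D (symbol_block (length D) j)" for j
    using expected_weight_bounds by auto
  then have "(\<Sum>j=1..N. expected_weight D B * of_bool (symbol_block (length D) j = B)) \<le> Q_sum Q D N"
    unfolding Q_sum_eq_weight by (rule sum_mono)
  then show ?thesis
    unfolding freq_eq_sum times_divide_eq_right sum_distrib_left by (rule divide_right_mono) simp
qed

text \<open>The symbol block for which \<open>D\<close> is admissible has positive measure and so
  occurs with positive frequency. Linear growth makes errors of order \<open>o(N)\<close> harmless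
  in the ratio defining Q-normality.\<close>

lemma Q_sum_linear:
  assumes "D \<in> digit_box (block (length D) u)"
  obtains a where "a > 0" "eventually (\<lambda>N. Q_sum Q D N / N \<ge> a) sequentially"
proof -
  let ?B = "block (length D) u"
  let ?p = "prob {v. block (length D) v = ?B}"
  have p: "?p > 0" by (rule cell_prob_pos) simp
  have w: "expected_weight D ?B > 0"
    using assms symbol_pos[of "length D" u] by (auto simp: expected_weight_def prod_list_zero_iff intro!: gr0I)
  have "(\<lambda>N. expected_weight D ?B * freq (\<lambda>j. symbol_block (length D) j = ?B) N) \<longlonglongrightarrow> expected_weight D ?B * ?p"
    by (intro tendsto_intros block_frequency)
  then have "eventually (\<lambda>N. expected_weight D ?B * freq (\<lambda>j. symbol_block (length D) j = ?B) N > expected_weight D ?B * ?p / 2) sequentially"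
    by (rule order_tendstoD) (use p w in simp)
  then have "eventually (\<lambda>N. Q_sum Q D N / N \<ge> expected_weight D ?B * ?p / 2) sequentially"
  proof eventually_elim
    case (elim N)
    then show ?case using Q_sum_ge[of D ?B N] by linarith
  qed
  then show ?thesis using that[of "expected_weight D ?B * ?p / 2"] p w by simp
qed

lemma N_Q_if_cell_normal:
  assumes z: "0 \<le> z" "z < 1" and normal: "cell_normal z"
  shows "z \<in> N_Q Q"
proof -
  have "(\<lambda>N. real (Q_count Q D z N) / Q_sum Q D N) \<longlonglongrightarrow> 1"
    if D: "D \<noteq> []" and lim: "filterlim (Q_sum Q D) at_top sequentially" for D
  proof -
    have "eventually (\<lambda>N. Q_sum Q D N > 0) sequentially" using lim unfolding filterlim_at_top_dense by blast
    then obtain N where "Q_sum Q D N > 0" by (auto simp: eventually_sequentially)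
    then have "\<exists>j. D \<in> digit_box (symbol_block (length D) j)"
      by (rule contrapos_pp) (simp add: Q_sum_eq)
    then obtain j where "D \<in> digit_box (symbol_block (length D) j)" by (rule exE)
    then obtain a where a: "a > 0" "eventually (\<lambda>N. Q_sum Q D N / N \<ge> a) sequentially" by (rule Q_sum_linear)
    define r where "r N = freq (\<lambda>j. digit_block z (length D) (Suc j) = D) N - Q_sum Q D N / N" for N
    have "(\<lambda>N. freq (\<lambda>j. digit_block z (length D) (Suc j) = D) N - freq (\<lambda>j. digit_block z (length D) j = D) N) \<longlonglongrightarrow> 0"
    proof (rule Lim_null_comparison)
      show "eventually (\<lambda>N. norm (freq (\<lambda>j. digit_block z (length D) (Suc j) = D) N - freq (\<lambda>j. digit_block z (length D) j = D) N) \<le> 2 / real N) sequentially"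
        using eventually_gt_at_top[of 0] by eventually_elim (simp add: freq_shift[of _ "\<lambda>j. digit_block z (length D) j = D"])
    qed (rule lim_const_over_n)
    from tendsto_add[OF this digit_frequency_minus_Q_sum[OF z normal D]] have r: "r \<longlonglongrightarrow> 0"
      by (simp add: r_def[abs_def])
    have "(\<lambda>N. r N / (Q_sum Q D N / N)) \<longlonglongrightarrow> 0"
    proof (rule Lim_null_comparison)
      show "eventually (\<lambda>N. norm (r N / (Q_sum Q D N / N)) \<le> \<bar>r N\<bar> / a) sequentially"
        using a(2)
      proof eventually_elim
        case (elim N)
        then have "a \<le> \<bar>Q_sum Q D N / N\<bar>" by linarith
        then have "\<bar>r N\<bar> / \<bar>Q_sum Q D N / N\<bar> \<le> \<bar>r N\<bar> / a"
          using a(1) by (intro divide_left_mono mult_pos_pos) linarith+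
        then show ?case by (simp only: real_norm_def abs_divide)
      qed
      show "(\<lambda>N. \<bar>r N\<bar> / a) \<longlonglongrightarrow> 0" using tendsto_divide[OF tendsto_rabs[OF r] tendsto_const, of a] a(1) by simp
    qed
    then have "(\<lambda>N. r N / (Q_sum Q D N / N) + 1) \<longlonglongrightarrow> 0 + 1" by (intro tendsto_intros)
    moreover have "eventually (\<lambda>N. r N / (Q_sum Q D N / N) + 1 = real (Q_count Q D z N) / Q_sum Q D N) sequentially"
      using a(2) eventually_gt_at_top[of 0]
    proof eventually_elim
      case (elim N)
      then have "Q_sum Q D N > 0" using a(1) by (metis divide_eq_0_iff less_le_trans of_nat_0_less_iff zero_less_divide_iff not_less_iff_gr_or_eq)
      then show ?case using elim unfolding r_def Q_count_eq[symmetric] by (simp add: field_simps)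
    qed
    ultimately show ?thesis by (simp add: Lim_transform_eventually)
  qed
  then show ?thesis unfolding N_Q_def using z by auto
qed

text \<open>The limit 1 of the ratio enters through the upper bound 2, and \<open>2 / N\<close> pays
  for the index shift between \<open>Q_count\<close> and \<open>digit_block\<close>.\<close>

lemma Q_count_le_twice_Q_sum:
  assumes N: "z \<in> N_Q Q" and D: "D \<noteq> []" "D \<in> digit_box (block (length D) u)"
  shows "eventually (\<lambda>N. freq (\<lambda>j. digit_block z (length D) j = D) N \<le> 2 * (Q_sum Q D N / N) + 2 / N) sequentially"
proof -
  obtain a where a: "a > 0" "eventually (\<lambda>N. Q_sum Q D N / N \<ge> a) sequentially"
    using D(2) by (rule Q_sum_linear)
  have "filterlim (Q_sum Q D) at_top sequentially"
  proof (rule filterlim_at_top_mono)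
    show "filterlim (\<lambda>N. a * real N) at_top sequentially"
      using a(1) by (intro filterlim_tendsto_pos_mult_at_top[OF tendsto_const] filterlim_real_sequentially)
    show "eventually (\<lambda>N. a * real N \<le> Q_sum Q D N) sequentially"
      using a(2) eventually_gt_at_top[of 0] by eventually_elim (simp add: field_simps)
  qed
  then have "(\<lambda>N. real (Q_count Q D z N) / Q_sum Q D N) \<longlonglongrightarrow> 1"
    using N D(1) unfolding N_Q_def by auto
  then have "eventually (\<lambda>N. real (Q_count Q D z N) / Q_sum Q D N < 2) sequentially"
    by (rule order_tendstoD) simp
  with a(2) show ?thesis using eventually_gt_at_top[of 0]
  proof eventually_elim
    case (elim N)
    have pos: "Q_sum Q D N > 0" using a(1) elim by (simp add: field_simps) (smt (verit) mult_pos_pos of_nat_0_less_iff)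
    then have "real (Q_count Q D z N) \<le> 2 * Q_sum Q D N" using elim(2) by (simp add: field_simps)
    then have "real (Q_count Q D z N) / N \<le> 2 * Q_sum Q D N / N" by (rule divide_right_mono) simp
    then show ?case
      using freq_shift[OF elim(3), of "\<lambda>j. digit_block z (length D) j = D"] unfolding Q_count_eq by linarith
  qed
qed

text \<open>The frequency of a digit block is known only irrespective of the symbols above it, so a
  block that is bad for one typical \<open>B\<close> is charged at all symbol blocks. Concentration
  of the exponent sums makes typical products comparable up to
  \<open>exp (2 * \<epsilon> * n * L)\<close>, so the union \<open>W\<close> of the bad blocks still
  has exponentially small weight over every typical block.\<close>

lemma cell_normal_if_N_Q:
  assumes N: "z \<in> N_Q Q"
  shows "cell_normal z"
  unfolding cell_normal_def
proof (intro allI impI cell_frequency_from_windows)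
  have z: "0 \<le> z" "z < 1" using N unfolding N_Q_def by auto
  fix \<beta> d and \<eta> :: real
  assume \<beta>d: "\<beta> \<noteq> [] \<and> d \<in> digit_box \<beta>" and \<eta>: "0 < \<eta>" "\<eta> \<le> 1"
  define c where "c = \<eta>\<^sup>2 / (4 * (real (length \<beta>))\<^sup>2)"
  have c: "c > 0" using \<eta> \<beta>d by (simp add: c_def)
  define L where "L = ln (real g)"
  have L: "L > 0" using g by (simp add: L_def)
  \<comment> \<open>In \<open>1 + 2 * L\<close> the 1 pays for \<open>card G\<close> and
    \<open>2 * L\<close> for the ratio of the largest to the smallest typical product. The bound
    \<open>\<eta> / 12\<close> is due to the atypical windows, which enter three times with
    frequency at most \<open>2 * \<epsilon>\<close>.\<close>
  define \<epsilon> where "\<epsilon> = min (c / (2 * (1 + 2 * L))) (\<eta> / 12)"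
  have \<epsilon>: "\<epsilon> > 0" "\<epsilon> * (1 + 2 * L) \<le> c / 2" "\<epsilon> \<le> \<eta> / 12"
  proof -
    show "\<epsilon> > 0" using c \<eta> L by (auto simp: \<epsilon>_def)
    show "\<epsilon> \<le> \<eta> / 12" unfolding \<epsilon>_def by (rule min.cobounded2)
    have "\<epsilon> * (1 + 2 * L) \<le> (c / (2 * (1 + 2 * L))) * (1 + 2 * L)"
      using L by (intro mult_right_mono) (auto simp: \<epsilon>_def)
    also have "\<dots> = c / 2" using L by (simp add: field_simps)
    finally show "\<epsilon> * (1 + 2 * L) \<le> c / 2" .
  qed
  let ?W = "bad_digits \<beta> d \<eta>"
  have "eventually (\<lambda>n. 4 * exp (- (c / 2) * real n) \<le> \<eta> / 4) sequentially"
    using c \<eta> by (intro exp_decay_eventually) auto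
  from eventually_happens'[OF sequentially_bot eventually_conj[OF few_typical_blocks[OF \<epsilon>(1)] eventually_conj[OF this eventually_ge_at_top[of "2 * length \<beta>"]]]]
  obtain n G where n: "n \<ge> 2 * length \<beta>" "4 * exp (- (c / 2) * real n) \<le> \<eta> / 4"
    and G: "finite G" "real (card G) \<le> exp (\<epsilon> * n)" "prob {u. block n u \<in> G} \<ge> 1 - \<epsilon>"
    and G': "\<forall>B\<in>G. \<exists>u. B = block n u \<and> (mean_expo - \<epsilon>) * n \<le> (\<Sum>i<n. real (expo ((T ^^ i) u)))
       \<and> (\<Sum>i<n. real (expo ((T ^^ i) u))) \<le> (mean_expo + \<epsilon>) * n"
    by blast
  have n0: "n > 0" using n(1) \<beta>d by (cases \<beta>) auto
  have prod: "real (prod_list B) \<le> exp ((mean_expo + \<epsilon>) * n * L)" "exp ((mean_expo - \<epsilon>) * n * L) \<le> real (prod_list B)" "length B = n"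
    if B: "B \<in> G" for B
  proof -
    obtain u where u: "B = block n u" "(mean_expo - \<epsilon>) * n \<le> (\<Sum>i<n. real (expo ((T ^^ i) u)))"
       "(\<Sum>i<n. real (expo ((T ^^ i) u))) \<le> (mean_expo + \<epsilon>) * n" using G' B by blast
    have "real (prod_list B) = exp ((\<Sum>i<n. real (expo ((T ^^ i) u))) * L)"
      using g unfolding u prod_block L_def by (simp add: exp_of_nat_mult flip: of_nat_sum)
    then show "real (prod_list B) \<le> exp ((mean_expo + \<epsilon>) * n * L)" "exp ((mean_expo - \<epsilon>) * n * L) \<le> real (prod_list B)" "length B = n"
      using u L by (auto intro!: mult_right_mono)
  qed
  define W where "W = (\<Union>B\<in>G. ?W B)"
  have finW: "finite W" unfolding W_def using G by auto
  have lenW: "length D = n" and boxW: "\<exists>u. D \<in> digit_box (block n u)" if "D \<in> W" for D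
    using that G' unfolding W_def bad_digits_def by (fastforce dest: list_all2_lengthD)+
  have "real (card W) \<le> (\<Sum>B\<in>G. real (card (?W B)))"
    unfolding W_def of_nat_sum[symmetric] using card_UN_le[OF G(1), of ?W] by (simp only: of_nat_le_iff)
  also have "\<dots> \<le> (\<Sum>B\<in>G. 2 * exp ((mean_expo + \<epsilon>) * n * L) * exp (- c * n))"
  proof (rule sum_mono)
    fix B assume B: "B \<in> G"
    have "real (card (?W B)) \<le> 2 * real (prod_list B) * exp (- c * n)"
      using card_bad_digits[of \<beta> d \<eta> B n] \<beta>d \<eta> prod(3)[OF B] by (simp add: c_def)
    also have "\<dots> \<le> 2 * exp ((mean_expo + \<epsilon>) * n * L) * exp (- c * n)"
      using prod(1)[OF B] by (intro mult_right_mono mult_left_mono) auto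
    finally show "real (card (?W B)) \<le> 2 * exp ((mean_expo + \<epsilon>) * n * L) * exp (- c * n)" .
  qed
  also have "\<dots> = card G * (2 * exp ((mean_expo + \<epsilon>) * n * L) * exp (- c * n))" by simp
  also have "\<dots> \<le> exp (\<epsilon> * n) * (2 * exp ((mean_expo + \<epsilon>) * n * L) * exp (- c * n))"
    by (rule mult_right_mono[OF G(2)]) simp
  finally have cardW: "real (card W) \<le> exp (\<epsilon> * n) * (2 * exp ((mean_expo + \<epsilon>) * n * L) * exp (- c * n))" .
  \<comment> \<open>Upper bound for the weight \<open>1 / prod_list B\<close> of a digit block over
    any typical \<open>B\<close>.\<close>
  define \<theta> where "\<theta> = exp (- ((mean_expo - \<epsilon>) * n * L))"
  have "card W * \<theta> \<le> exp (\<epsilon> * n) * (2 * exp ((mean_expo + \<epsilon>) * n * L) * exp (- c * n)) * \<theta>"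
    using cardW by (intro mult_right_mono) (auto simp: \<theta>_def)
  also have "\<dots> = 2 * exp ((\<epsilon> * (1 + 2 * L) - c) * n)"
    unfolding \<theta>_def by (simp add: mult_exp_exp) (simp add: algebra_simps)
  also have "\<dots> \<le> 2 * exp (- (c / 2) * n)"
  proof -
    have "(\<epsilon> * (1 + 2 * L) - c) * n \<le> (- (c / 2)) * n" using \<epsilon>(2) by (intro mult_right_mono) auto
    then show ?thesis by (simp only: exp_le_cancel_iff mult_le_cancel_left_pos zero_less_numeral)
  qed
  finally have W\<theta>: "2 * (card W * \<theta>) \<le> \<eta> / 4" using n(2) by linarith
  have "eventually (\<lambda>N. \<forall>D\<in>W. freq (\<lambda>j. digit_block z n j = D) N \<le> 2 * (Q_sum Q D N / N) + 2 / N) sequentially"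
  proof (rule eventually_ball_finite[OF finW], intro ballI)
    fix D assume D: "D \<in> W"
    then obtain u where "D \<in> digit_box (block (length D) u)" using boxW lenW by blast
    moreover have "D \<noteq> []" using lenW[OF D] n0 by auto
    ultimately show "eventually (\<lambda>N. freq (\<lambda>j. digit_block z n j = D) N \<le> 2 * (Q_sum Q D N / N) + 2 / N) sequentially"
      using Q_count_le_twice_Q_sum[OF N] lenW[OF D] by blast
  qed
  moreover have "eventually (\<lambda>N. 2 * card W / real N < \<eta> / 4) sequentially"
    by (rule order_tendstoD(2)[OF lim_const_over_n]) (use \<eta> in simp)
  ultimately have "eventually (\<lambda>N. freq (\<lambda>j. \<bar>block_excess \<beta> d (symbol_block n j) (digit_block z n j)\<bar> > \<eta> * n) N \<le> \<eta>) sequentially"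
    using atypical_frequency[OF G(3) \<epsilon>(1)] eventually_gt_at_top[of 0]
  proof eventually_elim
    case (elim N)
    let ?F = "freq (\<lambda>j. symbol_block n j \<notin> G) N"
    have weights: "(\<Sum>D\<in>W. Q_sum Q D N / N) \<le> ?F + card W * \<theta>"
    proof -
      \<comment> \<open>Over typical symbols each weight is at most \<open>\<theta>\<close>; over
        the others the weights of the whole digit box sum to 1.\<close>
      have pt: "(\<Sum>D\<in>W. expected_weight D B) \<le> of_bool (B \<notin> G) + card W * \<theta>" if B: "B = symbol_block n j" for B j
      proof (cases "B \<in> G")
        case True
        have "expected_weight D B \<le> \<theta>" for D
        proof -
          have "expected_weight D B \<le> 1 / real (prod_list B)" unfolding expected_weight_def by (simp add: divide_right_mono)
          also have "\<dots> \<le> 1 / exp ((mean_expo - \<epsilon>) * n * L)" using prod(2)[OF True] by (intro frac_le) auto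
          finally show ?thesis unfolding \<theta>_def exp_minus inverse_eq_divide .
        qed
        then show ?thesis using True by (simp add: sum_bounded_above)
      next
        case False
        have "prod_list B > 0" using symbol_pos[of n "(T ^^ j) x"] unfolding B by (auto simp: prod_list_zero_iff intro!: gr0I)
        have "(\<Sum>D\<in>W. expected_weight D B) = card (W \<inter> digit_box B) / real (prod_list B)"
          unfolding expected_weight_def sum_divide_distrib[symmetric] using finW by (simp add: of_bool_def sum.If_cases Int_def)
        also have "\<dots> \<le> card (digit_box B) / real (prod_list B)"
          by (intro divide_right_mono of_nat_mono card_mono) auto
        also have "\<dots> = 1" using \<open>prod_list B > 0\<close> by (simp add: card_digit_box)
        finally have "(\<Sum>D\<in>W. expected_weight D B) \<le> 1" .
        moreover have "0 \<le> card W * \<theta>" by (simp add: \<theta>_def)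
        ultimately show ?thesis using False by simp
      qed
      have "(\<Sum>D\<in>W. Q_sum Q D N) = (\<Sum>j=1..N. \<Sum>D\<in>W. expected_weight D (symbol_block n j))"
        unfolding Q_sum_eq_weight by (subst sum.swap) (simp add: lenW)
      also have "\<dots> \<le> (\<Sum>j=1..N. of_bool (symbol_block n j \<notin> G) + card W * \<theta>)"
        using pt by (intro sum_mono) auto
      finally have "(\<Sum>D\<in>W. Q_sum Q D N) \<le> (\<Sum>j=1..N. of_bool (symbol_block n j \<notin> G)) + N * (card W * \<theta>)"
        by (simp add: sum.distrib)
      then have "(\<Sum>D\<in>W. Q_sum Q D N) / N \<le> ((\<Sum>j=1..N. of_bool (symbol_block n j \<notin> G)) + N * (card W * \<theta>)) / N"
        by (rule divide_right_mono) simp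
      then show ?thesis using elim(4) unfolding freq_eq_sum by (simp add: sum_divide_distrib add_divide_distrib)
    qed
    have "freq (\<lambda>j. \<bar>block_excess \<beta> d (symbol_block n j) (digit_block z n j)\<bar> > \<eta> * n) N
      \<le> freq (\<lambda>j. symbol_block n j \<notin> G \<or> (\<exists>D\<in>W. digit_block z n j = D)) N"
    proof (rule freq_mono)
      fix j :: nat
      assume j: "j \<ge> 1" and b: "\<bar>block_excess \<beta> d (symbol_block n j) (digit_block z n j)\<bar> > \<eta> * n"
      have "digit_block z n j \<in> ?W (symbol_block n j)"
        using b digit_block_less[OF z j, of n] unfolding bad_digits_def by simp
      then show "symbol_block n j \<notin> G \<or> (\<exists>D\<in>W. digit_block z n j = D)"
        unfolding W_def by blast
    qed
    also have "\<dots> \<le> ?F + (\<Sum>D\<in>W. freq (\<lambda>j. digit_block z n j = D) N)"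
      by (intro order_trans[OF freq_disj_le] add_left_mono freq_bex_le finW)
    also have "\<dots> \<le> ?F + (\<Sum>D\<in>W. 2 * (Q_sum Q D N / N) + 2 / N)"
      using elim(1) by (intro add_left_mono sum_mono) auto
    also have "\<dots> = ?F + 2 * (\<Sum>D\<in>W. Q_sum Q D N / N) + 2 * card W / N"
      by (simp add: sum.distrib sum_distrib_left mult_ac)
    also have "\<dots> \<le> \<eta>" using weights elim(2,3) W\<theta> \<epsilon>(3) by linarith
    finally show ?case .
  qed
  then show "\<exists>n\<ge>2 * length \<beta>. eventually (\<lambda>N. freq (\<lambda>j. \<bar>block_excess \<beta> d (symbol_block n j) (digit_block z n j)\<bar> > \<eta> * n) N \<le> \<eta>) sequentially"
    using n(1) by blast
qed auto

end

section \<open>Intervals in base g\<close>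

definition adic_interval :: "nat \<Rightarrow> nat \<Rightarrow> nat \<Rightarrow> real set" where
  "adic_interval g k v = {real v / real (g ^ k)..<(real v + 1) / real (g ^ k)}"

lemma constant_orbit_rem: "orbit_rem (\<lambda>_. g) z n = frac (real (g ^ n) * z)"
  by (simp add: orbit_rem_def bprod_def)

text \<open>Every \<open>g\<close>-adic interval is the cell of the digits of its left
  endpoint.\<close>

lemma block_value_digs_replicate:
  assumes "v < g ^ k"
  defines "w \<equiv> digs (replicate k g) (real v / real (g ^ k))"
  shows "w \<in> digit_box (replicate k g)" "cell_interval (replicate k g) w = adic_interval g k v"
proof -
  have "g ^ k > 0" using assms(1) by (rule le_less_trans[OF le0])
  let ?r = "real v / real (g ^ k)"
  have gk: "real (g ^ k) > 0" using \<open>g ^ k > 0\<close> by linarith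
  have r: "0 \<le> ?r" "?r < 1" using assms(1) gk by (auto simp del: of_nat_power)
  have g0: "k = 0 \<or> g > 0" using \<open>g ^ k > 0\<close> by auto
  show w: "w \<in> digit_box (replicate k g)"
    unfolding w_def using digs_less[OF r, of "replicate k g"] g0 by auto
  have "?r \<in> cell_interval (replicate k g) w"
    using digs_eq_iff[OF _ r, of w "replicate k g"] w by (simp add: w_def)
  then have "real (block_value (replicate k g) w) \<le> real v" "real v < real (block_value (replicate k g) w) + 1"
    using gk unfolding cell_interval_def by (auto simp: prod_list_replicate divide_le_cancel divide_less_cancel simp del: of_nat_power)
  then have "block_value (replicate k g) w = v" by linarith
  then show "cell_interval (replicate k g) w = adic_interval g k v"
    by (simp add: cell_interval_def adic_interval_def prod_list_replicate)
qed

lemma adic_interval_of_word: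
  assumes "w \<in> digit_box (replicate k g)"
  obtains v where "v < g ^ k" "cell_interval (replicate k g) w = adic_interval g k v"
  using that[of "block_value (replicate k g) w"] block_value_less[of w "replicate k g"] assms
  by (simp add: cell_interval_def adic_interval_def prod_list_replicate)

lemma normal_numbers_base_iff:
  assumes g: "g \<ge> 2" and z: "0 \<le> z" "z < 1"
  shows "z \<in> normal_numbers_base g \<longleftrightarrow>
    (\<forall>k\<ge>1. \<forall>v<g ^ k. freq (\<lambda>i. orbit_rem (\<lambda>_. g) z (i - 1) \<in> adic_interval g k v) \<longlonglongrightarrow> 1 / real (g ^ k))"
proof -
  have basic: "basic_sequence (\<lambda>_. g)" using g by (simp add: basic_sequence_def)
  define X where "X w i \<longleftrightarrow> (\<forall>j\<in>{1..length w}. cantor_digits (\<lambda>_. g) z (i + j - 1) = w ! (j - 1))" for w i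
  have box: "w \<in> digit_box (replicate (length w) g) \<longleftrightarrow> (\<forall>i<length w. w ! i < g)" for w
    by (auto simp: list_all2_conv_all_nth)
  have X: "X w i \<longleftrightarrow> orbit_rem (\<lambda>_. g) z (i - 1) \<in> cell_interval (replicate (length w) g) w"
    if w: "w \<in> digit_box (replicate (length w) g)" and i: "i \<ge> 1" for w i
  proof -
    obtain i' where i': "i = Suc i'" using i by (cases i) auto
    have "X w i \<longleftrightarrow> map (\<lambda>j. cantor_digits (\<lambda>_. g) z (i + j)) [0..<length w] = w"
      unfolding X_def by (rule map_window_eq_iff[symmetric])
    also have "\<dots> \<longleftrightarrow> digs (replicate (length w) g) (orbit_rem (\<lambda>_. g) z i') = w"
      unfolding i' digit_window[OF basic z] by (simp add: map_replicate_const)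
    also have "\<dots> \<longleftrightarrow> orbit_rem (\<lambda>_. g) z i' \<in> cell_interval (replicate (length w) g) w"
      using w by (intro digs_eq_iff orbit_rem_bounds) auto
    finally show ?thesis by (simp add: i')
  qed
  have "z \<in> normal_numbers_base g \<longleftrightarrow>
    (\<forall>w. w \<noteq> [] \<and> w \<in> digit_box (replicate (length w) g) \<longrightarrow> freq (X w) \<longlonglongrightarrow> 1 / real (g ^ length w))"
    unfolding normal_numbers_base_def box X_def freq_def[abs_def] using z by simp
  also have "\<dots> \<longleftrightarrow> (\<forall>w. w \<noteq> [] \<and> w \<in> digit_box (replicate (length w) g) \<longrightarrow>
    freq (\<lambda>i. orbit_rem (\<lambda>_. g) z (i - 1) \<in> cell_interval (replicate (length w) g) w) \<longlonglongrightarrow> 1 / real (g ^ length w))"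
  proof -
    have "freq (X w) = freq (\<lambda>i. orbit_rem (\<lambda>_. g) z (i - 1) \<in> cell_interval (replicate (length w) g) w)"
      if "w \<in> digit_box (replicate (length w) g)" for w
      by (intro ext freq_cong X that)
    then show ?thesis by auto
  qed
  also have "\<dots> \<longleftrightarrow> (\<forall>k\<ge>1. \<forall>v<g ^ k. freq (\<lambda>i. orbit_rem (\<lambda>_. g) z (i - 1) \<in> adic_interval g k v) \<longlonglongrightarrow> 1 / real (g ^ k))"
    (is "?L \<longleftrightarrow> ?R")
  proof (intro iffI allI impI)
    fix k v assume L: ?L and kv: "k \<ge> 1" "v < g ^ k"
    let ?w = "digs (replicate k g) (real v / real (g ^ k))"
    have "?w \<noteq> []" using kv(1) by (metis length_digs length_replicate list.size(3) not_one_le_zero)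
    then show "freq (\<lambda>i. orbit_rem (\<lambda>_. g) z (i - 1) \<in> adic_interval g k v) \<longlonglongrightarrow> 1 / real (g ^ k)"
      using L[rule_format, of ?w] block_value_digs_replicate[OF kv(2)] by simp
  next
    fix w assume R: ?R and w: "w \<noteq> [] \<and> w \<in> digit_box (replicate (length w) g)"
    obtain v where v: "v < g ^ length w" "cell_interval (replicate (length w) g) w = adic_interval g (length w) v"
      using w adic_interval_of_word by blast
    have "length w \<ge> 1" using w by (cases w) auto
    then show "freq (\<lambda>i. orbit_rem (\<lambda>_. g) z (i - 1) \<in> cell_interval (replicate (length w) g) w) \<longlonglongrightarrow> 1 / real (g ^ length w)"
      using R v by simp
  qed
  finally show ?thesis .
qed

text \<open>The total leaves no room: when every term is nearly at least its target, the other terms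
  bound each one from above through the sum. Lower bounds on the pieces of a finite partition thus
  become limits.\<close>

lemma tendsto_if_lower_bounds:
  fixes X :: "'i \<Rightarrow> nat \<Rightarrow> real"
  assumes I: "finite I" and lower: "\<And>i e. i \<in> I \<Longrightarrow> e > 0 \<Longrightarrow> eventually (\<lambda>N. X i N \<ge> a i - e) sequentially"
    and total: "(\<lambda>N. \<Sum>i\<in>I. X i N) \<longlonglongrightarrow> (\<Sum>i\<in>I. a i)" and i: "i \<in> I"
  shows "X i \<longlonglongrightarrow> a i"
proof (rule tendstoI)
  fix e :: real assume e: "e > 0"
  define \<delta> where "\<delta> = e / (2 * (real (card I) + 1))"
  have "(real (card I) + 1) * \<delta> = e / 2" unfolding \<delta>_def by (simp add: field_simps add_nonneg_eq_0_iff)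
  then have \<delta>: "\<delta> > 0" "(real (card I) + 1) * \<delta> < e" using e by (simp add: \<delta>_def, linarith)
  have "eventually (\<lambda>N. \<forall>i\<in>I. X i N \<ge> a i - \<delta>) sequentially"
    using lower \<delta>(1) by (intro eventually_ball_finite I) auto
  moreover have "eventually (\<lambda>N. (\<Sum>i\<in>I. X i N) < (\<Sum>i\<in>I. a i) + \<delta>) sequentially"
    using total by (rule order_tendstoD) (use \<delta> in simp)
  ultimately show "eventually (\<lambda>N. dist (X i N) (a i) < e) sequentially"
  proof eventually_elim
    case (elim N)
    have "(\<Sum>j\<in>I - {i}. a j - \<delta>) \<le> (\<Sum>j\<in>I - {i}. X j N)" using elim(1) by (intro sum_mono) auto
    moreover have "(\<Sum>j\<in>I. X j N) = X i N + (\<Sum>j\<in>I - {i}. X j N)" "(\<Sum>j\<in>I. a j) = a i + (\<Sum>j\<in>I - {i}. a j)"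
      using I i by (simp_all add: sum.remove)
    moreover have "(\<Sum>j\<in>I - {i}. a j - \<delta>) = (\<Sum>j\<in>I - {i}. a j) - card (I - {i}) * \<delta>" by (simp add: sum_subtractf)
    moreover have "card (I - {i}) * \<delta> \<le> card I * \<delta>"
      using \<delta>(1) I by (intro mult_right_mono of_nat_mono card_mono) auto
    moreover have "(real (card I) + 1) * \<delta> = card I * \<delta> + \<delta>" by (simp add: algebra_simps)
    moreover have "\<delta> \<le> (real (card I) + 1) * \<delta>" using \<delta>(1) by (simp add: algebra_simps)
    moreover have "X i N \<ge> a i - \<delta>" using elim(1) i by blast
    ultimately show ?case using elim(2) \<delta> unfolding dist_real_def by linarith
  qed
qed

context generated_power_sequence
begin

section \<open>Comparison of the remainders along \<open>Q\<close> and in base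
  \<open>g\<close>\<close>

definition digit_position :: "nat \<Rightarrow> nat" where
  "digit_position n = (\<Sum>i=1..n. expo ((T ^^ i) x))"

lemma digit_position_0 [simp]: "digit_position 0 = 0"
  by (simp add: digit_position_def)

lemma digit_position_Suc: "digit_position (Suc n) = digit_position n + expo ((T ^^ Suc n) x)"
  by (simp add: digit_position_def)

lemma strict_mono_digit_position: "strict_mono digit_position"
  unfolding strict_mono_Suc_iff using expo_ge_1 by (auto simp: digit_position_Suc intro: less_le_trans[OF zero_less_one])

lemma bprod_eq_power: "bprod Q n = real (g ^ digit_position n)"
proof (induction n)
  case (Suc n)
  have "Q (Suc n) = g ^ expo ((T ^^ Suc n) x)" using Q_eq[of "Suc n"] f_eq_expo[of "(T ^^ Suc n) x"] by simp
  then show ?case using Suc unfolding bprod_Suc digit_position_Suc by (simp only: power_add of_nat_mult)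
qed simp

text \<open>A product of powers of \<open>g\<close> is a power of \<open>g\<close>, so
  multiplication by \<open>q_1 ... q_n\<close> is a shift by \<open>digit_position n\<close> digits
  in base \<open>g\<close>.\<close>

lemma orbit_rem_eq: "orbit_rem Q z n = orbit_rem (\<lambda>_. g) z (digit_position n)"
  unfolding constant_orbit_rem by (simp add: orbit_rem_def bprod_eq_power)

lemma digit_position_average: "(\<lambda>N. real (digit_position N) / real N) \<longlonglongrightarrow> mean_expo"
  using expo_average by (simp add: digit_position_def)

text \<open>The definition samples remainders from index 1, while cells use them from index 0; the
  shift does not affect the limit.\<close>

lemma ud_mod1_iff:
  "ud_mod1 (\<lambda>n. (\<Prod>i=1..n. real (Q i)) * z) \<longleftrightarrow>
    (\<forall>a b. 0 \<le> a \<and> a < b \<and> b \<le> 1 \<longrightarrow> freq (\<lambda>j. orbit_rem Q z (j - 1) \<in> {a..<b}) \<longlonglongrightarrow> b - a)"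
proof -
  have eq: "ud_mod1 (\<lambda>n. (\<Prod>i=1..n. real (Q i)) * z) \<longleftrightarrow>
    (\<forall>a b. 0 \<le> a \<and> a < b \<and> b \<le> 1 \<longrightarrow> freq (\<lambda>n. orbit_rem Q z n \<in> {a..<b}) \<longlonglongrightarrow> b - a)"
    unfolding ud_mod1_def orbit_rem_def bprod_def freq_def[abs_def] ..
  have *: "freq (\<lambda>n. orbit_rem Q z n \<in> S) \<longlonglongrightarrow> l \<longleftrightarrow> freq (\<lambda>j. orbit_rem Q z (j - 1) \<in> S) \<longlonglongrightarrow> l" for S l
  proof (rule Lim_transform_eq)
    show "(\<lambda>N. freq (\<lambda>n. orbit_rem Q z n \<in> S) N - freq (\<lambda>j. orbit_rem Q z (j - 1) \<in> S) N) \<longlonglongrightarrow> 0"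
    proof (rule Lim_null_comparison)
      show "eventually (\<lambda>N. norm (freq (\<lambda>n. orbit_rem Q z n \<in> S) N - freq (\<lambda>j. orbit_rem Q z (j - 1) \<in> S) N) \<le> 2 / real N) sequentially"
        using eventually_gt_at_top[of 0]
        by eventually_elim (use freq_shift[of _ "\<lambda>j. orbit_rem Q z (j - 1) \<in> S"] in simp)
    qed (rule lim_const_over_n)
  qed
  show ?thesis unfolding eq * ..
qed

lemma cell_normal_if_DN_Q:
  assumes "z \<in> DN_Q Q"
  shows "cell_normal z"
proof (rule cell_normal_if_bounded_density[where C = 1])
  show "0 \<le> z" "z < 1" using assms unfolding DN_Q_def by auto
  fix k v and \<delta> :: real assume v: "v < g ^ k" and \<delta>: "\<delta> > 0"
  let ?a = "real v / real (g ^ k)" and ?b = "(real v + 1) / real (g ^ k)"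
  have gk: "real (g ^ k) > 0" "real v + 1 \<le> real (g ^ k)" using g v by (simp, linarith)
  have "freq (\<lambda>j. orbit_rem Q z (j - 1) \<in> {?a..<?b}) \<longlonglongrightarrow> ?b - ?a"
    using assms gk unfolding DN_Q_def ud_mod1_iff by (auto simp: divide_strict_right_mono simp del: of_nat_power)
  moreover have "?b - ?a < 1 / real (g ^ k) + \<delta>" using \<delta> by (simp add: diff_divide_distrib[symmetric])
  ultimately have "eventually (\<lambda>N. freq (\<lambda>j. orbit_rem Q z (j - 1) \<in> {?a..<?b}) N < 1 / real (g ^ k) + \<delta>) sequentially"
    by (rule order_tendstoD)
  then show "eventually (\<lambda>N. freq (\<lambda>j. orbit_rem Q z (j - 1) \<in> {?a..<?b}) N \<le> 1 / real (g ^ k) + \<delta>) sequentially"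
    by eventually_elim simp
qed simp

text \<open>The positions \<open>Suc (digit_position (j - 1))\<close> are distinct, so visits along
  \<open>Q\<close> inject into base \<open>g\<close> visits. The sampling ratio
  \<open>digit_position N / N\<close> tends to \<open>mean_expo\<close>, the origin of the constant
  in the density bound.\<close>

lemma freq_along_digit_positions:
  assumes "N > 0"
  shows "freq (\<lambda>j. orbit_rem Q z (j - 1) \<in> S) N \<le> real (digit_position N) / real N * freq (\<lambda>i. orbit_rem (\<lambda>_. g) z (i - 1) \<in> S) (digit_position N)"
proof -
  have pos: "digit_position N > 0" using strict_mono_less[OF strict_mono_digit_position, of 0 N] assms by simp
  let ?A = "{j \<in> {1..N}. orbit_rem Q z (j - 1) \<in> S}"
  let ?B = "{i \<in> {1..digit_position N}. orbit_rem (\<lambda>_. g) z (i - 1) \<in> S}"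
  have "card ?A \<le> card ?B"
  proof (rule card_inj_on_le[where f = "\<lambda>j. Suc (digit_position (j - 1))"])
    show "inj_on (\<lambda>j. Suc (digit_position (j - 1))) ?A"
      by (auto simp: inj_on_def strict_mono_eq[OF strict_mono_digit_position])
    show "(\<lambda>j. Suc (digit_position (j - 1))) ` ?A \<subseteq> ?B"
    proof
      fix i assume "i \<in> (\<lambda>j. Suc (digit_position (j - 1))) ` ?A"
      then obtain j where j: "j \<in> {1..N}" "orbit_rem Q z (j - 1) \<in> S" "i = Suc (digit_position (j - 1))" by auto
      have "digit_position (j - 1) < digit_position N"
        using j(1) by (intro strict_monoD[OF strict_mono_digit_position]) auto
      then show "i \<in> ?B" using j by (simp add: orbit_rem_eq)
    qed
  qed simp
  then have "real (card ?A) / N \<le> real (card ?B) / N" by (intro divide_right_mono) auto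
  then show ?thesis using pos unfolding freq_def by simp
qed

lemma cell_normal_if_normal_base:
  assumes z: "z \<in> normal_numbers_base g"
  shows "cell_normal z"
proof (rule cell_normal_if_bounded_density[where C = mean_expo])
  show z01: "0 \<le> z" "z < 1" using z unfolding normal_numbers_base_def by auto
  show "mean_expo \<ge> 0" using mean_expo_ge_1 by simp
  fix k v and \<delta> :: real assume v: "v < g ^ k" and \<delta>: "\<delta> > 0"
  let ?I = "{real v / real (g ^ k)..<(real v + 1) / real (g ^ k)}"
  show "eventually (\<lambda>N. freq (\<lambda>j. orbit_rem Q z (j - 1) \<in> ?I) N \<le> mean_expo / real (g ^ k) + \<delta>) sequentially"
  \<comment> \<open>Base \<open>g\<close> normality concerns levels \<open>k \<ge> 1\<close>; at
    level 0 the bound is \<open>freq \<le> 1 \<le> mean_expo\<close>.\<close>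
  proof (cases "k = 0")
    case True
    then show ?thesis using mean_expo_ge_1 \<delta> by (intro always_eventually allI order_trans[OF freq_le_1]) simp
  next
    case False
    then have "freq (\<lambda>i. orbit_rem (\<lambda>_. g) z (i - 1) \<in> adic_interval g k v) \<longlonglongrightarrow> 1 / real (g ^ k)"
      using z v normal_numbers_base_iff[OF g z01] by simp
    from LIMSEQ_subseq_LIMSEQ[OF this strict_mono_digit_position]
    have "(\<lambda>N. freq (\<lambda>i. orbit_rem (\<lambda>_. g) z (i - 1) \<in> ?I) (digit_position N)) \<longlonglongrightarrow> 1 / real (g ^ k)"
      by (simp add: comp_def adic_interval_def)
    from tendsto_mult[OF digit_position_average this]
    have "(\<lambda>N. real (digit_position N) / real N * freq (\<lambda>i. orbit_rem (\<lambda>_. g) z (i - 1) \<in> ?I) (digit_position N)) \<longlonglongrightarrow> mean_expo / real (g ^ k)"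
      by (simp only: times_divide_eq_right mult_1_right)
    then have "eventually (\<lambda>N. real (digit_position N) / real N * freq (\<lambda>i. orbit_rem (\<lambda>_. g) z (i - 1) \<in> ?I) (digit_position N) < mean_expo / real (g ^ k) + \<delta>) sequentially"
      by (rule order_tendstoD) (use \<delta> in simp)
    then show ?thesis using eventually_gt_at_top[of 0]
      by eventually_elim (use freq_along_digit_positions[of _ z ?I] in \<open>auto intro: order_trans less_imp_le\<close>)
  qed
qed

end

section \<open>Cells of the phase space\<close>

lemma prob_space_lebesgue01: "prob_space lebesgue01"
  by (rule prob_spaceI) (simp add: lebesgue01_def emeasure_restrict_space space_restrict_space)

lemma sets_lebesgue01_interval:
  "{a..<b} \<subseteq> {0..<1} \<Longrightarrow> {a..<b} \<in> sets lebesgue01"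
  "{a<..<b} \<subseteq> {0..<1} \<Longrightarrow> {a<..<b} \<in> sets lebesgue01" for a b :: real
  by (simp_all add: lebesgue01_def sets_restrict_space_iff)

lemma measure_lebesgue01_interval:
  assumes "0 \<le> a" "a \<le> b" "b \<le> 1"
  shows "measure lebesgue01 {a..<b} = b - a" "measure lebesgue01 {a<..<b} = b - a"
proof -
  have "{a..<b} \<subseteq> {0..<1}" "{a<..<b} \<subseteq> {0..<1}" using assms by auto
  then show "measure lebesgue01 {a..<b} = b - a" "measure lebesgue01 {a<..<b} = b - a"
    using assms by (simp_all add: lebesgue01_def measure_restrict_space)
qed

lemma space_lebesgue01: "space lebesgue01 = {0..<1}"
  by (simp add: lebesgue01_def space_restrict_space)

lemma digs_eq_imp_close:
  assumes "0 \<le> r" "r < 1" "0 \<le> r'" "r' < 1" "\<forall>b\<in>set B. b \<ge> 2" "digs B r = digs B r'"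
  shows "\<bar>r - r'\<bar> \<le> (1 / 2) ^ length B"
proof -
  have pos: "\<forall>b\<in>set B. b > 0" using assms(5) by auto
  have "r \<in> cell_interval B (digs B r)" "r' \<in> cell_interval B (digs B r)"
    using digs_eq_iff[OF digs_less[OF assms(1,2) pos] assms(1,2)] digs_eq_iff[OF digs_less[OF assms(1,2) pos] assms(3,4)] assms(6) by auto
  then have "\<bar>r - r'\<bar> \<le> 1 / real (prod_list B)" unfolding cell_interval_def by (auto simp: add_divide_distrib)
  also have "\<dots> \<le> 1 / 2 ^ length B"
  proof -
    have "2 ^ length B \<le> prod_list B" using assms(5) by (induction B) (auto intro: mult_mono)
    then have "2 ^ length B \<le> real (prod_list B)" by (metis of_nat_le_iff of_nat_numeral of_nat_power)
    then show ?thesis by (intro frac_le) auto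
  qed
  finally show ?thesis by (simp add: power_one_over)
qed

lemma take_digs: "take m (digs B r) = digs (take m B) r"
proof (induction B arbitrary: m r)
  case (Cons b B)
  then show ?case by (cases m) auto
qed simp

context generated_power_sequence
begin

text \<open>Sets that contain a block cylinder around each of their points form a topology which
  makes \<open>f\<close> continuous and is closed under preimages of \<open>T\<close>. By minimality
  the given topology is contained in it, so every open set is of this kind.\<close>

lemma block_neighbourhood:
  assumes "open V" "u \<in> V"
  shows "\<exists>n. \<forall>v. block n v = block n u \<longrightarrow> v \<in> V"
proof -
  define Op where "Op V \<longleftrightarrow> (\<forall>u\<in>V. \<exists>n. \<forall>v. block n v = block n u \<longrightarrow> v \<in> V)" for V
  have coarser: "block m v = block m u" if "m \<le> n" "block n v = block n u" for m n u v
    using that take_block[OF that(1)] by metis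
  have "istopology Op"
    unfolding istopology_def
  proof (intro conjI allI impI)
    fix S S' assume "Op S" "Op S'"
    show "Op (S \<inter> S')" unfolding Op_def
    proof
      fix u assume "u \<in> S \<inter> S'"
      then obtain n n' where n: "\<forall>v. block n v = block n u \<longrightarrow> v \<in> S" "\<forall>v. block n' v = block n' u \<longrightarrow> v \<in> S'"
        using \<open>Op S\<close> \<open>Op S'\<close> unfolding Op_def by blast
      show "\<exists>n. \<forall>v. block n v = block n u \<longrightarrow> v \<in> S \<inter> S'"
      proof (intro exI[of _ "max n n'"] allI impI)
        fix v assume v: "block (max n n') v = block (max n n') u"
        have "block n v = block n u" "block n' v = block n' u"
          by (rule coarser[OF _ v], simp)+
        then show "v \<in> S \<inter> S'" using n by blast
      qed
    qed
  next
    fix K assume "\<forall>S\<in>K. Op S"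
    then show "Op (\<Union>K)" unfolding Op_def by (meson Union_iff)
  qed
  then have Op: "openin (topology Op) = Op" by (rule topology_inverse')
  have "makes_continuous T f (topology Op)"
    unfolding makes_continuous_def
  proof (intro conjI allI impI)
    have "Op UNIV" by (auto simp: Op_def)
    then have "openin (topology Op) UNIV" unfolding Op .
    then show "topspace (topology Op) = UNIV" using openin_subset by blast
    then show "continuous_map (topology Op) (discrete_topology UNIV) f"
      unfolding continuous_map_def Op
    proof (intro conjI allI impI)
      fix S assume "topspace (topology Op) = UNIV"
      have "\<exists>n. \<forall>v. block n v = block n u \<longrightarrow> f v \<in> S" if "f u \<in> S" for u
        using that by (intro exI[of _ 1]) (auto simp: block_def)
      then show "Op {x \<in> topspace (topology Op). f x \<in> S}"
        using \<open>topspace (topology Op) = UNIV\<close> by (auto simp: Op_def)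
    qed auto
    fix U assume "openin (topology Op) U"
    then have "Op U" unfolding Op .
    \<comment> \<open>A preimage under \<open>T\<close> costs one more symbol in the
      cylinder.\<close>
    have step: "block (Suc n) v = f v # block n (T v)" for n v
    proof (rule nth_equalityI)
      fix i assume "i < length (block (Suc n) v)"
      then show "block (Suc n) v ! i = (f v # block n (T v)) ! i" by (cases i) (auto simp: funpow_swap1)
    qed simp
    have "Op (T -` U)"
      unfolding Op_def
    proof
      fix u assume "u \<in> T -` U"
      then obtain n where n: "\<forall>v. block n v = block n (T u) \<longrightarrow> v \<in> U" using \<open>Op U\<close> unfolding Op_def by blast
      then have "\<forall>v. block (Suc n) v = block (Suc n) u \<longrightarrow> v \<in> T -` U" unfolding step by simp
      then show "\<exists>n. \<forall>v. block n v = block n u \<longrightarrow> v \<in> T -` U" by blast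
    qed
    then show "openin (topology Op) (T -` U)" unfolding Op .
  qed
  then have "openin (topology Op) V" using generates assms(1) unfolding generates_topology_def by blast
  then have "Op V" unfolding Op .
  then show ?thesis using assms(2) unfolding Op_def by blast
qed

section \<open>The product phase space and its cells\<close>

sublocale L: prob_space lebesgue01 by (rule prob_space_lebesgue01)

sublocale P: pair_prob_space M lebesgue01 ..

abbreviation product_measure :: "('a \<times> real) measure" where
  "product_measure \<equiv> M \<Otimes>\<^sub>M lebesgue01"

abbreviation phase_space :: "('a \<times> real) set" where
  "phase_space \<equiv> UNIV \<times> {0..<1}"

lemma space_product: "space product_measure = phase_space"
  by (simp add: space_pair_measure space_lebesgue01)

lemma measure_product_Times:
  "A \<in> sets M \<Longrightarrow> B \<in> sets lebesgue01 \<Longrightarrow> P.prob (A \<times> B) = prob A * measure lebesgue01 B"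
  unfolding measure_def by (simp add: L.emeasure_pair_measure_Times enn2real_mult)

text \<open>Pairs the symbols from \<open>q_j\<close> on with the remainder before digit
  \<open>j\<close>, which is the \<open>j\<close>-th point of the orbit of \<open>(T x, z)\<close>
  under the skew product.\<close>

definition orbit_point :: "real \<Rightarrow> nat \<Rightarrow> 'a \<times> real" where
  "orbit_point z j = ((T ^^ j) x, orbit_rem Q z (j - 1))"

definition cell :: "nat list \<times> nat list \<Rightarrow> ('a \<times> real) set" where
  "cell p = {u. block (length (fst p)) u = fst p} \<times> cell_interval (fst p) (snd p)"

lemma mem_cell_iff:
  assumes "D \<in> digit_box B" "0 \<le> r" "r < 1"
  shows "(u, r) \<in> cell (B, D) \<longleftrightarrow> block (length B) u = B \<and> digs B r = D"
  using digs_eq_iff[of D B r] assms by (auto simp: cell_def)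

lemma cell_measure:
  assumes "D \<in> digit_box B"
  shows "cell (B, D) \<in> sets product_measure"
    "P.prob (cell (B, D)) = prob {u. block (length B) u = B} / real (prod_list B)"
proof -
  have D: "list_all2 (<) D B" using assms by simp
  have I: "cell_interval B D \<in> sets lebesgue01"
    using cell_interval_subset[OF D] unfolding cell_interval_def by (rule sets_lebesgue01_interval)
  show "cell (B, D) \<in> sets product_measure"
    unfolding cell_def fst_conv snd_conv by (intro pair_measureI sets_block I)
  have le: "real (block_value B D) + 1 \<le> real (prod_list B)" using block_value_less[OF D] by linarith
  have "measure lebesgue01 (cell_interval B D) = 1 / real (prod_list B)"
    unfolding cell_interval_def using le
    by (subst measure_lebesgue01_interval) (auto simp: divide_right_mono divide_le_eq_1 diff_divide_distrib[symmetric])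
  then show "P.prob (cell (B, D)) = prob {u. block (length B) u = B} / real (prod_list B)"
    unfolding cell_def fst_conv snd_conv by (subst measure_product_Times[OF sets_block I]) simp
qed

text \<open>More general than relative openness, since the half-open cells qualify. The condition
  \<open>n \<ge> 1\<close> keeps symbol blocks nonempty, as in \<open>cell_normal\<close>.\<close>

definition cell_open :: "('a \<times> real) set \<Rightarrow> bool" where
  "cell_open A \<longleftrightarrow> A \<subseteq> phase_space \<and>
     (\<forall>(u, r)\<in>A. \<exists>n\<ge>1. cell (block n u, digs (block n u) r) \<subseteq> A)"

lemma block_ge_2: "\<forall>b\<in>set (block n u). b \<ge> 2"
  using f_ge_2 by (auto simp: block_def)

text \<open>Block cylinders are arbitrarily small neighbourhoods in the first coordinate, and cells
  over \<open>n\<close> symbols have length at most \<open>(1 / 2) ^ n\<close> in the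
  second.\<close>

lemma cell_open_if_relatively_open:
  assumes "open U"
  shows "cell_open (U \<inter> phase_space)"
  unfolding cell_open_def
proof (intro conjI ballI)
  fix p assume p: "p \<in> U \<inter> phase_space"
  obtain u r where ur: "p = (u, r)" by (cases p)
  have r: "0 \<le> r" "r < 1" using p ur by auto
  obtain V W where "open V" "open W" "p \<in> V \<times> W" "V \<times> W \<subseteq> U"
    by (rule open_prod_elim[OF assms, of p]) (use p in auto)
  then have VW: "open V" "open W" "u \<in> V" "r \<in> W" "V \<times> W \<subseteq> U" unfolding ur by auto
  obtain m where m: "\<forall>v. block m v = block m u \<longrightarrow> v \<in> V" using block_neighbourhood[OF VW(1,3)] by blast
  obtain e where e: "e > 0" "ball r e \<subseteq> W" using VW(2,4) open_contains_ball by blast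
  obtain k where k: "(1 / 2) ^ k < e" using real_arch_pow_inv[of e "1/2"] e by auto
  define n where "n = max 1 (max m k)"
  have "cell (block n u, digs (block n u) r) \<subseteq> U \<inter> phase_space"
  proof
    fix q assume q: "q \<in> cell (block n u, digs (block n u) r)"
    obtain v s where vs: "q = (v, s)" by (cases q)
    have box: "digs (block n u) r \<in> digit_box (block n u)" using digs_less[OF r symbol_pos] by simp
    have "s \<in> cell_interval (block n u) (digs (block n u) r)" using q unfolding vs cell_def by simp
    then have "s \<in> {0..<1}" using cell_interval_subset box by blast
    then have s: "0 \<le> s" "s < 1" by auto
    have eq: "block n v = block n u" "digs (block n u) s = digs (block n u) r"
      using q mem_cell_iff[OF box s] unfolding vs by auto
    have "block m v = block m u" using arg_cong[OF eq(1), of "take m"] by (simp add: take_block n_def)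
    then have "v \<in> V" using m by blast
    moreover have "\<bar>r - s\<bar> < e"
    proof -
      have "\<bar>r - s\<bar> \<le> (1 / 2) ^ n" using digs_eq_imp_close[OF r s block_ge_2, of n u] eq(2) by simp
      also have "\<dots> \<le> (1 / 2) ^ k" by (rule power_decreasing) (auto simp: n_def)
      finally show ?thesis using k by linarith
    qed
    then have "s \<in> W" using e(2) by (auto simp: dist_real_def)
    ultimately show "q \<in> U \<inter> phase_space" using VW(5) s vs by auto
  qed
  then show "case p of (u, r) \<Rightarrow> \<exists>n\<ge>1. cell (block n u, digs (block n u) r) \<subseteq> U \<inter> phase_space"
    unfolding ur by (auto intro!: exI[of _ n] simp: n_def)
qed auto

text \<open>Every point of \<open>A\<close> lies in a largest cell contained in \<open>A\<close>, and two of these largest cells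
  are equal or disjoint because cells are nested or disjoint.\<close>

lemma cell_open_decomposition:
  assumes A: "cell_open A"
  obtains J where "A = (\<Union>p\<in>J. cell p)" "disjoint_family_on cell J"
    "\<And>B D. (B, D) \<in> J \<Longrightarrow> B \<noteq> [] \<and> D \<in> digit_box B"
proof -
  define J where "J = {(B, D). B \<noteq> [] \<and> D \<in> digit_box B \<and> cell (B, D) \<subseteq> A \<and>
    (\<forall>m. 1 \<le> m \<and> m < length B \<longrightarrow> \<not> cell (take m B, take m D) \<subseteq> A)}"
  have mem: "n = length B \<Longrightarrow> (u, r) \<in> cell (B, D) \<Longrightarrow> D \<in> digit_box B \<Longrightarrow> 0 \<le> r \<and> r < 1 \<and> B = block n u \<and> D = digs (block n u) r" for n u r B D
  proof -
    assume *: "n = length B" "(u, r) \<in> cell (B, D)" "D \<in> digit_box B"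
    then have "r \<in> cell_interval B D" unfolding cell_def by simp
    then have "r \<in> {0..<1}" using cell_interval_subset *(3) by blast
    then have r: "0 \<le> r" "r < 1" by auto
    then show ?thesis using mem_cell_iff[OF *(3) r] * by auto
  qed
  have "A \<subseteq> (\<Union>p\<in>J. cell p)"
  proof
    fix p assume p: "p \<in> A"
    obtain u r where ur: "p = (u, r)" by (cases p)
    have r: "0 \<le> r" "r < 1" using A p ur unfolding cell_open_def by auto
    let ?P = "\<lambda>n. n \<ge> 1 \<and> cell (block n u, digs (block n u) r) \<subseteq> A"
    have ex: "\<exists>n. ?P n" using A p unfolding cell_open_def ur by blast
    define n where "n = (LEAST n. ?P n)"
    have n: "?P n" unfolding n_def by (rule LeastI_ex[OF ex])
    have least: "\<not> ?P m" if "m < n" for m using that unfolding n_def by (rule not_less_Least)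
    have box: "digs (block n u) r \<in> digit_box (block n u)" using digs_less[OF r symbol_pos] by simp
    have "(block n u, digs (block n u) r) \<in> J"
      unfolding J_def using n box least by (auto simp: take_block take_digs less_imp_le) (auto simp: block_def)
    moreover have "p \<in> cell (block n u, digs (block n u) r)" unfolding ur using mem_cell_iff[OF box r] by simp
    ultimately show "p \<in> (\<Union>p\<in>J. cell p)" by blast
  qed
  moreover have "(\<Union>p\<in>J. cell p) \<subseteq> A" unfolding J_def by auto
  moreover have "disjoint_family_on cell J"
    unfolding disjoint_family_on_def
  proof (intro ballI impI)
    fix p p' assume p: "p \<in> J" "p' \<in> J" "p \<noteq> p'"
    obtain B D where BD: "p = (B, D)" by (cases p)
    obtain B' D' where BD': "p' = (B', D')" by (cases p')
    show "cell p \<inter> cell p' = {}"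
    proof (rule ccontr)
      assume "cell p \<inter> cell p' \<noteq> {}"
      then obtain u r where ur: "(u, r) \<in> cell (B, D)" "(u, r) \<in> cell (B', D')" unfolding BD BD' by auto
      have eq: "B = block (length B) u" "D = digs (block (length B) u) r" "B' = block (length B') u" "D' = digs (block (length B') u) r"
        using mem[OF refl ur(1)] mem[OF refl ur(2)] p unfolding BD BD' J_def by auto
      have no: "\<not> length C < length C'"
        if "(C, E) \<in> J" "(C', E') \<in> J" "C = block (length C) u" "E = digs (block (length C) u) r"
          "C' = block (length C') u" "E' = digs (block (length C') u) r" for C E C' E'
      proof
        assume less: "length C < length C'"
        have "take (length C) C' = C" by (subst that(5), subst that(3)) (simp add: take_block less less_imp_le)
        moreover have "take (length C) E' = E"
          by (subst that(6), subst that(4)) (simp add: take_block take_digs less less_imp_le)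
        moreover have "length C \<ge> 1" "cell (C, E) \<subseteq> A" using that(1) unfolding J_def by (auto simp: Suc_le_eq)
        moreover have "\<not> cell (take (length C) C', take (length C) E') \<subseteq> A"
          using that(2) less \<open>length C \<ge> 1\<close> unfolding J_def by blast
        ultimately show False by simp
      qed
      have "length B = length B'"
        using no[of B D B' D'] no[of B' D' B D] p eq unfolding BD BD' by (metis linorder_neqE_nat)
      then have "p = p'" using eq unfolding BD BD' by metis
      then show False using p(3) by simp
    qed
  qed
  ultimately show ?thesis using that[of J] unfolding J_def by blast
qed

text \<open>The disjoint decomposition into cells is countable, as cells are indexed by pairs of
  lists of naturals. Finitely many of them carry the measure up to \<open>e / 2\<close>, and on each
  the frequency converges by cell normality. Measurability comes from the same
  decomposition.\<close>

lemma cell_open_lower_frequency: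
  assumes A: "cell_open A"
  shows "A \<in> sets product_measure"
    and "0 \<le> z \<Longrightarrow> z < 1 \<Longrightarrow> cell_normal z \<Longrightarrow> e > 0 \<Longrightarrow>
      eventually (\<lambda>N. freq (\<lambda>j. orbit_point z j \<in> A) N \<ge> P.prob A - e) sequentially"
proof -
  obtain J where J: "A = (\<Union>p\<in>J. cell p)" "disjoint_family_on cell J"
    "\<And>B D. (B, D) \<in> J \<Longrightarrow> B \<noteq> [] \<and> D \<in> digit_box B"
    using cell_open_decomposition[OF A] by blast
  have Jm: "cell p \<in> sets product_measure" if "p \<in> J" for p
    using cell_measure(1) J(3) that by (cases p) auto
  show "A \<in> sets product_measure"
    unfolding J(1) using Jm by (intro sets.countable_UN'') (auto intro: countableI_type)
  assume z: "0 \<le> z" "z < 1" and normal: "cell_normal z" and e: "e > 0"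
  define F where "F n = {p \<in> J. to_nat p < n}" for n
  have F: "finite (F n)" "F n \<subseteq> J" for n
  proof -
    have "inj_on to_nat (F n)" "to_nat ` F n \<subseteq> {..<n}" by (auto simp: F_def)
    then show "finite (F n)" by (metis finite_imageD finite_lessThan finite_subset)
  qed (auto simp: F_def)
  have "(\<lambda>n. P.prob (\<Union>p\<in>F n. cell p)) \<longlonglongrightarrow> P.prob (\<Union>n. \<Union>p\<in>F n. cell p)"
  proof (rule P.finite_Lim_measure_incseq)
    have "(\<Union>p\<in>F n. cell p) \<in> sets product_measure" for n
      by (rule sets.finite_UN[OF F(1)]) (use Jm F(2) in blast)
    then show "range (\<lambda>n. \<Union>p\<in>F n. cell p) \<subseteq> sets product_measure" by blast
    show "incseq (\<lambda>n. \<Union>p\<in>F n. cell p)" by (rule incseq_SucI) (auto simp: F_def)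
  qed
  moreover have "(\<Union>n. \<Union>p\<in>F n. cell p) = A" unfolding J(1) by (auto simp: F_def)
  ultimately have "eventually (\<lambda>n. P.prob (\<Union>p\<in>F n. cell p) > P.prob A - e / 2) sequentially"
    using e by (intro order_tendstoD) auto
  then have "\<exists>n. P.prob (\<Union>p\<in>F n. cell p) > P.prob A - e / 2"
    by (rule eventually_happens'[OF sequentially_bot])
  then obtain n where n: "P.prob (\<Union>p\<in>F n. cell p) > P.prob A - e / 2" by (rule exE)
  have disj: "disjoint_family_on cell (F n)" using J(2) F(2) by (rule disjoint_family_on_mono[rotated])
  have meas: "P.prob (\<Union>p\<in>F n. cell p) = (\<Sum>p\<in>F n. P.prob (cell p))"
  proof (rule P.finite_measure_finite_Union[OF F(1) _ disj])
    show "cell ` F n \<subseteq> sets product_measure" using Jm F(2) by blast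
  qed
  have freq_cell: "freq (\<lambda>j. orbit_point z j \<in> cell p) \<longlonglongrightarrow> P.prob (cell p)" if p: "p \<in> F n" for p
  proof -
    obtain B D where BD: "p = (B, D)" by (cases p)
    have box: "B \<noteq> []" "D \<in> digit_box B" using J(3) F(2) p BD by blast+
    have "freq (\<lambda>j. orbit_point z j \<in> cell p) = freq (\<lambda>j. symbol_block (length B) j = B \<and> digit_block z (length B) j = D)"
    proof (intro ext freq_cong)
      fix j :: nat assume j: "j \<ge> 1"
      show "orbit_point z j \<in> cell p \<longleftrightarrow> symbol_block (length B) j = B \<and> digit_block z (length B) j = D"
        unfolding orbit_point_def BD mem_cell_iff[OF box(2) orbit_rem_bounds] digit_block_eq[OF z j] by auto
    qed
    then show ?thesis using cell_normalD[OF normal box] cell_measure(2)[OF box(2)] unfolding BD by simp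
  qed
  have union: "freq (\<lambda>j. \<exists>p\<in>F n. orbit_point z j \<in> cell p) N = (\<Sum>p\<in>F n. freq (\<lambda>j. orbit_point z j \<in> cell p) N)" for N
  proof (rule freq_bex_disjoint[OF F(1)], rule ccontr)
    fix p q j assume "p \<in> F n" "q \<in> F n" "orbit_point z j \<in> cell p" "orbit_point z j \<in> cell q" "p \<noteq> q"
    then show False using disjoint_family_onD[OF disj, of p q] by blast
  qed
  have "(\<lambda>N. \<Sum>p\<in>F n. freq (\<lambda>j. orbit_point z j \<in> cell p) N) \<longlonglongrightarrow> (\<Sum>p\<in>F n. P.prob (cell p))"
    by (intro tendsto_sum freq_cell)
  then have "freq (\<lambda>j. \<exists>p\<in>F n. orbit_point z j \<in> cell p) \<longlonglongrightarrow> P.prob (\<Union>p\<in>F n. cell p)"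
    unfolding meas union[symmetric] .
  then have "eventually (\<lambda>N. freq (\<lambda>j. \<exists>p\<in>F n. orbit_point z j \<in> cell p) N > P.prob A - e) sequentially"
    by (rule order_tendstoD) (use n e in linarith)
  then show "eventually (\<lambda>N. freq (\<lambda>j. orbit_point z j \<in> A) N \<ge> P.prob A - e) sequentially"
  proof eventually_elim
    case (elim N)
    have "freq (\<lambda>j. \<exists>p\<in>F n. orbit_point z j \<in> cell p) N \<le> freq (\<lambda>j. orbit_point z j \<in> A) N"
      using F(2) unfolding J(1) by (intro freq_mono) auto
    then show ?case using elim by linarith
  qed
qed

end

section \<open>Distribution normality\<close>

lemma tendsto_if_both_lower_bounds:
  fixes X :: "nat \<Rightarrow> real"
  assumes "\<And>e. e > 0 \<Longrightarrow> eventually (\<lambda>N. X N \<ge> a - e) sequentially"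
    and "\<And>e. e > 0 \<Longrightarrow> eventually (\<lambda>N. X N \<le> a + e) sequentially"
  shows "X \<longlonglongrightarrow> a"
proof (rule tendstoI)
  fix e :: real assume "e > 0"
  then have "eventually (\<lambda>N. X N \<ge> a - e / 2) sequentially" "eventually (\<lambda>N. X N \<le> a + e / 2) sequentially"
    using assms[of "e / 2"] by auto
  then show "eventually (\<lambda>N. dist (X N) a < e) sequentially"
    by eventually_elim (use \<open>e > 0\<close> in \<open>auto simp: dist_real_def\<close>)
qed

text \<open>Discrete layer cake estimate: averages and integrals of functions with values in
  \<open>[0, 1]\<close> reduce to \<open>m\<close> superlevel sets, with error
  \<open>1 / m\<close>.\<close>

lemma staircase_bounds:
  fixes t :: real and m :: nat
  assumes "0 \<le> t" "t \<le> 1" "m > 0"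
  shows "(\<Sum>i=1..m. of_bool (t > i / m)) \<le> m * t" "m * t \<le> (\<Sum>i=1..m. of_bool (t > i / m)) + 1"
proof -
  have eq: "(\<Sum>i=1..m. of_bool (t > i / m) :: real) = card {i \<in> {1..m}. real i < m * t}"
    using assms(3) by (simp add: of_bool_def sum.If_cases Int_def field_simps)
  show "(\<Sum>i=1..m. of_bool (t > i / m)) \<le> m * t"
  proof -
    have "{i \<in> {1..m}. real i < m * t} \<subseteq> {1..nat \<lfloor>m * t\<rfloor>}" by (auto simp: le_nat_floor)
    then have "card {i \<in> {1..m}. real i < m * t} \<le> nat \<lfloor>m * t\<rfloor>" using card_mono[of "{1..nat \<lfloor>m * t\<rfloor>}"] by fastforce
    moreover have "real (nat \<lfloor>m * t\<rfloor>) \<le> m * t" using assms by simp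
    ultimately show ?thesis unfolding eq by linarith
  qed
  show "m * t \<le> (\<Sum>i=1..m. of_bool (t > i / m)) + 1"
  proof -
    define n where "n = nat (\<lceil>m * t\<rceil> - 1)"
    have mt: "m * t \<le> m" using assms by (simp add: mult_left_le)
    have "{1..n} \<subseteq> {i \<in> {1..m}. real i < m * t}"
    proof
      fix i assume i: "i \<in> {1..n}"
      then have "int i \<le> \<lceil>m * t\<rceil> - 1" by (auto simp: n_def)
      then have "real i < m * t" by linarith
      moreover from this mt have "i \<le> m" by linarith
      ultimately show "i \<in> {i \<in> {1..m}. real i < m * t}" using i by auto
    qed
    then have "n \<le> card {i \<in> {1..m}. real i < m * t}" using card_mono[of "{i \<in> {1..m}. real i < m * t}" "{1..n}"] by simp
    moreover have "m * t \<le> real n + 1" unfolding n_def by linarith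
    ultimately show ?thesis unfolding eq by linarith
  qed
qed

context generated_power_sequence
begin

lemma orbit_point_in_phase_space: "orbit_point z j \<in> phase_space"
  using orbit_rem_bounds by (simp add: orbit_point_def)

lemma measure_fiber_interval:
  assumes "0 \<le> a" "a \<le> b" "b \<le> 1"
  shows "P.prob (UNIV \<times> {a<..<b}) = b - a"
  using measure_product_Times[of UNIV "{a<..<b}"] measure_lebesgue01_interval(2)[OF assms]
    sets_lebesgue01_interval(2)[of a b] assms prob_space sets.top[of M]
  by (auto simp: subset_iff)

lemma open_fiber_lower_frequency:
  assumes z: "0 \<le> z" "z < 1" "cell_normal z" and "0 \<le> a" "a \<le> b" "b \<le> 1" "e > 0"
  shows "eventually (\<lambda>N. freq (\<lambda>j. orbit_rem Q z (j - 1) \<in> {a<..<b}) N \<ge> b - a - e) sequentially"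
proof -
  have eq: "UNIV \<times> {a<..<b} = (UNIV \<times> {a<..<b}) \<inter> phase_space" using assms by auto
  have "cell_open (UNIV \<times> {a<..<b})"
    by (subst eq, rule cell_open_if_relatively_open) (intro open_Times open_UNIV open_greaterThanLessThan)
  from cell_open_lower_frequency(2)[OF this z \<open>e > 0\<close>] measure_fiber_interval[OF assms(4-6)]
  show ?thesis by (simp add: orbit_point_def)
qed

text \<open>The upper bound comes from the complement: the open intervals to the left and to the
  right of \<open>[a, b)\<close> obey lower bounds, and the three frequencies add up to at most
  1.\<close>

lemma DN_Q_if_cell_normal:
  assumes z: "0 \<le> z" "z < 1" "cell_normal z"
  shows "z \<in> DN_Q Q"
proof -
  have "freq (\<lambda>j. orbit_rem Q z (j - 1) \<in> {a..<b}) \<longlonglongrightarrow> b - a" if ab: "0 \<le> a" "a < b" "b \<le> 1" for a b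
  proof (rule tendsto_if_both_lower_bounds)
    fix e :: real assume e: "e > 0"
    have "eventually (\<lambda>N. freq (\<lambda>j. orbit_rem Q z (j - 1) \<in> {a<..<b}) N \<ge> b - a - e) sequentially"
      using ab e by (intro open_fiber_lower_frequency z) auto
    then show "eventually (\<lambda>N. freq (\<lambda>j. orbit_rem Q z (j - 1) \<in> {a..<b}) N \<ge> b - a - e) sequentially"
    proof eventually_elim
      case (elim N)
      have "freq (\<lambda>j. orbit_rem Q z (j - 1) \<in> {a<..<b}) N \<le> freq (\<lambda>j. orbit_rem Q z (j - 1) \<in> {a..<b}) N"
        by (rule freq_mono) auto
      then show ?case using elim by linarith
    qed
    have "eventually (\<lambda>N. freq (\<lambda>j. orbit_rem Q z (j - 1) \<in> {0<..<a}) N \<ge> a - 0 - e / 2) sequentially"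
      "eventually (\<lambda>N. freq (\<lambda>j. orbit_rem Q z (j - 1) \<in> {b<..<1}) N \<ge> 1 - b - e / 2) sequentially"
      using ab e by (intro open_fiber_lower_frequency z; simp)+
    then show "eventually (\<lambda>N. freq (\<lambda>j. orbit_rem Q z (j - 1) \<in> {a..<b}) N \<le> b - a + e) sequentially"
      using eventually_gt_at_top[of 0]
    proof eventually_elim
      case (elim N)
      let ?A = "\<lambda>i. if i = (0::nat) then {0<..<a} else if i = 1 then {b<..<1} else {a..<b}"
      have eq: "freq (\<lambda>j. \<exists>i\<in>{0, 1, 2}. orbit_rem Q z (j - 1) \<in> ?A i) N = (\<Sum>i\<in>{0, 1, 2}. freq (\<lambda>j. orbit_rem Q z (j - 1) \<in> ?A i) N)"
        by (rule freq_bex_disjoint) (use ab in \<open>auto split: if_splits\<close>)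
      have "(\<Sum>i\<in>{0, 1, 2}. freq (\<lambda>j. orbit_rem Q z (j - 1) \<in> ?A i) N) \<le> 1"
        unfolding eq[symmetric] by (rule freq_le_1)
      then show ?case using elim by simp
    qed
  qed
  then show ?thesis unfolding DN_Q_def ud_mod1_iff using z by auto
qed

section \<open>Averages of continuous functions under the skew product\<close>

lemma funpow_skew_product:
  assumes "0 \<le> z" "z < 1"
  shows "(skew_product T f ^^ n) (T x, z) = orbit_point z (Suc n)"
proof (induction n)
  case 0
  then show ?case using assms by (simp add: orbit_point_def orbit_rem_def frac_eq)
next
  case (Suc n)
  have "Q (Suc n) = f ((T ^^ Suc n) x)" by (rule Q_eq) simp
  then show ?case unfolding funpow.simps comp_def Suc by (simp add: skew_product_def orbit_point_def orbit_rem_Suc)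
qed

lemma skew_average_eq:
  assumes "0 \<le> z" "z < 1"
  shows "(\<Sum>n=1..N. F ((skew_product T f ^^ (n - 1)) (T x, z))) = (\<Sum>j=1..N. F (orbit_point z j))"
  by (rule sum.cong) (auto simp: funpow_skew_product[OF assms])

lemma cell_open_superlevel:
  fixes h :: "'a \<times> real \<Rightarrow> real"
  assumes "continuous_on phase_space h"
  shows "cell_open {p \<in> phase_space. h p > c}"
proof -
  obtain U where U: "open U" "U \<inter> phase_space = h -` {c<..} \<inter> phase_space"
    using assms unfolding continuous_on_open_invariant by (metis open_greaterThan)
  have "{p \<in> phase_space. h p > c} = U \<inter> phase_space" unfolding U by auto
  then show ?thesis using cell_open_if_relatively_open[OF U(1)] by simp
qed

lemma continuous_imp_measurable:
  fixes h :: "'a \<times> real \<Rightarrow> real"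
  assumes "continuous_on phase_space h"
  shows "h \<in> borel_measurable product_measure"
  using cell_open_lower_frequency(1)[OF cell_open_superlevel[OF assms]]
  by (intro borel_measurableI_greater) (simp add: space_product)

text \<open>Superlevel sets of a continuous function are cell-open, so each has a lower frequency
  bound; a staircase with more than \<open>2 / e\<close> steps transfers these bounds to the
  average.\<close>

lemma continuous_lower_average:
  fixes h :: "'a \<times> real \<Rightarrow> real"
  assumes z: "0 \<le> z" "z < 1" "cell_normal z"
    and h: "continuous_on phase_space h" "\<And>p. p \<in> phase_space \<Longrightarrow> 0 \<le> h p \<and> h p \<le> 1" and e: "e > 0"
  shows "eventually (\<lambda>N. (\<Sum>j=1..N. h (orbit_point z j)) / real N \<ge> (\<integral>v. h v \<partial>product_measure) - e) sequentially"
proof -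
  obtain m :: nat where m: "m > 2 / e" using reals_Archimedean2 by blast
  have "2 / e > 0" using e by simp
  then have m0: "m > 0" using m by (cases m) auto
  have me: "1 / real m \<le> e / 2" using m e m0 by (simp add: field_simps)
  define A where "A i = {p \<in> phase_space. h p > real i / real m}" for i :: nat
  have A: "cell_open (A i)" for i unfolding A_def by (rule cell_open_superlevel[OF h(1)])
  note Am = cell_open_lower_frequency(1)[OF A]
  have hm: "h \<in> borel_measurable product_measure" by (rule continuous_imp_measurable[OF h(1)])
  have "(\<integral>v. h v \<partial>product_measure) \<le> (\<integral>v. (\<Sum>i=1..m. indicat_real (A i) v) / m + 1 / m \<partial>product_measure)"
  proof (rule integral_mono)
    show "integrable product_measure h"
      using hm h(2) by (intro P.integrable_const_bound[of _ 1] AE_I2) (auto simp: space_product)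
    show "integrable product_measure (\<lambda>v. (\<Sum>i=1..m. indicat_real (A i) v) / m + 1 / m)"
      using Am by (intro Bochner_Integration.integrable_add integrable_divide_zero Bochner_Integration.integrable_sum integrable_real_indicator)
        (auto simp: P.emeasure_eq_measure)
    fix v assume v: "v \<in> space product_measure"
    have "m * h v \<le> (\<Sum>i=1..m. of_bool (h v > i / m)) + 1"
      using h(2)[of v] v m0 by (intro staircase_bounds) (auto simp: space_product)
    also have "(\<Sum>i=1..m. of_bool (h v > i / m) :: real) = (\<Sum>i=1..m. indicat_real (A i) v)"
      using v by (intro sum.cong) (auto simp: A_def space_product indicator_def)
    finally show "h v \<le> (\<Sum>i=1..m. indicat_real (A i) v) / m + 1 / m" using m0 by (simp add: field_simps)
  qed
  also have "\<dots> = (\<Sum>i=1..m. P.prob (A i)) / m + 1 / m"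
    using Am by (simp add: P.emeasure_eq_measure P.prob_space)
  finally have int: "(\<integral>v. h v \<partial>product_measure) \<le> (\<Sum>i=1..m. P.prob (A i)) / m + 1 / m" .
  have "eventually (\<lambda>N. \<forall>i\<in>{1..m}. freq (\<lambda>j. orbit_point z j \<in> A i) N \<ge> P.prob (A i) - e / 2) sequentially"
    using e by (intro eventually_ball_finite ballI cell_open_lower_frequency(2)[OF A z]) auto
  then show ?thesis
  proof eventually_elim
    case (elim N)
    have "(\<Sum>i=1..m. P.prob (A i)) - m * (e / 2) \<le> (\<Sum>i=1..m. freq (\<lambda>j. orbit_point z j \<in> A i) N)"
      using sum_mono[of "{1..m}" "\<lambda>i. P.prob (A i) - e / 2"] elim by (simp add: sum_subtractf)
    also have "\<dots> = (\<Sum>j=1..N. \<Sum>i=1..m. of_bool (orbit_point z j \<in> A i)) / N"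
      unfolding freq_eq_sum sum_divide_distrib[symmetric] by (subst sum.swap) simp
    also have "\<dots> \<le> (\<Sum>j=1..N. m * h (orbit_point z j)) / N"
    proof (intro divide_right_mono sum_mono)
      fix j
      have "(\<Sum>i=1..m. of_bool (orbit_point z j \<in> A i) :: real) = (\<Sum>i=1..m. of_bool (h (orbit_point z j) > i / m))"
        using orbit_point_in_phase_space by (intro sum.cong) (auto simp: A_def)
      also have "\<dots> \<le> m * h (orbit_point z j)"
        using h(2) orbit_point_in_phase_space m0 by (intro staircase_bounds) auto
      finally show "(\<Sum>i=1..m. of_bool (orbit_point z j \<in> A i) :: real) \<le> m * h (orbit_point z j)" .
    qed simp
    also have "\<dots> = m * ((\<Sum>j=1..N. h (orbit_point z j)) / N)" by (simp add: sum_distrib_left)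
    finally have "((\<Sum>i=1..m. P.prob (A i)) - m * (e / 2)) / m \<le> m * ((\<Sum>j=1..N. h (orbit_point z j)) / N) / m"
      by (rule divide_right_mono) simp
    then have "(\<Sum>i=1..m. P.prob (A i)) / m - e / 2 \<le> (\<Sum>j=1..N. h (orbit_point z j)) / N"
      using m0 by (simp add: diff_divide_distrib)
    then show ?case using int me by linarith
  qed
qed

text \<open>The lower estimate is applied to \<open>h\<close> and to \<open>- h\<close>, rescaled to
  values in \<open>[0, 1]\<close>, and gives both sides of the limit.\<close>

lemma continuous_average:
  fixes h :: "'a \<times> real \<Rightarrow> real"
  assumes z: "0 \<le> z" "z < 1" "cell_normal z"
    and h: "continuous_on phase_space h" "\<And>p. p \<in> phase_space \<Longrightarrow> \<bar>h p\<bar> \<le> K"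
  shows "integrable product_measure h"
    "(\<lambda>N. (\<Sum>j=1..N. h (orbit_point z j)) / real N) \<longlonglongrightarrow> (\<integral>v. h v \<partial>product_measure)"
proof -
  have hm: "h \<in> borel_measurable product_measure" by (rule continuous_imp_measurable[OF h(1)])
  show int: "integrable product_measure h"
    using hm h(2) by (intro P.integrable_const_bound[of _ K] AE_I2) (auto simp: space_product)
  define C where "C = \<bar>K\<bar> + 1"
  have C: "C > 0" "\<bar>h p\<bar> \<le> C" if "p \<in> phase_space" for p using h(2)[OF that] by (auto simp: C_def)
  have C0: "C > 0" by (simp add: C_def)
  have lower: "eventually (\<lambda>N. (\<Sum>j=1..N. s * h (orbit_point z j)) / real N \<ge> s * (\<integral>v. h v \<partial>product_measure) - e) sequentially"
    if s: "s = 1 \<or> s = -1" and e: "e > 0" for s e :: real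
  proof -
    let ?k = "\<lambda>p. (s * h p + C) / (2 * C)"
    have "continuous_on phase_space ?k" using C0 by (intro continuous_intros h(1)) auto
    moreover have "0 \<le> ?k p \<and> ?k p \<le> 1" if "p \<in> phase_space" for p
      using C(2)[OF that] C0 s by (auto simp: field_simps abs_le_iff)
    ultimately have ev: "eventually (\<lambda>N. (\<Sum>j=1..N. ?k (orbit_point z j)) / real N \<ge> (\<integral>v. ?k v \<partial>product_measure) - e / (2 * C)) sequentially"
      using C0 e by (intro continuous_lower_average z) auto
    have int_k: "(\<integral>v. ?k v \<partial>product_measure) = (s * (\<integral>v. h v \<partial>product_measure) + C) / (2 * C)"
      using int by (simp add: P.prob_space)
    show ?thesis using ev eventually_gt_at_top[of 0]
    proof eventually_elim
      case (elim N)
      have "(\<Sum>j=1..N. ?k (orbit_point z j)) / real N = ((\<Sum>j=1..N. s * h (orbit_point z j)) / N + C) / (2 * C)"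
        using elim(2) by (simp add: sum_divide_distrib[symmetric] sum.distrib add_divide_distrib)
      then have "(s * (\<integral>v. h v \<partial>product_measure) + C - e) / (2 * C) \<le> ((\<Sum>j=1..N. s * h (orbit_point z j)) / N + C) / (2 * C)"
        using elim(1) unfolding int_k by (simp add: diff_divide_distrib)
      then show ?case using C0 by (simp add: divide_le_cancel)
    qed
  qed
  show "(\<lambda>N. (\<Sum>j=1..N. h (orbit_point z j)) / real N) \<longlonglongrightarrow> (\<integral>v. h v \<partial>product_measure)"
  proof (rule tendsto_if_both_lower_bounds)
    fix e :: real assume e: "e > 0"
    show "eventually (\<lambda>N. (\<Sum>j=1..N. h (orbit_point z j)) / real N \<ge> (\<integral>v. h v \<partial>product_measure) - e) sequentially"
      using lower[of 1, OF _ e] by simp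
    show "eventually (\<lambda>N. (\<Sum>j=1..N. h (orbit_point z j)) / real N \<le> (\<integral>v. h v \<partial>product_measure) + e) sequentially"
      using lower[of "-1", OF _ e] by (simp add: sum_negf) (auto elim: eventually_mono)
  qed
qed

lemma UDN_Q_if_cell_normal:
  assumes z: "0 \<le> z" "z < 1" "cell_normal z"
  shows "z \<in> UDN_Q M T f x"
proof -
  have "(\<lambda>N. (\<Sum>n=1..N. F ((skew_product T f ^^ (n - 1)) (T x, z))) / of_nat N) \<longlonglongrightarrow> (\<integral>v. F v \<partial>product_measure)"
    if F: "continuous_on phase_space F" "bounded (F ` phase_space)" for F :: "'a \<times> real \<Rightarrow> complex"
  proof -
    obtain K where "\<forall>w\<in>F ` phase_space. norm w \<le> K" using F(2) unfolding bounded_iff by blast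
    then have K: "norm (F p) \<le> K" if "p \<in> phase_space" for p using that by blast
    have re: "continuous_on phase_space (\<lambda>p. Re (F p))" "\<And>p. p \<in> phase_space \<Longrightarrow> \<bar>Re (F p)\<bar> \<le> K"
      using K abs_Re_le_cmod order_trans by (blast intro: continuous_on_Re F(1))+
    have im: "continuous_on phase_space (\<lambda>p. Im (F p))" "\<And>p. p \<in> phase_space \<Longrightarrow> \<bar>Im (F p)\<bar> \<le> K"
      using K abs_Im_le_cmod order_trans by (blast intro: continuous_on_Im F(1))+
    have int: "complex_integrable product_measure F"
    proof -
      have "complex_integrable product_measure (\<lambda>p. complex_of_real (Re (F p)) + \<i> * complex_of_real (Im (F p)))"
        using continuous_average(1)[OF z re] continuous_average(1)[OF z im]
        by (intro Bochner_Integration.integrable_add integrable_mult_right integrable_of_real)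
      then show ?thesis by (simp add: complex_eq[symmetric])
    qed
    show ?thesis
      unfolding skew_average_eq[OF z(1,2)] tendsto_complex_iff
      using continuous_average(2)[OF z re] continuous_average(2)[OF z im]
      by (simp add: Re_divide_of_nat Im_divide_of_nat integral_Re[OF int, symmetric] integral_Im[OF int, symmetric])
  qed
  then show ?thesis unfolding UDN_Q_def using z by auto
qed

text \<open>The indicator of a cell is in general discontinuous at the endpoints of its interval, so
  a continuous function below it yields a lower bound only. The cells over \<open>B\<close>
  partition the occurrences of \<open>B\<close>, whose frequency is known, and this turns the lower
  bounds into limits.\<close>

lemma cell_normal_if_UDN_Q:
  assumes U: "z \<in> UDN_Q M T f x"
  shows "cell_normal z"
  unfolding cell_normal_def
proof (intro allI impI)
  have z: "0 \<le> z" "z < 1" using U unfolding UDN_Q_def by auto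
  fix B d assume Bd: "B \<noteq> [] \<and> d \<in> digit_box B"
  let ?p = "prob {u. block (length B) u = B}"
  let ?X = "\<lambda>D. freq (\<lambda>j. symbol_block (length B) j = B \<and> digit_block z (length B) j = D)"
  have P: "prod_list B > 0" using card_digit_box[of B] Bd card_gt_0_iff[of "digit_box B"] by auto
  show "?X d \<longlonglongrightarrow> ?p / real (prod_list B)"
  proof (rule tendsto_if_lower_bounds[where I = "digit_box B" and X = ?X])
    have "(\<Sum>D\<in>digit_box B. ?X D N) = freq (\<lambda>j. symbol_block (length B) j = B) N" for N
    proof -
      have "(\<Sum>D\<in>digit_box B. ?X D N) = freq (\<lambda>j. \<exists>D\<in>digit_box B. symbol_block (length B) j = B \<and> digit_block z (length B) j = D) N"
        by (rule freq_bex_disjoint[symmetric]) auto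
      also have "\<dots> = freq (\<lambda>j. symbol_block (length B) j = B) N"
      proof (rule freq_cong)
        fix j :: nat assume "j \<ge> 1"
        then show "(\<exists>D\<in>digit_box B. symbol_block (length B) j = B \<and> digit_block z (length B) j = D) \<longleftrightarrow> symbol_block (length B) j = B"
          using digit_block_less[OF z, of j "length B"] by auto
      qed
      finally show ?thesis .
    qed
    moreover have "(\<Sum>D\<in>digit_box B. ?p / real (prod_list B)) = ?p" using P by (simp add: card_digit_box)
    ultimately show "(\<lambda>N. \<Sum>D\<in>digit_box B. ?X D N) \<longlonglongrightarrow> (\<Sum>D\<in>digit_box B. ?p / real (prod_list B))"
      using block_frequency[of "\<lambda>B'. B' = B" "length B"] by simp
    fix D and e :: real assume D: "D \<in> digit_box B" and e: "e > 0"
    define a where "a = real (block_value B D) / real (prod_list B)"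
    define b where "b = (real (block_value B D) + 1) / real (prod_list B)"
    have ba: "b - a = 1 / real (prod_list B)" unfolding a_def b_def by (simp add: diff_divide_distrib[symmetric])
    have I: "cell_interval B D = {a..<b}" by (simp add: cell_interval_def a_def b_def)
    have P1: "1 / real (prod_list B) > 0" using P by simp
    have ab: "0 \<le> a" "a < b" "b \<le> 1"
    proof -
      show "0 \<le> a" by (simp add: a_def)
      show "a < b" using ba P1 by linarith
      have "real (block_value B D) + 1 \<le> real (prod_list B)" using block_value_less[of D B] D by simp
      then show "b \<le> 1" using P by (simp add: b_def divide_le_eq_1)
    qed
    \<comment> \<open>Cutting \<open>\<delta>\<close> off both ends loses at most
      \<open>2 * \<delta> \<le> e / 2\<close>; the second bound keeps the inner endpoints in
      order.\<close>
    define \<delta> where "\<delta> = min (e / 4) ((b - a) / 2)"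
    have "\<delta> \<le> e / 4" "\<delta> \<le> (b - a) / 2" unfolding \<delta>_def by (rule min.cobounded1, rule min.cobounded2)
    then have \<delta>: "\<delta> > 0" "2 * \<delta> \<le> b - a" "2 * \<delta> \<le> e / 2" using ab e by (auto simp: \<delta>_def)
    \<comment> \<open>A trapezoid: 0 outside \<open>[a, b]\<close>, with slopes
      \<open>1 / \<delta>\<close> at both ends and value 1 on the inner interval.\<close>
    define \<phi> where "\<phi> r = max 0 (min 1 (min (r - a) (b - r) / \<delta>))" for r
    have \<phi>: "0 \<le> \<phi> r" "\<phi> r \<le> of_bool (r \<in> {a..<b})" "of_bool (r \<in> {a + \<delta><..<b - \<delta>}) \<le> \<phi> r" for r
    proof -
      show "0 \<le> \<phi> r" by (simp add: \<phi>_def)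
      have "min (r - a) (b - r) / \<delta> \<le> 0" if "r \<notin> {a..<b}"
        using that \<delta>(1) by (intro divide_nonpos_pos) auto
      then show "\<phi> r \<le> of_bool (r \<in> {a..<b})" unfolding \<phi>_def by auto
      have "1 \<le> min (r - a) (b - r) / \<delta>" if "r \<in> {a + \<delta><..<b - \<delta>}"
        using that \<delta>(1) by (simp add: le_divide_eq)
      then show "of_bool (r \<in> {a + \<delta><..<b - \<delta>}) \<le> \<phi> r" unfolding \<phi>_def by auto
    qed
    define h where "h p = of_bool (block (length B) (fst p) = B) * \<phi> (snd p)" for p :: "'a \<times> real"
    have h_cont: "continuous_on phase_space h"
    proof -
      have "continuous_on UNIV (\<lambda>u. of_bool (block (length B) u = B) :: real)"
        by (rule continuous_of_open_levels) (rule open_block)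
      then have "continuous_on phase_space (\<lambda>p. of_bool (block (length B) (fst p) = B) :: real)"
        using continuous_on_compose2[OF _ continuous_on_fst[OF continuous_on_id]] by blast
      then show ?thesis unfolding h_def \<phi>_def using \<delta>(1) by (intro continuous_intros) auto
    qed
    have h01: "0 \<le> h p" "h p \<le> 1" for p
      using \<phi>(1,2)[of "snd p"] unfolding h_def by (auto simp: of_bool_def split: if_splits)
    let ?F = "\<lambda>p. complex_of_real (h p)"
    have "bounded (?F ` phase_space)" unfolding bounded_iff using h01 by (intro exI[of _ 1]) auto
    moreover have "continuous_on phase_space ?F" using h_cont by (intro continuous_intros)
    ultimately have "(\<lambda>N. (\<Sum>n=1..N. ?F ((skew_product T f ^^ (n - 1)) (T x, z))) / of_nat N) \<longlonglongrightarrow> (\<integral>v. ?F v \<partial>product_measure)"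
      using U unfolding UDN_Q_def by blast
    then have "(\<lambda>N. complex_of_real ((\<Sum>j=1..N. h (orbit_point z j)) / real N)) \<longlonglongrightarrow> complex_of_real (\<integral>v. h v \<partial>product_measure)"
      unfolding skew_average_eq[OF z, of "\<lambda>p. complex_of_real (h p)"] by simp
    then have lim: "(\<lambda>N. (\<Sum>j=1..N. h (orbit_point z j)) / real N) \<longlonglongrightarrow> (\<integral>v. h v \<partial>product_measure)"
      by (simp only: tendsto_of_real_iff)
    let ?A = "{u. block (length B) u = B} \<times> {a + \<delta><..<b - \<delta>}"
    have Im: "{a + \<delta><..<b - \<delta>} \<in> sets lebesgue01" using ab \<delta>(1) by (intro sets_lebesgue01_interval) auto
    have Am: "?A \<in> sets product_measure" by (intro pair_measureI sets_block Im)
    have "?p / real (prod_list B) - e / 2 \<le> ?p * (b - a - 2 * \<delta>)"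
    proof -
      have "?p * (2 * \<delta>) \<le> 1 * (e / 2)" using \<delta> by (intro mult_mono) auto
      then show ?thesis using ba by (simp add: right_diff_distrib)
    qed
    also have "\<dots> = P.prob ?A"
      using measure_lebesgue01_interval(2)[of "a + \<delta>" "b - \<delta>"] ab \<delta>
      by (subst measure_product_Times[OF sets_block Im]) simp
    also have "\<dots> = (\<integral>v. indicat_real ?A v \<partial>product_measure)" using Am by simp
    also have "\<dots> \<le> (\<integral>v. h v \<partial>product_measure)"
    proof (rule integral_mono)
      show "integrable product_measure (indicat_real ?A)" using Am by (simp add: P.emeasure_eq_measure)
      show "integrable product_measure h"
        using continuous_imp_measurable[OF h_cont] h01 by (intro P.integrable_const_bound[of _ 1] AE_I2) auto
      show "indicat_real ?A v \<le> h v" for v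
        using \<phi>(1,3)[of "snd v"] by (cases v) (auto simp: indicator_def h_def)
    qed
    finally have "?p / real (prod_list B) - e < (\<integral>v. h v \<partial>product_measure)" using e by linarith
    with lim have "eventually (\<lambda>N. (\<Sum>j=1..N. h (orbit_point z j)) / real N > ?p / real (prod_list B) - e) sequentially"
      by (rule order_tendstoD)
    then show "eventually (\<lambda>N. ?X D N \<ge> ?p / real (prod_list B) - e) sequentially"
    proof eventually_elim
      case (elim N)
      have "(\<Sum>j=1..N. h (orbit_point z j)) / real N \<le> ?X D N"
        unfolding freq_eq_sum
      proof (intro divide_right_mono sum_mono)
        fix j assume "j \<in> {1..N}"
        then have j: "j \<ge> 1" by simp
        show "h (orbit_point z j) \<le> of_bool (symbol_block (length B) j = B \<and> digit_block z (length B) j = D)"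
        proof (cases "symbol_block (length B) j = B")
          case True
          then have "digit_block z (length B) j = D \<longleftrightarrow> orbit_rem Q z (j - 1) \<in> {a..<b}"
            using digit_block_iff[OF z j, of D "length B"] D unfolding I[symmetric] by simp
          then show ?thesis using True \<phi>(2)[of "orbit_rem Q z (j - 1)"] by (simp add: h_def orbit_point_def)
        qed (simp add: h_def orbit_point_def)
      qed simp
      then show ?case using elim by linarith
    qed
  qed (use Bd in auto)
qed

end

section \<open>Normality in base g\<close>

lemma floor_in_unit_shift:
  fixes y :: real
  assumes "real t + a < y" "y < real t + b" "0 \<le> a" "b \<le> 1"
  shows "nat \<lfloor>y\<rfloor> = t" "frac y \<in> {a<..<b}"
proof -
  have "\<lfloor>y\<rfloor> = int t" using assms by (simp add: floor_eq_iff)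
  then show "nat \<lfloor>y\<rfloor> = t" "frac y \<in> {a<..<b}" using assms by (auto simp: frac_def)
qed

context generated_power_sequence
begin

text \<open>For \<open>0 \<le> a\<close> and \<open>b \<le> 1\<close> these are the remainders whose
  multiple by \<open>g ^ i\<close> has integer part \<open>t\<close> and fractional part in
  \<open>(a, b)\<close>.\<close>

definition subcell_interval :: "nat \<Rightarrow> nat \<Rightarrow> real \<Rightarrow> real \<Rightarrow> real set" where
  "subcell_interval i t a b = {(real t + a) / real (g ^ i)<..<(real t + b) / real (g ^ i)}"

lemma subcell_interval_iff:
  "r \<in> subcell_interval i t a b \<longleftrightarrow> real t + a < real (g ^ i) * r \<and> real (g ^ i) * r < real t + b"
proof -
  have "real (g ^ i) > 0" using g by simp
  then show ?thesis unfolding subcell_interval_def by (auto simp: field_simps simp del: of_nat_power)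
qed

lemma subcell_lower_frequency:
  assumes z: "0 \<le> z" "z < 1" "cell_normal z" and ab: "0 \<le> a" "a \<le> b" "b \<le> 1" and t: "t < g ^ i" and e: "e > 0"
  shows "eventually (\<lambda>N. freq (\<lambda>j. expo ((T ^^ j) x) > i \<and> orbit_rem Q z (j - 1) \<in> subcell_interval i t a b) N
    \<ge> prob {u. expo u > i} * (b - a) / real (g ^ i) - e) sequentially"
proof -
  have gi: "real (g ^ i) > 0" using g by simp
  let ?I = "subcell_interval i t a b"
  have tg: "real t + 1 \<le> real (g ^ i)" using t by linarith
  have I: "?I \<subseteq> {0..<1}"
  proof
    fix r assume r: "r \<in> ?I"
    then have "0 < real (g ^ i) * r" "real (g ^ i) * r < real (g ^ i) * 1"
      using ab tg unfolding subcell_interval_iff by linarith+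
    then show "r \<in> {0..<1}" using gi by (auto simp only: zero_less_mult_iff mult_less_cancel_left_pos atLeastLessThan_iff)
  qed
  have eq: "{u. expo u > i} \<times> ?I = ({u. expo u > i} \<times> ?I) \<inter> phase_space" using I by auto
  have op: "cell_open ({u. expo u > i} \<times> ?I)"
    by (subst eq, rule cell_open_if_relatively_open)
      (intro open_Times open_expo, simp add: subcell_interval_def)
  have Im: "?I \<in> sets lebesgue01" using I unfolding subcell_interval_def by (rule sets_lebesgue01_interval)
  have em: "{u. expo u > i} \<in> sets M" using open_expo unfolding sets_M by (rule borel_open)
  have "measure lebesgue01 ?I = (real t + b) / real (g ^ i) - (real t + a) / real (g ^ i)"
    unfolding subcell_interval_def
    using ab gi tg by (intro measure_lebesgue01_interval) (auto simp: divide_right_mono simp del: of_nat_power)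
  also have "\<dots> = (b - a) / real (g ^ i)" by (simp add: diff_divide_distrib[symmetric])
  finally have "P.prob ({u. expo u > i} \<times> ?I) = prob {u. expo u > i} * (b - a) / real (g ^ i)"
    by (subst measure_product_Times[OF em Im]) simp
  then show ?thesis
    using cell_open_lower_frequency(2)[OF op z e] by (simp add: orbit_point_def)
qed

text \<open>Tail formula for the mean: \<open>min n R\<close> counts the \<open>i < R\<close> with
  \<open>i < n\<close>, so the sum of the tails is the mean of the truncated exponent, which
  converges by domination.\<close>

lemma truncated_mean_expo: "(\<lambda>R. \<Sum>i<R. prob {u. expo u > i}) \<longlonglongrightarrow> mean_expo"
proof -
  have em: "{u. expo u > i} \<in> sets M" for i using open_expo unfolding sets_M by (rule borel_open)
  have eq: "(\<Sum>i<R. prob {u. expo u > i}) = (\<integral>u. real (min (expo u) R) \<partial>M)" for R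
  proof -
    have "real (min n R) = (\<Sum>i<R. of_bool (n > i))" for n :: nat
    proof -
      have "{..<R} \<inter> {i. i < n} = {..<min n R}" by auto
      then show ?thesis by (simp add: of_bool_def sum.If_cases)
    qed
    then have "(\<integral>u. real (min (expo u) R) \<partial>M) = (\<integral>u. (\<Sum>i<R. indicat_real {u. expo u > i} u) \<partial>M)"
      by (simp add: indicator_def of_bool_def)
    also have "\<dots> = (\<Sum>i<R. prob {u. expo u > i})"
      using em by (subst Bochner_Integration.integral_sum) (auto simp: emeasure_eq_measure)
    finally show ?thesis by simp
  qed
  show ?thesis
    unfolding eq mean_expo_def
  proof (rule integral_dominated_convergence[OF _ _ integrable_expo])
    show "AE u in M. (\<lambda>R. real (min (expo u) R)) \<longlonglongrightarrow> real (expo u)"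
    proof (intro AE_I2 tendsto_eventually)
      fix u show "eventually (\<lambda>R. real (min (expo u) R) = real (expo u)) sequentially"
        using eventually_ge_at_top[of "expo u"] by eventually_elim simp
    qed
  qed auto
qed

lemma orbit_rem_offset:
  "orbit_rem (\<lambda>_. g) z (digit_position n + i) = frac (real (g ^ i) * orbit_rem Q z n)"
proof -
  have "frac (real (g ^ i) * frac (real (g ^ digit_position n) * z)) = frac (real (g ^ i) * (real (g ^ digit_position n) * z))"
    by (rule frac_nat_mult_frac)
  then show ?thesis unfolding orbit_rem_eq constant_orbit_rem by (simp add: power_add mult_ac)
qed

text \<open>
  The digit position \<open>digit_position (j - 1) + i\<close> with \<open>i < expo ((T ^^ j) x)\<close> visits \<open>{a<..<b}\<close> iff
  the orbit point at \<open>j\<close> lies in \<open>subcell_interval i t a b\<close> for some \<open>t < g ^ i\<close>. Truncating at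
  \<open>i < R\<close> loses only an upper bound, and lower bounds suffice as the frequencies add up to \<open>1\<close>.
\<close>

lemma sum_subcell_counts_le:
  assumes "0 \<le> a" "b \<le> 1"
  shows "(\<Sum>i<R. \<Sum>t<g ^ i. card {j \<in> {1..N}. expo ((T ^^ j) x) > i \<and> orbit_rem Q z (j - 1) \<in> subcell_interval i t a b})
    \<le> card {i \<in> {1..digit_position N}. orbit_rem (\<lambda>_. g) z (i - 1) \<in> {a<..<b}}"
proof -
  let ?C = "\<lambda>i t. {j \<in> {1..N}. expo ((T ^^ j) x) > i \<and> orbit_rem Q z (j - 1) \<in> subcell_interval i t a b}"
  let ?S = "SIGMA p:(SIGMA i:{..<R}. {..<g ^ i}). ?C (fst p) (snd p)"
  let ?\<phi> = "\<lambda>q. Suc (digit_position (snd q - 1) + fst (fst q))"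
  have pos: "digit_position (j - 1) + i < digit_position j" if "j \<ge> 1" "i < expo ((T ^^ j) x)" for i j
    using that digit_position_Suc[of "j - 1"] by simp
  have card: "(\<Sum>i<R. \<Sum>t<g ^ i. card (?C i t)) = card ?S"
    by (simp add: card_SigmaI sum.Sigma case_prod_unfold)
  have "card ?S \<le> card {i \<in> {1..digit_position N}. orbit_rem (\<lambda>_. g) z (i - 1) \<in> {a<..<b}}"
  proof (rule card_inj_on_le[where f = ?\<phi>])
    \<comment> \<open>Digit positions belonging to different \<open>j\<close> lie in disjoint
      ranges, which separates \<open>j\<close>; the offset then separates \<open>i\<close>, and the
      integer part of the shifted remainder separates \<open>t\<close>.\<close>
    show "inj_on ?\<phi> ?S"
    proof (rule inj_onI)
      fix q q' assume q: "q \<in> ?S" and q': "q' \<in> ?S" and eq: "?\<phi> q = ?\<phi> q'"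
      obtain i t j where qd: "q = ((i, t), j)" by (cases q) auto
      obtain i' t' j' where qd': "q' = ((i', t'), j')" by (cases q') auto
      have j: "j \<ge> 1" "i < expo ((T ^^ j) x)" "orbit_rem Q z (j - 1) \<in> subcell_interval i t a b"
        and j': "j' \<ge> 1" "i' < expo ((T ^^ j') x)" "orbit_rem Q z (j' - 1) \<in> subcell_interval i' t' a b"
        using q q' unfolding qd qd' by auto
      have no: "\<not> m < n" if "m \<ge> 1" "i < expo ((T ^^ m) x)" "digit_position (m - 1) + i = digit_position (n - 1) + i'" for m n i i'
      proof
        assume "m < n"
        then have "digit_position m \<le> digit_position (n - 1)" by (simp add: strict_mono_less_eq[OF strict_mono_digit_position])
        then show False using pos[OF that(1,2)] that(3) by linarith
      qed
      have e: "digit_position (j - 1) + i = digit_position (j' - 1) + i'" using eq unfolding qd qd' by simp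
      have "j = j'" using no[OF j(1,2) e] no[OF j'(1,2) e[symmetric]] by simp
      moreover from this have "i = i'" using e by simp
      moreover have "t = t'"
        using j(3) j'(3) floor_in_unit_shift(1)[OF _ _ assms] unfolding \<open>j = j'\<close> \<open>i = i'\<close> subcell_interval_iff by metis
      ultimately show "q = q'" unfolding qd qd' by simp
    qed
    show "?\<phi> ` ?S \<subseteq> {i \<in> {1..digit_position N}. orbit_rem (\<lambda>_. g) z (i - 1) \<in> {a<..<b}}"
    proof (rule image_subsetI)
      fix q assume q: "q \<in> ?S"
      obtain i t j where qd: "q = ((i, t), j)" by (cases q) auto
      have j: "j \<in> {1..N}" "i < expo ((T ^^ j) x)" "orbit_rem Q z (j - 1) \<in> subcell_interval i t a b"
        using q unfolding qd by auto
      have "digit_position (j - 1) + i < digit_position j" using j by (intro pos) auto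
      also have "digit_position j \<le> digit_position N" using j(1) by (simp add: strict_mono_less_eq[OF strict_mono_digit_position])
      finally have "Suc (digit_position (j - 1) + i) \<in> {1..digit_position N}" by simp
      moreover have "frac (real (g ^ i) * orbit_rem Q z (j - 1)) \<in> {a<..<b}"
        using j(3) floor_in_unit_shift(2)[OF _ _ assms] unfolding subcell_interval_iff by blast
      ultimately show "?\<phi> q \<in> {i \<in> {1..digit_position N}. orbit_rem (\<lambda>_. g) z (i - 1) \<in> {a<..<b}}"
        unfolding qd by (simp add: orbit_rem_offset del: of_nat_power)
    qed
  qed simp
  then show ?thesis unfolding card .
qed

section \<open>From counts along the symbols to frequencies along base \<open>g\<close>
  digits\<close>

lemma digit_position_bracket: "\<exists>N. digit_position N \<le> n \<and> n < digit_position (Suc N)"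
proof -
  define N where "N = (LEAST N. n < digit_position (Suc N))"
  have ex: "n < digit_position (Suc n)"
    using strict_mono_imp_increasing[OF strict_mono_digit_position, of "Suc n"] by linarith
  have "n < digit_position (Suc N)" unfolding N_def by (rule LeastI[of "\<lambda>N. n < digit_position (Suc N)" n, OF ex])
  moreover have "digit_position N \<le> n"
  proof (cases N)
    case (Suc m)
    then have "\<not> n < digit_position (Suc m)" using not_less_Least[of m "\<lambda>N. n < digit_position (Suc N)"] by (simp add: N_def)
    then show ?thesis using Suc by simp
  qed simp
  ultimately show ?thesis by blast
qed

text \<open>A length \<open>n\<close> is bracketed by consecutive digit positions. The hits up to
  \<open>n\<close> include those found along the first \<open>N\<close> symbols, while
  \<open>n\<close> is below \<open>digit_position (Suc N)\<close>. The ratio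
  \<open>N / digit_position (Suc N)\<close> tends to \<open>1 / mean_expo\<close>, which cancels the
  factor \<open>mean_expo\<close> from summing the tails.\<close>

lemma base_lower_frequency:
  assumes z: "0 \<le> z" "z < 1" "cell_normal z" and ab: "0 \<le> a" "a \<le> b" "b \<le> 1" and e: "e > 0"
  shows "eventually (\<lambda>n. freq (\<lambda>i. orbit_rem (\<lambda>_. g) z (i - 1) \<in> {a<..<b}) n \<ge> (b - a) - e) sequentially"
proof -
  \<comment> \<open>Truncating the mean and the frequency errors cost at most
    \<open>\<delta>\<close> each after division by \<open>mean_expo \<ge> 1\<close>; the last third
    keeps the inequality strict.\<close>
  define \<delta> where "\<delta> = e / 3"
  have \<delta>: "\<delta> > 0" using e by (simp add: \<delta>_def)
  have "eventually (\<lambda>R. (\<Sum>i<R. prob {u. expo u > i}) > mean_expo - \<delta>) sequentially"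
    using truncated_mean_expo by (rule order_tendstoD) (use \<delta> in simp)
  then have "\<exists>R. (\<Sum>i<R. prob {u. expo u > i}) > mean_expo - \<delta>" by (rule eventually_happens'[OF sequentially_bot])
  then obtain R where R: "(\<Sum>i<R. prob {u. expo u > i}) > mean_expo - \<delta>" by (rule exE)
  let ?C = "\<lambda>i t j. expo ((T ^^ j) x) > i \<and> orbit_rem Q z (j - 1) \<in> subcell_interval i t a b"
  define s where "s N = (\<Sum>i<R. \<Sum>t<g ^ i. freq (?C i t) N)" for N
  \<comment> \<open>One more than the number of pairs \<open>(i, t)\<close>, so that errors of
    \<open>\<delta> / K\<close> add up to at most \<open>\<delta>\<close>.\<close>
  define K where "K = real (\<Sum>i<R. g ^ i) + 1"
  have K: "K > 0" unfolding K_def by linarith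
  have "eventually (\<lambda>N. \<forall>i\<in>{..<R}. \<forall>t\<in>{..<g ^ i}. freq (?C i t) N \<ge> prob {u. expo u > i} * (b - a) / real (g ^ i) - \<delta> / K) sequentially"
    using \<delta> K by (intro eventually_ball_finite ballI subcell_lower_frequency z ab) auto
  then have s: "eventually (\<lambda>N. s N \<ge> (mean_expo - \<delta>) * (b - a) - \<delta>) sequentially"
  proof eventually_elim
    case (elim N)
    have "(mean_expo - \<delta>) * (b - a) \<le> (\<Sum>i<R. prob {u. expo u > i}) * (b - a)"
      using R ab by (intro mult_right_mono) auto
    moreover have "(\<Sum>i<R. g ^ i) * (\<delta> / K) \<le> \<delta>"
    proof -
      have "real (\<Sum>i<R. g ^ i) * (\<delta> / K) \<le> K * (\<delta> / K)" using K \<delta> by (intro mult_right_mono) (auto simp: K_def)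
      then show ?thesis using K by simp
    qed
    ultimately have "(mean_expo - \<delta>) * (b - a) - \<delta> \<le> (\<Sum>i<R. prob {u. expo u > i} * (b - a)) - (\<Sum>i<R. g ^ i) * (\<delta> / K)"
      by (simp add: sum_distrib_right)
    also have "\<dots> = (\<Sum>i<R. \<Sum>t<g ^ i. prob {u. expo u > i} * (b - a) / real (g ^ i) - \<delta> / K)"
    proof -
      have "(\<Sum>t<g ^ i. prob {u. expo u > i} * (b - a) / real (g ^ i) - \<delta> / K) = prob {u. expo u > i} * (b - a) - real (g ^ i) * (\<delta> / K)" for i
      proof -
        have "g > 0" using g by simp
        then show ?thesis by (simp add: field_simps)
      qed
      then show ?thesis by (simp only: sum_subtractf sum_distrib_right of_nat_sum)
    qed
    also have "\<dots> \<le> s N" unfolding s_def using elim by (intro sum_mono) auto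
    finally show ?case .
  qed
  have w: "(\<lambda>N. real N / real (digit_position (Suc N))) \<longlonglongrightarrow> 1 / mean_expo"
  proof -
    have "(\<lambda>N. real (digit_position (Suc N)) / real (Suc N)) \<longlonglongrightarrow> mean_expo"
      using digit_position_average by (rule LIMSEQ_Suc)
    then have "(\<lambda>N. (real N / real (Suc N)) / (real (digit_position (Suc N)) / real (Suc N))) \<longlonglongrightarrow> 1 / mean_expo"
      using mean_expo_ge_1 by (intro tendsto_divide LIMSEQ_n_over_Suc_n) auto
    then show ?thesis by simp
  qed
  have "((mean_expo - \<delta>) * (b - a) - \<delta>) * (1 / mean_expo) > (b - a) - e"
  proof -
    have m: "mean_expo > 0" "1 / mean_expo \<le> 1" using mean_expo_ge_1 by auto
    have "((mean_expo - \<delta>) * (b - a) - \<delta>) * (1 / mean_expo) = (b - a) - \<delta> * ((b - a) * (1 / mean_expo)) - \<delta> * (1 / mean_expo)"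
      using m(1) by (simp add: field_simps)
    moreover have "\<delta> * ((b - a) * (1 / mean_expo)) \<le> \<delta> * (1 * 1)"
      using m ab \<delta> by (intro mult_left_mono mult_mono) auto
    moreover have "\<delta> * (1 / mean_expo) \<le> \<delta> * 1" using m \<delta> by (intro mult_left_mono) auto
    ultimately show ?thesis using \<delta> by (simp add: \<delta>_def)
  qed
  with tendsto_mult[OF tendsto_const w, of "(mean_expo - \<delta>) * (b - a) - \<delta>"]
  have "eventually (\<lambda>N. ((mean_expo - \<delta>) * (b - a) - \<delta>) * (real N / real (digit_position (Suc N))) > (b - a) - e) sequentially"
    by (rule order_tendstoD)
  with s have "eventually (\<lambda>N. s N * (real N / real (digit_position (Suc N))) > (b - a) - e) sequentially"
  proof eventually_elim
    case (elim N)
    have "((mean_expo - \<delta>) * (b - a) - \<delta>) * (real N / real (digit_position (Suc N))) \<le> s N * (real N / real (digit_position (Suc N)))"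
      using elim(1) by (intro mult_right_mono) auto
    then show ?case using elim(2) by linarith
  qed
  then obtain N0 where N0: "\<And>N. N \<ge> N0 \<Longrightarrow> s N * (real N / real (digit_position (Suc N))) > (b - a) - e"
    unfolding eventually_sequentially by blast
  show ?thesis
    using eventually_ge_at_top[of "max 1 (digit_position N0)"]
  proof eventually_elim
    case (elim n)
    let ?A = "\<lambda>i. orbit_rem (\<lambda>_. g) z (i - 1) \<in> {a<..<b}"
    obtain N where N: "digit_position N \<le> n" "n < digit_position (Suc N)" using digit_position_bracket by blast
    have "digit_position N0 < digit_position (Suc N)" using elim N by linarith
    then have "N0 \<le> N" using strict_mono_less[OF strict_mono_digit_position] by simp
    have "s N * real N \<le> real (card {i \<in> {1..n}. ?A i})"
    proof -
      have "s N * real N = real (\<Sum>i<R. \<Sum>t<g ^ i. card {j \<in> {1..N}. ?C i t j})"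
        unfolding s_def freq_def by (cases "N = 0") (simp_all add: sum_distrib_right)
      also have "\<dots> \<le> real (card {i \<in> {1..digit_position N}. ?A i})"
        using sum_subcell_counts_le[OF ab(1,3), of N z R] by (intro of_nat_mono)
      also have "\<dots> \<le> real (card {i \<in> {1..n}. ?A i})"
        using N(1) by (intro of_nat_mono card_mono) auto
      finally show ?thesis .
    qed
    then have "s N * real N / real (digit_position (Suc N)) \<le> real (card {i \<in> {1..n}. ?A i}) / real (digit_position (Suc N))"
      by (rule divide_right_mono) simp
    also have "\<dots> \<le> real (card {i \<in> {1..n}. ?A i}) / real n"
      using N(2) elim by (intro divide_left_mono) auto
    finally have "s N * (real N / real (digit_position (Suc N))) \<le> freq ?A n" by (simp add: freq_def)
    then show ?case using N0[OF \<open>N0 \<le> N\<close>] by linarith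
  qed
qed

text \<open>The \<open>g\<close>-adic intervals of one level partition \<open>[0, 1)\<close>, so
  their frequencies sum to 1 and the lower bounds on their open interiors determine the
  limits.\<close>

lemma normal_base_if_cell_normal:
  assumes z: "0 \<le> z" "z < 1" "cell_normal z"
  shows "z \<in> normal_numbers_base g"
  unfolding normal_numbers_base_iff[OF g z(1,2)]
proof (intro allI impI)
  fix k v assume "k \<ge> 1" and v: "v < g ^ k"
  let ?X = "\<lambda>v. freq (\<lambda>i. orbit_rem (\<lambda>_. g) z (i - 1) \<in> adic_interval g k v)"
  have gk: "real (g ^ k) > 0" using g by simp
  show "?X v \<longlonglongrightarrow> 1 / real (g ^ k)"
  proof (rule tendsto_if_lower_bounds[where I = "{..<g ^ k}" and X = ?X])
    have disjoint: "w = w'" if "r \<in> adic_interval g k w" "r \<in> adic_interval g k w'" for r w w'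
    proof -
      have "real w \<le> real (g ^ k) * r" "real (g ^ k) * r < real w + 1" "real w' \<le> real (g ^ k) * r" "real (g ^ k) * r < real w' + 1"
        using that gk unfolding adic_interval_def by (auto simp: field_simps simp del: of_nat_power)
      then show ?thesis by linarith
    qed
    have cover: "\<exists>w\<in>{..<g ^ k}. orbit_rem (\<lambda>_. g) z i \<in> adic_interval g k w" for i
    proof
      let ?r = "orbit_rem (\<lambda>_. g) z i"
      let ?w = "nat \<lfloor>real (g ^ k) * ?r\<rfloor>"
      have y: "0 \<le> real (g ^ k) * ?r" "real (g ^ k) * ?r < real (g ^ k)" using orbit_rem_bounds[of "\<lambda>_. g" z i] gk by auto
      then have "real ?w \<le> real (g ^ k) * ?r" "real (g ^ k) * ?r < real ?w + 1" by linarith+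
      then show "?r \<in> adic_interval g k ?w" using gk unfolding adic_interval_def by (auto simp: field_simps simp del: of_nat_power)
      show "?w \<in> {..<g ^ k}" using y by (simp add: nat_less_iff floor_less_iff)
    qed
    have "(\<Sum>w<g ^ k. ?X w N) = 1" if "N > 0" for N
    proof -
      have "(\<Sum>w<g ^ k. ?X w N) = freq (\<lambda>i. \<exists>w\<in>{..<g ^ k}. orbit_rem (\<lambda>_. g) z (i - 1) \<in> adic_interval g k w) N"
        by (rule freq_bex_disjoint[symmetric]) (auto intro: disjoint)
      also have "\<dots> = freq (\<lambda>_. True) N" by (intro freq_cong) (use cover in simp)
      also have "\<dots> = 1" using that unfolding freq_eq_sum by simp
      finally show ?thesis .
    qed
    moreover have "(\<Sum>w<g ^ k. 1 / real (g ^ k)) = (1::real)" using gk by simp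
    ultimately show "(\<lambda>N. \<Sum>w<g ^ k. ?X w N) \<longlonglongrightarrow> (\<Sum>w<g ^ k. 1 / real (g ^ k))"
      by (intro tendsto_eventually) (auto intro!: eventually_mono[OF eventually_gt_at_top[of 0]])
    fix w and e :: real assume w: "w \<in> {..<g ^ k}" and e: "e > 0"
    let ?a = "real w / real (g ^ k)" and ?b = "(real w + 1) / real (g ^ k)"
    have "real w + 1 \<le> real (g ^ k)" using w by (simp only: lessThan_iff)
    then have ab: "0 \<le> ?a" "?a \<le> ?b" "?b \<le> 1" using gk by (auto simp: divide_right_mono simp del: of_nat_power)
    have "?b - ?a = 1 / real (g ^ k)" by (simp add: diff_divide_distrib[symmetric])
    with base_lower_frequency[OF z ab e]
    have "eventually (\<lambda>N. freq (\<lambda>i. orbit_rem (\<lambda>_. g) z (i - 1) \<in> {?a<..<?b}) N \<ge> 1 / real (g ^ k) - e) sequentially"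
      by simp
    then show "eventually (\<lambda>N. ?X w N \<ge> 1 / real (g ^ k) - e) sequentially"
    proof eventually_elim
      case (elim N)
      have "freq (\<lambda>i. orbit_rem (\<lambda>_. g) z (i - 1) \<in> {?a<..<?b}) N \<le> ?X w N"
        by (rule freq_mono) (auto simp: adic_interval_def)
      then show ?case using elim by linarith
    qed
  qed (use v in auto)
qed

lemma all_equal_cell_normal:
  "N_Q Q = {z \<in> {0..<1}. cell_normal z}" "DN_Q Q = {z \<in> {0..<1}. cell_normal z}"
  "UN_Q Q = {z \<in> {0..<1}. cell_normal z}" "UDN_Q M T f x = {z \<in> {0..<1}. cell_normal z}"
  "normal_numbers_base g = {z \<in> {0..<1}. cell_normal z}"
proof -
  have eqI: "A = {z \<in> {0..<1}. cell_normal z}"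
    if sub: "A \<subseteq> {0..<1}" and iff: "\<And>z. 0 \<le> z \<Longrightarrow> z < 1 \<Longrightarrow> z \<in> A \<longleftrightarrow> cell_normal z" for A
  proof (intro set_eqI iffI)
    fix z assume "z \<in> A"
    then show "z \<in> {z \<in> {0..<1}. cell_normal z}" using sub iff[of z] by auto
  qed (use iff in simp)
  show "N_Q Q = {z \<in> {0..<1}. cell_normal z}"
    by (rule eqI, unfold N_Q_def, blast, fold N_Q_def, rule iffI, erule cell_normal_if_N_Q, rule N_Q_if_cell_normal)
  show "DN_Q Q = {z \<in> {0..<1}. cell_normal z}"
    by (rule eqI, unfold DN_Q_def, blast, fold DN_Q_def, rule iffI, erule cell_normal_if_DN_Q, rule DN_Q_if_cell_normal)
  show "UN_Q Q = {z \<in> {0..<1}. cell_normal z}"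
    by (rule eqI, unfold UN_Q_def, blast, fold UN_Q_def, rule UN_Q_iff_cell_normal)
  show "UDN_Q M T f x = {z \<in> {0..<1}. cell_normal z}"
    by (rule eqI, unfold UDN_Q_def, blast, fold UDN_Q_def, rule iffI, erule cell_normal_if_UDN_Q, rule UDN_Q_if_cell_normal)
  show "normal_numbers_base g = {z \<in> {0..<1}. cell_normal z}"
    by (rule eqI, unfold normal_numbers_base_def, blast, fold normal_numbers_base_def, rule iffI, erule cell_normal_if_normal_base, rule normal_base_if_cell_normal)
qed

end

theorem theorem1p7:
  fixes g :: nat and Q :: "nat \<Rightarrow> nat"
    and M :: "'a::polish_space measure" and T :: "'a \<Rightarrow> 'a" and f :: "'a \<Rightarrow> nat" and x :: 'a
  assumes "g \<ge> 2"
    and "basic_sequence Q"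
    and "\<forall>n\<ge>1. \<exists>k\<ge>1. Q n = g ^ k"
    and "generated_by Q M T f x"
    and "ergodic M T"
    and "ks_entropy M T = 0"
    and "(\<integral>\<^sup>+ u. ennreal (ln (real (f u))) \<partial>M) < \<infinity>"
  shows "N_Q Q = DN_Q Q \<and> DN_Q Q = UN_Q Q \<and> UN_Q Q = UDN_Q M T f x \<and> UDN_Q M T f x = normal_numbers_base g"
proof -
  interpret generated_power_sequence g Q M T f x
    by unfold_locales (fact assms)+
  show ?thesis unfolding all_equal_cell_normal by simp
qed

end
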